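(* Let $\alpha>0$ and let $\{\mathbf E^k\}$ satisfy $\|\mathbf E^k\times n-\mathbf E^{obs}\times n\|_{L^2(\Gamma)}\to0$ as $k\to+\infty$. For each $k$ let $\sigma_k\in K_h$ be a minimizer over $K_h$ of the functional $$\sigma_h\mapsto \tfrac12\|\mathbf E_h(\sigma_h)\times n-\mathbf E^{k}\times n\|_{L^2(\Gamma)}^2+\alpha\,|D\sigma_h|(\Omega_C).$$ Then any limit point of $\{\sigma_k\}$ solves $$\min_{\sigma_h\in K_h}\ \phi_\alpha(\sigma_h)=G_h(\sigma_h)+\alpha\,|D\sigma_h|(\Omega_C).$$
   Context: Setting (fixed throughout). $\Omega\subset\mathbb R^3$ is a convex bounded domain consisting of a non-conducting part $\Omega_0$ and a conducting part $\Omega_C=\Omega_1\cup\overline{\Omega}_2$, both polyhedral. $\Gamma$ is the upper boundary of $\Omega$ (part of $\partial\Omega_0$), $\Gamma_D$ is the rest of $\partial\Omega$, and $n$ is the unit outer normal. $\mu>0$ is constant, $\varepsilon>0$ is the permittivity in $\Omega_0$, $\omega>0$ is the angular frequency, $\mathbf J_s\in L^2(\Omega)^3$ with $\nabla\cdot\mathbf J_s=0$ in $\Omega$. The background conductivity $\sigma_0$ vanishes in $\Omega_0$ and is a positive constant in $\Omega_C$. $\mathbf E^{obs}\times n\in L^2(\Gamma)^3$ is the given data, and likewise $\mathbf E^k\times n\in L^2(\Gamma)^3$. Conductivities are real-valued and extended by zero outside $\Omega_C$. $H_\Gamma(\mathrm{curl};\Omega)=\{\mathbf u\in L^2(\Omega)^3:\nabla\times\mathbf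 u\in L^2(\Omega)^3,\ n\times\mathbf u=0\text{ on }\Gamma_D\}$, $H^1_\Gamma(\Omega_0)=\{v\in H^1(\Omega_0): v=0\text{ on }\partial\Omega_0\setminus\Gamma\}$ (complex-valued). Discretization. $\mathcal M_h$ is a (fixed) shape regular, quasi-uniform tetrahedral mesh of $\Omega$ of mesh size $h$, with sub-meshes $\mathcal M_0,\mathcal M_C$ fitting $\Omega_0,\Omega_C$. $R_h\subset H_\Gamma(\mathrm{curl};\Omega)$ is the lowest-order Nédélec edge element space; $U_h\subset H^1_\Gamma(\Omega_0)$ and $V_h\subset H^1_0(\Omega_C)$ (real-valued) are the linear Lagrange element spaces on $\mathcal M_0$ and $\mathcal M_C$. With $M>m>-\sigma_0|_{\Omega_C}$, let $K=\{\sigma\in BV(\Omega_C):\sigma\text{ compactly supported in }\Omega_C,\ m\le\sigma\le M\}$ and $K_h=V_h\cap K$. Limit points are taken in the finite-dimensional space $V_h$. For $\sigma_h\in K_h$ put $a_h(\mathbf E_h,\mathbf F_h)=\int_\Omega\mu^{-1}\nabla\times\mathbf E_h\cdot\nabla\times\overline{\mathbf F_h}-i\omega(\sigma_h+\sigma_0)\mathbf E_h\cdot\overline{\mathbf F_h}\,dx$ and $b(\mathbf E,\mathbf F)=\int_{\Omega_0}\varepsilon\mathbf E\cdot\overline{\mathbf F}\,dx$. The discrete state $\mathbf E_h=\mathbf E_h(\sigma_h)\in R_h$, together with $\phi_h\in U_h$, solves $a_h(\mathbf E_h,\mathbf F_h)+b(\nabla\phi_h,\mathbf F_h)=i\omega\int_\Omega\mathbf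 J_s\cdot\overline{\mathbf F_h}\,dx$ for all $\mathbf F_h\in R_h$, and $b(\mathbf E_h,\nabla\psi_h)=0$ for all $\psi_h\in U_h$. The discrete objective functional is $G_h(\sigma_h)=\frac12\|\mathbf E_h(\sigma_h)\times n-\mathbf E^{obs}\times n\|_{L^2(\Gamma)}^2$. The total variation is $|Du|(\Omega_C)=\sup\{\int_{\Omega_C}u\,\nabla\cdot g\,dx:\ g\in C_0^1(\Omega_C)^3,\ |g(x)|\le1\text{ in }\Omega_C\}$. *)

theory Defs
  imports "HOL-Analysis.Analysis"
begin

section \<open>Geometry and mesh\<close>

definition polyhedral_open :: "(real^3) set \<Rightarrow> bool" where
  "polyhedral_open S \<longleftrightarrow> open S \<and> bounded S \<and> S \<noteq> {} \<and>
     (\<exists>\<P>. finite \<P> \<and> (\<forall>P\<in>\<P>. polytope P \<and> aff_dim P \<le> 2) \<and> frontier S = \<Union>\<P>)"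

definition tetrahedral_mesh :: "(real^3) set set \<Rightarrow> (real^3) set \<Rightarrow> bool" where
  "tetrahedral_mesh \<M> S \<longleftrightarrow>
     triangulation \<M> \<and> (\<forall>T\<in>\<M>. 3 simplex T) \<and> \<Union>\<M> = closure S"

definition mesh_size :: "(real^3) set set \<Rightarrow> real" where
  "mesh_size \<M> = Max (diameter ` \<M>)"

definition shape_regular :: "real \<Rightarrow> (real^3) set set \<Rightarrow> bool" where
  "shape_regular \<kappa> \<M> \<longleftrightarrow>
     (\<forall>T\<in>\<M>. \<exists>x r. 0 < r \<and> ball x r \<subseteq> T \<and> diameter T \<le> \<kappa> * r)"

definition quasi_uniform :: "real \<Rightarrow> (real^3) set set \<Rightarrow> bool" where
  "quasi_uniform \<kappa> \<M> \<longleftrightarrow> (\<forall>T\<in>\<M>. mesh_size \<M> \<le> \<kappa> * diameter T)"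

definition mesh_faces :: "(real^3) set set \<Rightarrow> (real^3) set \<Rightarrow> (real^3) set set" where
  "mesh_faces \<M> G = {F. F \<subseteq> G \<and> (\<exists>T\<in>\<M>. F facet_of T)}"

text \<open>The unit outer normal of a convex set.  It is set to zero at the boundary points without a
  unique supporting half-space (for a polyhedron: on edges and at vertices, a null set).\<close>

definition outer_normal :: "(real^3) set \<Rightarrow> real^3 \<Rightarrow> real^3" where
  "outer_normal S x =
     (if \<exists>!\<nu>. norm \<nu> = 1 \<and> (\<forall>y\<in>S. \<nu> \<bullet> (y - x) \<le> 0)
      then THE \<nu>. norm \<nu> = 1 \<and> (\<forall>y\<in>S. \<nu> \<bullet> (y - x) \<le> 0) else 0)"


section \<open>Vector calculus\<close>

definition partial_deriv :: "3 \<Rightarrow> (real^3 \<Rightarrow> 'b::real_normed_vector) \<Rightarrow> real^3 \<Rightarrow> 'b" where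
  "partial_deriv i u x = frechet_derivative u (at x) (axis i 1)"

definition grad :: "(real^3 \<Rightarrow> 'b::real_normed_vector) \<Rightarrow> real^3 \<Rightarrow> 'b^3" where
  "grad u x = (\<chi> i. partial_deriv i u x)"

definition divergence :: "(real^3 \<Rightarrow> real^3) \<Rightarrow> real^3 \<Rightarrow> real" where
  "divergence u x = (\<Sum>i\<in>UNIV. partial_deriv i u x $ i)"

definition curl :: "(real^3 \<Rightarrow> ('b::real_normed_vector)^3) \<Rightarrow> real^3 \<Rightarrow> 'b^3" where
  "curl u x = vector
     [partial_deriv 2 u x $ 3 - partial_deriv 3 u x $ 2,
      partial_deriv 3 u x $ 1 - partial_deriv 1 u x $ 3,
      partial_deriv 1 u x $ 2 - partial_deriv 2 u x $ 1]"

text \<open>Cross product of a complex with a real vector.\<close>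

definition ccross :: "complex^3 \<Rightarrow> real^3 \<Rightarrow> complex^3" where
  "ccross u x = vector
     [u $ 2 * of_real (x $ 3) - u $ 3 * of_real (x $ 2),
      u $ 3 * of_real (x $ 1) - u $ 1 * of_real (x $ 3),
      u $ 1 * of_real (x $ 2) - u $ 2 * of_real (x $ 1)]"

definition rdot :: "complex^3 \<Rightarrow> real^3 \<Rightarrow> complex" where
  "rdot u x = (\<Sum>i\<in>UNIV. u $ i * of_real (x $ i))"

definition cdot :: "complex^3 \<Rightarrow> complex^3 \<Rightarrow> complex" where
  "cdot u v = (\<Sum>i\<in>UNIV. u $ i * cnj (v $ i))"

definition C1c :: "(real^3) set \<Rightarrow> (real^3 \<Rightarrow> 'b::real_normed_vector) set" where
  "C1c S = {u. (\<exists>u' :: real^3 \<Rightarrow> ((real^3) \<Rightarrow>\<^sub>L 'b).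
                  (\<forall>x. (u has_derivative blinfun_apply (u' x)) (at x)) \<and> continuous_on UNIV u')
              \<and> compact (closure {x. u x \<noteq> 0}) \<and> closure {x. u x \<noteq> 0} \<subseteq> S}"


section \<open>Function spaces\<close>

definition L2 :: "'a measure \<Rightarrow> ('a \<Rightarrow> 'b::real_normed_vector) set" where
  "L2 M = {u \<in> borel_measurable M. integrable M (\<lambda>x. (norm (u x))\<^sup>2)}"

definition divergence_free :: "(real^3) set \<Rightarrow> (real^3 \<Rightarrow> complex^3) \<Rightarrow> bool" where
  "divergence_free \<Omega> J \<longleftrightarrow>
     (\<forall>\<psi> :: real^3 \<Rightarrow> real. \<psi> \<in> C1c \<Omega> \<longrightarrow> (LINT x|lebesgue_on \<Omega>. rdot (J x) (grad \<psi> x)) = 0)"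

definition has_weak_curl ::
    "(real^3) set \<Rightarrow> (real^3 \<Rightarrow> complex^3) \<Rightarrow> (real^3 \<Rightarrow> complex^3) \<Rightarrow> bool" where
  "has_weak_curl \<Omega> u w \<longleftrightarrow>
     (\<forall>\<phi> \<in> C1c \<Omega>. (LINT x|lebesgue_on \<Omega>. rdot (u x) (curl \<phi> x))
                  = (LINT x|lebesgue_on \<Omega>. rdot (w x) (\<phi> x)))"

text \<open>The tangential trace of a field \<open>u\<close> with weak curl \<open>w\<close> vanishes on the relatively open
  boundary part \<open>frontier \<Omega> - \<Gamma>\<close>: the boundary term in Green's formula is zero for every
  test field that vanishes near the closed set \<open>\<Gamma>\<close>, but not necessarily on the rest of the
  boundary.\<close>

definition zero_tangential_trace_off ::
    "(real^3) set \<Rightarrow> (real^3) set \<Rightarrow> (real^3 \<Rightarrow> complex^3) \<Rightarrow> (real^3 \<Rightarrow> complex^3) \<Rightarrow> bool" where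
  "zero_tangential_trace_off \<Gamma> \<Omega> u w \<longleftrightarrow>
     (\<forall>\<phi> \<in> C1c (- \<Gamma>). (LINT x|lebesgue_on \<Omega>. rdot (u x) (curl \<phi> x))
                      = (LINT x|lebesgue_on \<Omega>. rdot (w x) (\<phi> x)))"

definition Hcurl :: "(real^3) set \<Rightarrow> (real^3) set \<Rightarrow> (real^3 \<Rightarrow> complex^3) set" where
  "Hcurl \<Gamma> \<Omega> = {u \<in> L2 (lebesgue_on \<Omega>).
     \<exists>w \<in> L2 (lebesgue_on \<Omega>). has_weak_curl \<Omega> u w \<and> zero_tangential_trace_off \<Gamma> \<Omega> u w}"

text \<open>Total variation, as a value in \<open>[0, \<infinity>]\<close>.\<close>

definition total_variation :: "(real^3) set \<Rightarrow> (real^3 \<Rightarrow> real) \<Rightarrow> ereal" where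
  "total_variation \<Omega> u =
     (SUP g \<in> {g \<in> C1c \<Omega>. \<forall>x\<in>\<Omega>. norm (g x) \<le> 1}.
        ereal (LINT x|lebesgue_on \<Omega>. u x * divergence g x))"

definition BV :: "(real^3) set \<Rightarrow> (real^3 \<Rightarrow> real) set" where
  "BV \<Omega> = {u. integrable (lebesgue_on \<Omega>) u \<and> total_variation \<Omega> u < \<infinity>}"

definition admissible :: "(real^3) set \<Rightarrow> real \<Rightarrow> real \<Rightarrow> (real^3 \<Rightarrow> real) set" where
  "admissible \<Omega>\<^sub>C m M = {\<sigma> \<in> BV \<Omega>\<^sub>C.
      (\<forall>x. x \<notin> \<Omega>\<^sub>C \<longrightarrow> \<sigma> x = 0) \<and>
      compact (closure {x. \<sigma> x \<noteq> 0}) \<and> closure {x. \<sigma> x \<noteq> 0} \<subseteq> \<Omega>\<^sub>C \<and>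
      (\<forall>x\<in>\<Omega>\<^sub>C. m \<le> \<sigma> x \<and> \<sigma> x \<le> M)}"


section \<open>Finite element spaces\<close>

text \<open>Elements of \<open>L\<^sup>2\<close> are classes modulo null sets.  The representative chosen for an edge
  element field is the one that vanishes off the open tetrahedra, so that fields which agree
  almost everywhere in the domain are equal.  On an open tetrahedron the weak curl is the classical
  one, hence \<open>curl\<close> can be used for these fields under integrals.\<close>

definition nedelec_space ::
    "(real^3) set \<Rightarrow> (real^3) set \<Rightarrow> (real^3) set set \<Rightarrow> (real^3 \<Rightarrow> complex^3) set" where
  "nedelec_space \<Gamma> \<Omega> \<M> = {u \<in> Hcurl \<Gamma> \<Omega>.
      (\<forall>T\<in>\<M>. \<exists>a b. \<forall>x \<in> interior T. u x = a + ccross b x) \<and>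
      (\<forall>x. x \<notin> (\<Union>T\<in>\<M>. interior T) \<longrightarrow> u x = 0)}"

text \<open>Linear Lagrange elements on \<open>\<M>\<close> with zero boundary values on \<open>D\<close>, extended by zero outside
  the mesh.  As these functions are continuous, the trace is a pointwise restriction.\<close>

definition lagrange_space ::
    "(real^3) set \<Rightarrow> (real^3) set set \<Rightarrow> (real^3 \<Rightarrow> 'b::real_normed_vector) set" where
  "lagrange_space D \<M> = {v. continuous_on (\<Union>\<M>) v \<and>
      (\<forall>T\<in>\<M>. \<exists>c l. linear l \<and> (\<forall>x\<in>T. v x = c + l x)) \<and>
      (\<forall>x\<in>D. v x = 0) \<and> (\<forall>x. x \<notin> \<Union>\<M> \<longrightarrow> v x = 0)}"


section \<open>Surface integrals and tangential traces\<close>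

definition ref_triangle :: "(real \<times> real) set" where
  "ref_triangle = {(s, t). 0 \<le> s \<and> 0 \<le> t \<and> s + t \<le> 1}"

definition triangle_vertices :: "(real^3) set \<Rightarrow> (real^3) \<times> (real^3) \<times> (real^3)" where
  "triangle_vertices F = (SOME (a, b, c). F = convex hull {a, b, c})"

definition triangle_param :: "(real^3) set \<Rightarrow> real \<times> real \<Rightarrow> real^3" where
  "triangle_param F = (case triangle_vertices F of (a, b, c) \<Rightarrow>
     \<lambda>(s, t). a + s *\<^sub>R (b - a) + t *\<^sub>R (c - a))"

definition triangle_jacobian :: "(real^3) set \<Rightarrow> real" where
  "triangle_jacobian F = (case triangle_vertices F of (a, b, c) \<Rightarrow> norm (cross3 (b - a) (c - a)))"

definition surface_L2 :: "(real^3) set set \<Rightarrow> (real^3 \<Rightarrow> complex^3) set" where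
  "surface_L2 \<F> = {f. \<forall>F\<in>\<F>. (\<lambda>p. f (triangle_param F p)) \<in> L2 (lebesgue_on ref_triangle)}"

definition surface_L2_norm :: "(real^3) set set \<Rightarrow> (real^3 \<Rightarrow> complex^3) \<Rightarrow> real" where
  "surface_L2_norm \<F> f = sqrt (\<Sum>F\<in>\<F>. triangle_jacobian F *
      (LINT p|lebesgue_on ref_triangle. (norm (f (triangle_param F p)))\<^sup>2))"

text \<open>Boundary values from inside.  For an edge element field the limit exists in the relative
  interior of every boundary face, that is, almost everywhere on the boundary.\<close>

definition inner_trace :: "(real^3) set \<Rightarrow> (real^3 \<Rightarrow> complex^3) \<Rightarrow> real^3 \<Rightarrow> complex^3" where
  "inner_trace \<Omega> u x = Lim (at x within \<Omega>) u"

definition tangential :: "(real^3) set \<Rightarrow> (real^3 \<Rightarrow> complex^3) \<Rightarrow> real^3 \<Rightarrow> complex^3" where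
  "tangential \<Omega> g x = ccross (g x) (outer_normal \<Omega> x)"

definition misfit ::
    "(real^3) set \<Rightarrow> (real^3) set set \<Rightarrow> (real^3 \<Rightarrow> complex^3) \<Rightarrow> (real^3 \<Rightarrow> complex^3) \<Rightarrow> real" where
  "misfit \<Omega> \<F> E g = 1 / 2 *
     (surface_L2_norm \<F> (\<lambda>x. tangential \<Omega> (inner_trace \<Omega> E) x - tangential \<Omega> g x))\<^sup>2"


section \<open>Discrete state equation\<close>

definition form_a :: "(real^3) set \<Rightarrow> real \<Rightarrow> real \<Rightarrow> (real^3 \<Rightarrow> real) \<Rightarrow>
    (real^3 \<Rightarrow> complex^3) \<Rightarrow> (real^3 \<Rightarrow> complex^3) \<Rightarrow> complex" where
  "form_a \<Omega> \<mu> \<omega> \<gamma> E F =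
     (LINT x|lebesgue_on \<Omega>. of_real (1 / \<mu>) * cdot (curl E x) (curl F x)
                           - \<i> * of_real \<omega> * of_real (\<gamma> x) * cdot (E x) (F x))"

definition form_b :: "(real^3) set \<Rightarrow> (real^3 \<Rightarrow> real) \<Rightarrow>
    (real^3 \<Rightarrow> complex^3) \<Rightarrow> (real^3 \<Rightarrow> complex^3) \<Rightarrow> complex" where
  "form_b \<Omega>\<^sub>0 \<epsilon> E F = (LINT x|lebesgue_on \<Omega>\<^sub>0. of_real (\<epsilon> x) * cdot (E x) (F x))"

text \<open>\<open>E\<close> is the field component of a solution of the discrete problem with total
  conductivity \<open>\<gamma>\<close>; the multiplier \<open>\<phi>\<close> is piecewise linear, so its gradient is classical
  almost everywhere.\<close>

definition discrete_state ::
    "(real^3) set \<Rightarrow> (real^3) set \<Rightarrow> real \<Rightarrow> (real^3 \<Rightarrow> real) \<Rightarrow> real \<Rightarrow> (real^3 \<Rightarrow> complex^3) \<Rightarrow>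
     (real^3 \<Rightarrow> complex^3) set \<Rightarrow> (real^3 \<Rightarrow> complex) set \<Rightarrow>
     (real^3 \<Rightarrow> real) \<Rightarrow> (real^3 \<Rightarrow> complex^3) \<Rightarrow> bool" where
  "discrete_state \<Omega> \<Omega>\<^sub>0 \<mu> \<epsilon> \<omega> J R U \<gamma> E \<longleftrightarrow> E \<in> R \<and>
     (\<exists>\<phi>\<in>U.
        (\<forall>F\<in>R. form_a \<Omega> \<mu> \<omega> \<gamma> E F + form_b \<Omega>\<^sub>0 \<epsilon> (grad \<phi>) F
               = \<i> * of_real \<omega> * (LINT x|lebesgue_on \<Omega>. cdot (J x) (F x))) \<and>
        (\<forall>\<psi>\<in>U. form_b \<Omega>\<^sub>0 \<epsilon> E (grad \<psi>) = 0))"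


section \<open>Limit points\<close>

text \<open>On a finite-dimensional space of bounded functions, convergence is uniform convergence.\<close>

definition limit_point_in ::
    "(real^3 \<Rightarrow> real) set \<Rightarrow> (nat \<Rightarrow> real^3 \<Rightarrow> real) \<Rightarrow> (real^3 \<Rightarrow> real) \<Rightarrow> bool" where
  "limit_point_in V s \<sigma> \<longleftrightarrow> \<sigma> \<in> V \<and>
     (\<exists>r :: nat \<Rightarrow> nat. strict_mono r \<and> uniform_limit UNIV (\<lambda>j. s (r j)) \<sigma> sequentially)"

end

theory Submission
  imports Defs
begin

text \<open>The mesh is fixed, so the edge element space is finite-dimensional and the unique solvability
  of the discrete problem makes the state, hence the misfit, continuous in the conductivity under
  uniform convergence.  The total variation is lower semicontinuous, being a supremum of functionals
  that are continuous under uniform convergence.  For a single test field \<open>g\<close> the minimality of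
  \<open>\<sigma>\<^sub>k\<close> gives misfit plus \<open>\<alpha> \<integral> \<sigma>\<^sub>k \<nabla>\<cdot>g\<close> at most the functional at any competitor; one passes to the limit
  in \<open>k\<close> and only then takes the supremum over \<open>g\<close>.\<close>

section \<open>Finite-dimensional spaces of functions\<close>

text \<open>Unique solvability is available only for conductivities in \<open>K\<^sub>h\<close>, so
  the limit has to be placed there before the state at the limit can be identified. Two conditions
  resist. Finite variation comes from comparison with a fixed competitor after discarding the
  nonnegative misfit. Compact support in the open conductor is usually lost in a limit; here a mesh
  function supported inside vanishes on every cell that touches the boundary, so all supports share
  one compact union of cells. No coercivity or inf-sup constant enters: continuity of the state is a
  compactness argument that uses uniqueness at the limit alone. It is run in coordinates, which are
  linear functionals on the discrete space. Point values, forms with one argument fixed (up to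
  conjugation) and boundary traces are then all combinations of finitely many coordinates. The trace
  is a pointwise limit, and becomes such a functional because the domain near the inside of a
  boundary face lies in one open cell.\<close>

definition csubspace :: "('i \<Rightarrow> complex) set \<Rightarrow> bool" where
  "csubspace S \<longleftrightarrow> S \<noteq> {} \<and> (\<forall>f\<in>S. \<forall>g\<in>S. \<forall>c. (\<lambda>i. f i + c * g i) \<in> S)"

lemma csubspace_add:
  assumes "csubspace S" "f \<in> S" "g \<in> S"
  shows "(\<lambda>i. f i + c * g i) \<in> S"
  using assms by (auto simp: csubspace_def)

lemma csubspace_zero: "csubspace S \<Longrightarrow> (\<lambda>i. 0) \<in> S"
proof -
  assume S: "csubspace S"
  then obtain f where "f \<in> S" by (auto simp: csubspace_def)
  with csubspace_add[OF S this this, of "-1"] show ?thesis by simp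
qed

lemma csubspace_scale: "csubspace S \<Longrightarrow> f \<in> S \<Longrightarrow> (\<lambda>i. c * f i) \<in> S"
  using csubspace_add[OF _ csubspace_zero, of S f c] by simp

lemma csubspace_sum:
  assumes S: "csubspace S" and "finite I" and "\<And>i. i \<in> I \<Longrightarrow> e i \<in> S"
  shows "(\<lambda>j. \<Sum>i\<in>I. c i * e i j) \<in> S"
  using assms(2,3)
proof (induction I rule: finite_induct)
  case empty
  then show ?case using csubspace_zero[OF S] by simp
next
  case (insert a I)
  then have "(\<lambda>j. \<Sum>i\<in>I. c i * e i j) \<in> S" and "e a \<in> S" by auto
  from csubspace_add[OF S this, of "c a"] insert.hyps show ?case
    by (simp add: add.commute)
qed

text \<open>Gaussian elimination on the coordinates: a new coordinate \<open>a\<close> is either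
  determined on all of \<open>S\<close> by the selected ones, or some element of \<open>S\<close>
  vanishes on \<open>I\<close> but not at \<open>a\<close> and supplies a new basis
  function.\<close>

lemma csubspace_nodal_basis:
  assumes S: "csubspace S" and "finite I"
  shows "\<exists>I'\<subseteq>I. \<exists>e. (\<forall>i\<in>I'. e i \<in> S) \<and> (\<forall>f\<in>S. \<forall>j\<in>I. f j = (\<Sum>i\<in>I'. f i * e i j))"
  using \<open>finite I\<close>
proof (induction I rule: finite_induct)
  case empty
  then show ?case by auto
next
  case (insert a I)
  then obtain I' e where sub: "I' \<subseteq> I" and e: "\<And>i. i \<in> I' \<Longrightarrow> e i \<in> S"
    and rep: "\<And>f j. f \<in> S \<Longrightarrow> j \<in> I \<Longrightarrow> f j = (\<Sum>i\<in>I'. f i * e i j)" by metis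
  have fin: "finite I'" using sub insert.hyps finite_subset by blast
  have rest: "(\<lambda>j. f j - (\<Sum>i\<in>I'. f i * e i j)) \<in> S" if "f \<in> S" for f
    using csubspace_add[OF S that csubspace_sum[OF S fin e, where c = f], where c = "-1"] by simp
  show ?case
  proof (cases "\<exists>g\<in>S. (\<forall>j\<in>I. g j = 0) \<and> g a \<noteq> 0")
    case False
    \<comment> \<open>The remainder of \<open>f\<close> lies in \<open>S\<close> and vanishes on
      \<open>I\<close>, so in this case it vanishes at \<open>a\<close> too.\<close>
    have "f a = (\<Sum>i\<in>I'. f i * e i a)" if "f \<in> S" for f
      using False rest[OF that] rep[OF that] by force
    then show ?thesis using sub e rep by (intro exI[of _ I'] conjI exI[of _ e]) auto
  next
    case True
    then obtain g where g: "g \<in> S" "\<And>j. j \<in> I \<Longrightarrow> g j = 0" "g a \<noteq> 0" by auto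
    \<comment> \<open>\<open>g\<close> is scaled to 1 at \<open>a\<close>, and each old function is
      corrected to vanish there; \<open>g\<close> being zero on \<open>I\<close>, the values at the
      old coordinates do not change.\<close>
    define e' where "e' i = (if i = a then (\<lambda>j. g j / g a) else (\<lambda>j. e i j - e i a / g a * g j))" for i
    have a: "a \<notin> I'" using sub insert.hyps by auto
    have "e' i \<in> S" if "i \<in> insert a I'" for i
    proof (cases "i = a")
      case True
      then show ?thesis using csubspace_scale[OF S g(1), of "1 / g a"] by (simp add: e'_def)
    next
      case False
      then show ?thesis using that csubspace_add[OF S e g(1), of i "- e i a / g a"]
        by (simp add: e'_def)
    qed
    moreover have "f j = (\<Sum>i\<in>insert a I'. f i * e' i j)" if f: "f \<in> S" and j: "j \<in> insert a I" for f j
    proof -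
      have "(\<Sum>i\<in>insert a I'. f i * e' i j) = f a * g j / g a + (\<Sum>i\<in>I'. f i * (e i j - e i a / g a * g j))"
        using a fin by (auto simp: e'_def intro!: sum.cong)
      also have "\<dots> = f j"
      proof (cases "j = a")
        case True
        then show ?thesis using g(3) by simp
      next
        case False
        then show ?thesis using j g(2) rep[OF f] by simp
      qed
      finally show ?thesis by simp
    qed
    ultimately show ?thesis using sub by (intro exI[of _ "insert a I'"] conjI exI[of _ e']) auto
  qed
qed

text \<open>Finite-dimensional subspaces are closed: the limit coordinates, used as coefficients of
  the nodal basis, produce the required element.\<close>

lemma csubspace_closed:
  assumes S: "csubspace S" and I: "finite I" and f: "\<And>n. f n \<in> S"
    and lim: "\<And>i. i \<in> I \<Longrightarrow> (\<lambda>n::nat. f n i) \<longlonglongrightarrow> l i"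
  shows "\<exists>g\<in>S. \<forall>i\<in>I. g i = l i"
proof -
  obtain I' e where sub: "I' \<subseteq> I" and e: "\<And>i. i \<in> I' \<Longrightarrow> e i \<in> S"
    and rep: "\<And>f j. f \<in> S \<Longrightarrow> j \<in> I \<Longrightarrow> f j = (\<Sum>i\<in>I'. f i * e i j)"
    using csubspace_nodal_basis[OF S I] by metis
  have fin: "finite I'" using sub I finite_subset by blast
  have "(\<Sum>i\<in>I'. l i * e i j) = l j" if "j \<in> I" for j
  proof (rule LIMSEQ_unique)
    show "(\<lambda>n. f n j) \<longlonglongrightarrow> l j" using lim that .
    show "(\<lambda>n. f n j) \<longlonglongrightarrow> (\<Sum>i\<in>I'. l i * e i j)"
      unfolding rep[OF f that] using lim sub by (intro tendsto_intros) auto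
  qed
  then show ?thesis using csubspace_sum[OF S fin e] by (intro bexI[of _ "\<lambda>j. \<Sum>i\<in>I'. l i * e i j"]) auto
qed

text \<open>Bolzano-Weierstrass, one coordinate at a time; a further subsequence keeps the limits
  already found.\<close>

lemma finite_coordinates_convergent_subseq:
  fixes y :: "nat \<Rightarrow> 'i \<Rightarrow> complex"
  assumes "finite I" and "\<And>n i. i \<in> I \<Longrightarrow> norm (y n i) \<le> C"
  shows "\<exists>r :: nat \<Rightarrow> nat. \<exists>z. strict_mono r \<and> (\<forall>i\<in>I. (\<lambda>n. y (r n) i) \<longlonglongrightarrow> z i)"
  using assms
proof (induction I rule: finite_induct)
  case empty
  then show ?case by (auto intro: strict_mono_id)
next
  case (insert a I)
  then obtain r z where r: "strict_mono r" and z: "\<And>i. i \<in> I \<Longrightarrow> (\<lambda>n. y (r n) i) \<longlonglongrightarrow> z i" by blast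
  have "bounded (range (\<lambda>n. y (r n) a))" using insert.prems by (auto simp: bounded_iff)
  then obtain l s where s: "strict_mono s" and l: "((\<lambda>n. y (r n) a) \<circ> s) \<longlonglongrightarrow> l"
    using bounded_imp_convergent_subsequence by blast
  have "(\<lambda>n. y ((r \<circ> s) n) i) \<longlonglongrightarrow> (z(a := l)) i" if "i \<in> insert a I" for i
    using that l LIMSEQ_subseq_LIMSEQ[OF z s] by (auto simp: o_def)
  with strict_mono_o[OF r s] show ?case by blast
qed

text \<open>If the errors did not vanish, their normalisations would accumulate at a nonzero solution of
  the homogeneous limit system.\<close>

lemma linear_systems_solutions_converge:
  fixes A :: "nat \<Rightarrow> 'i \<Rightarrow> 'b \<Rightarrow> complex" and x :: "nat \<Rightarrow> 'i \<Rightarrow> complex"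
  assumes I: "finite I" and B: "finite B" and X: "csubspace X" and \<Phi>: "csubspace \<Phi>"
    and A: "\<And>i b. i \<in> I \<Longrightarrow> b \<in> B \<Longrightarrow> (\<lambda>k. A k i b) \<longlonglongrightarrow> A' i b"
    and x: "\<And>k. x k \<in> X" and x': "x' \<in> X"
    and eq: "\<And>k. \<exists>g\<in>\<Phi>. \<forall>b\<in>B. (\<Sum>i\<in>I. x k i * A k i b) - (\<Sum>i\<in>I. x' i * A' i b) = g b"
    and unique: "\<And>y g. y \<in> X \<Longrightarrow> g \<in> \<Phi> \<Longrightarrow> (\<And>b. b \<in> B \<Longrightarrow> (\<Sum>i\<in>I. y i * A' i b) = g b)
                   \<Longrightarrow> \<forall>i\<in>I. y i = 0"
    and i: "i \<in> I"
  shows "(\<lambda>k. x k i) \<longlonglongrightarrow> x' i"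
proof -
  define N where "N k = (\<Sum>i\<in>I. norm (x k i - x' i))" for k
  have N0: "N k \<ge> 0" for k by (simp add: N_def sum_nonneg)
  have "N \<longlonglongrightarrow> 0"
  proof (rule ccontr)
    assume "\<not> N \<longlonglongrightarrow> 0"
    then obtain \<delta> where \<delta>: "\<delta> > 0" and "\<And>n. \<exists>k\<ge>n. N k \<ge> \<delta>"
      using N0 by (auto simp: LIMSEQ_iff not_less)
    then have "infinite {k. N k \<ge> \<delta>}" by (auto simp: infinite_nat_iff_unbounded_le)
    then obtain r :: "nat \<Rightarrow> nat" where r: "strict_mono r" and Nr: "\<And>n. N (r n) \<ge> \<delta>"
      using infinite_enumerate by blast
    \<comment> \<open>\<open>t\<close> rescales the error along a subsequence where it stays above
      \<delta>: the rescaled errors have total size 1, and \<open>t\<close> itself is at most 1 /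
      \<delta>.\<close>
    define t where "t n = complex_of_real (1 / N (r n))" for n
    define y where "y n = (\<lambda>i. t n * (x (r n) i - x' i))" for n
    have Npos: "N (r n) > 0" for n using Nr[of n] \<delta> by linarith
    have "norm (y n i) \<le> 1" if "i \<in> I" for n i
    proof -
      have "norm (x (r n) i - x' i) \<le> N (r n)"
        unfolding N_def by (rule member_le_sum) (use that I in auto)
      then show ?thesis using Npos[of n] by (simp add: y_def t_def norm_mult norm_divide)
    qed
    then obtain s z where s: "strict_mono s" and z: "\<And>i. i \<in> I \<Longrightarrow> (\<lambda>n. y (s n) i) \<longlonglongrightarrow> z i"
      using finite_coordinates_convergent_subseq[OF I, of y 1] by metis
    have rs: "strict_mono (r \<circ> s)" using strict_mono_o[OF r s] .
    have yX: "y n \<in> X" for n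
      using csubspace_scale[OF X csubspace_add[OF X x x', of "r n" "-1"], of "t n"] by (simp add: y_def)
    obtain z' where z': "z' \<in> X" "\<And>i. i \<in> I \<Longrightarrow> z' i = z i"
      using csubspace_closed[OF X I, of "\<lambda>n. y (s n)" z] yX z by blast
    obtain g where g: "\<And>k. g k \<in> \<Phi>"
      and gb: "\<And>k b. b \<in> B \<Longrightarrow> g k b = (\<Sum>i\<in>I. x k i * A k i b) - (\<Sum>i\<in>I. x' i * A' i b)"
      using eq by metis
    have tb: "norm (t n) \<le> 1 / \<delta>" for n
      using Nr[of n] \<delta> Npos[of n] by (simp add: t_def norm_divide frac_le)
    \<comment> \<open>The residual splits into the system applied to the rescaled error and the
      change of the matrix applied to the fixed \<open>x'\<close>; the latter tends to 0 because
      \<open>t\<close> is bounded.\<close>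
    have lim: "(\<lambda>n. t (s n) * g (r (s n)) b) \<longlonglongrightarrow> (\<Sum>i\<in>I. z' i * A' i b)" if b: "b \<in> B" for b
    proof -
      have As: "(\<lambda>n. A (r (s n)) i b) \<longlonglongrightarrow> A' i b" if "i \<in> I" for i
        using LIMSEQ_subseq_LIMSEQ[OF A[OF that b] rs] by (simp add: o_def)
      have "t (s n) * g (r (s n)) b = (\<Sum>i\<in>I. y (s n) i * A (r (s n)) i b)
            + t (s n) * (\<Sum>i\<in>I. x' i * (A (r (s n)) i b - A' i b))" for n
        by (simp add: gb[OF b] y_def algebra_simps sum_subtractf sum.distrib sum_distrib_left)
      moreover have "(\<lambda>n. \<Sum>i\<in>I. y (s n) i * A (r (s n)) i b) \<longlonglongrightarrow> (\<Sum>i\<in>I. z' i * A' i b)"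
        by (intro tendsto_sum tendsto_mult As) (auto simp: z' intro: z)
      moreover have "(\<lambda>n. t (s n) * (\<Sum>i\<in>I. x' i * (A (r (s n)) i b - A' i b))) \<longlonglongrightarrow> 0"
      proof (rule Lim_null_comparison)
        have "(\<lambda>n. \<Sum>i\<in>I. x' i * (A (r (s n)) i b - A' i b)) \<longlonglongrightarrow> (\<Sum>i\<in>I. x' i * (A' i b - A' i b))"
          by (intro tendsto_intros As)
        then show "(\<lambda>n. 1 / \<delta> * norm (\<Sum>i\<in>I. x' i * (A (r (s n)) i b - A' i b))) \<longlonglongrightarrow> 0"
          by (intro tendsto_mult_right_zero tendsto_norm_zero) simp
        show "\<forall>\<^sub>F n in sequentially. norm (t (s n) * (\<Sum>i\<in>I. x' i * (A (r (s n)) i b - A' i b)))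
            \<le> 1 / \<delta> * norm (\<Sum>i\<in>I. x' i * (A (r (s n)) i b - A' i b))"
          using tb by (intro always_eventually allI) (simp only: norm_mult, intro mult_right_mono, auto)
      qed
      ultimately show ?thesis using tendsto_add by fastforce
    qed
    \<comment> \<open>The values of \<Phi> at the finitely many points of \<open>B\<close> form a
      closed set, so the limit residual again comes from \<Phi>.\<close>
    obtain h where h: "h \<in> \<Phi>" "\<And>b. b \<in> B \<Longrightarrow> h b = (\<Sum>i\<in>I. z' i * A' i b)"
      using csubspace_closed[OF \<Phi> B csubspace_scale[OF \<Phi> g] lim] by blast
    have "\<forall>i\<in>I. z' i = 0" using unique[OF z'(1) h(1)] h(2) by simp
    moreover have "(\<lambda>n. \<Sum>i\<in>I. norm (y (s n) i)) \<longlonglongrightarrow> (\<Sum>i\<in>I. norm (z i))"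
      by (intro tendsto_intros z)
    moreover have "(\<Sum>i\<in>I. norm (y n i)) = 1" for n
    proof -
      have "norm (y n i) = norm (x (r n) i - x' i) / N (r n)" for i
        using Npos[of n] by (simp add: y_def t_def norm_mult norm_divide)
      then have "(\<Sum>i\<in>I. norm (y n i)) = (\<Sum>i\<in>I. norm (x (r n) i - x' i)) / N (r n)"
        by (simp only: sum_divide_distrib)
      then show ?thesis using Npos[of n] by (simp flip: N_def)
    qed
    ultimately show False using z'(2) by (simp add: LIMSEQ_const_iff)
  qed
  moreover have "norm (x k i - x' i) \<le> N k" for k
    unfolding N_def by (rule member_le_sum) (use i I in auto)
  ultimately have "(\<lambda>k. x k i - x' i) \<longlonglongrightarrow> 0"
    using Lim_null_comparison[of "\<lambda>k. x k i - x' i" N] by auto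
  then show ?thesis by (simp add: LIM_zero_iff)
qed

section \<open>Piecewise polynomial fields and the bilinear forms\<close>

text \<open>Bounds hold almost everywhere because classical curls and gradients of mesh functions
  carry no information on cell faces. These functions are closed under products, so every integrand
  in the forms is integrable on a bounded open set.\<close>

definition Linf :: "(real^3) set \<Rightarrow> (real^3 \<Rightarrow> 'b::euclidean_space) set" where
  "Linf S = {f \<in> borel_measurable (lebesgue_on S). \<exists>C. AE x in lebesgue_on S. norm (f x) \<le> C}"

lemma Linf_measurable: "f \<in> Linf S \<Longrightarrow> f \<in> borel_measurable (lebesgue_on S)"
  by (simp add: Linf_def)

lemma LinfI: "f \<in> borel_measurable (lebesgue_on S) \<Longrightarrow> AE x in lebesgue_on S. norm (f x) \<le> C \<Longrightarrow> f \<in> Linf S"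
  by (auto simp: Linf_def)

lemma finite_measure_lebesgue_on_open:
  "open S \<Longrightarrow> bounded S \<Longrightarrow> finite_measure (lebesgue_on S)"
  by (simp add: finite_measure_lebesgue_on lmeasurable_open)

lemma integrable_Linf:
  assumes "open S" "bounded S" "f \<in> Linf S"
  shows "integrable (lebesgue_on S) f"
  using assms finite_measure.integrable_const_bound[OF finite_measure_lebesgue_on_open]
  by (auto simp: Linf_def)

lemma Linf_const: "(\<lambda>x. c) \<in> Linf S"
  by (auto simp: Linf_def)

lemma Linf_add: "f \<in> Linf S \<Longrightarrow> g \<in> Linf S \<Longrightarrow> (\<lambda>x. f x + g x) \<in> Linf S"
proof -
  assume f: "f \<in> Linf S" and g: "g \<in> Linf S"
  then obtain C D where "AE x in lebesgue_on S. norm (f x) \<le> C" "AE x in lebesgue_on S. norm (g x) \<le> D"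
    by (auto simp: Linf_def)
  then have "AE x in lebesgue_on S. norm (f x + g x) \<le> C + D"
    by eventually_elim (meson add_mono norm_triangle_le)
  then show ?thesis by (rule LinfI[rotated]) (intro borel_measurable_add Linf_measurable f g)
qed

lemma Linf_sum: "(\<And>i. i \<in> A \<Longrightarrow> f i \<in> Linf S) \<Longrightarrow> (\<lambda>x. \<Sum>i\<in>A. f i x) \<in> Linf S"
  by (induction A rule: infinite_finite_induct) (auto intro: Linf_const Linf_add)

lemma Linf_mult:
  fixes f :: "real^3 \<Rightarrow> complex"
  shows "f \<in> Linf S \<Longrightarrow> g \<in> Linf S \<Longrightarrow> (\<lambda>x. f x * g x) \<in> Linf S"
proof -
  assume f: "f \<in> Linf S" and g: "g \<in> Linf S"
  then obtain C D where "AE x in lebesgue_on S. norm (f x) \<le> C" "AE x in lebesgue_on S. norm (g x) \<le> D"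
    by (auto simp: Linf_def)
  then have "AE x in lebesgue_on S. norm (f x * g x) \<le> C * D"
    by eventually_elim (simp add: norm_mult, smt (verit) mult_mono norm_ge_zero)
  then show ?thesis by (rule LinfI[rotated]) (intro borel_measurable_times Linf_measurable f g)
qed

lemma Linf_compose:
  assumes f: "f \<in> Linf S" and h: "\<And>x. norm (h x) \<le> norm x" "continuous_on UNIV h"
  shows "(\<lambda>x. h (f x)) \<in> Linf S"
proof -
  from f obtain C where "AE x in lebesgue_on S. norm (f x) \<le> C" by (auto simp: Linf_def)
  then have "AE x in lebesgue_on S. norm (h (f x)) \<le> C"
    by eventually_elim (use h order_trans in blast)
  then show ?thesis
    using measurable_compose[OF Linf_measurable[OF f] borel_measurable_continuous_onI[OF h(2)]]
    by (rule LinfI[rotated])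
qed

lemma Linf_cnj: "f \<in> Linf S \<Longrightarrow> (\<lambda>x. cnj (f x)) \<in> Linf S"
  by (erule Linf_compose) (auto intro!: continuous_intros)

lemma Linf_of_real: "f \<in> Linf S \<Longrightarrow> (\<lambda>x. complex_of_real (f x)) \<in> Linf S"
  by (erule Linf_compose) (auto intro!: continuous_intros)

lemma Linf_nth:
  fixes f :: "real^3 \<Rightarrow> complex^3"
  shows "f \<in> Linf S \<Longrightarrow> (\<lambda>x. f x $ i) \<in> Linf S"
  by (erule Linf_compose) (auto intro!: continuous_intros simp: Finite_Cartesian_Product.norm_nth_le)

lemma Linf_cdot: "u \<in> Linf S \<Longrightarrow> v \<in> Linf S \<Longrightarrow> (\<lambda>x. cdot (u x) (v x)) \<in> Linf S"
  unfolding cdot_def by (intro Linf_sum Linf_mult Linf_cnj Linf_nth)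

lemma Linf_mono:
  assumes "f \<in> Linf S" "open S" "open T" "T \<subseteq> S"
  shows "f \<in> Linf T"
proof -
  obtain C where C: "AE x in lebesgue_on S. norm (f x) \<le> C" using assms by (auto simp: Linf_def)
  have "AE x in lebesgue_on T. norm (f x) \<le> C"
    using C assms(2-4) by (auto simp: AE_restrict_space_iff elim!: eventually_mono)
  then show ?thesis
    using measurable_restrict_mono[OF Linf_measurable[OF assms(1)] assms(4)] by (rule LinfI[rotated])
qed

text \<open>The exceptional points lie on the frontiers of finitely many tetrahedra, and frontiers
  of convex sets are null.\<close>

lemma AE_interior_mesh:
  assumes M: "tetrahedral_mesh \<M> S" and S: "open S"
  shows "AE x in lebesgue_on S. \<exists>T\<in>\<M>. x \<in> interior T"
proof -
  have fin: "finite \<M>" and simp: "\<And>T. T \<in> \<M> \<Longrightarrow> 3 simplex T" and cov: "\<Union>\<M> = closure S"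
    using M by (auto simp: tetrahedral_mesh_def triangulation_def)
  have "negligible (\<Union>T\<in>\<M>. frontier T)"
    using fin simp by (auto intro!: negligible_Union negligible_convex_frontier convex_simplex)
  then have "AE x in lebesgue. x \<notin> (\<Union>T\<in>\<M>. frontier T)"
    using AE_not_in negligible_iff_null_sets by blast
  then have "AE x in lebesgue. x \<in> S \<longrightarrow> (\<exists>T\<in>\<M>. x \<in> interior T)"
  proof eventually_elim
    case (elim x)
    show ?case
    proof
      assume "x \<in> S"
      then obtain T where T: "T \<in> \<M>" "x \<in> T" using cov closure_subset by blast
      then have "x \<notin> frontier T" using elim by auto
      then show "\<exists>T\<in>\<M>. x \<in> interior T"
        using T simp[OF T(1)] closed_simplex[OF simp[OF T(1)]] by (auto simp: frontier_def)
    qed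
  qed
  then show ?thesis using S by (simp add: AE_restrict_space_iff)
qed

lemma Linf_piecewise:
  fixes f :: "real^3 \<Rightarrow> 'b::euclidean_space"
  assumes M: "tetrahedral_mesh \<M> S" and S: "open S"
    and cont: "\<And>T. T \<in> \<M> \<Longrightarrow> continuous_on (interior T) f"
    and bd: "\<And>T. T \<in> \<M> \<Longrightarrow> bounded (f ` interior T)"
  shows "f \<in> Linf S"
proof -
  define V where "V = (\<Union>T\<in>\<M>. interior T)"
  have fin: "finite \<M>" using M by (auto simp: tetrahedral_mesh_def triangulation_def)
  have V: "open V" by (auto simp: V_def)
  have AE: "AE x in lebesgue. x \<in> S \<longrightarrow> x \<in> V"
    using AE_interior_mesh[OF M S] S by (auto simp: AE_restrict_space_iff V_def)
  have "continuous_on V f"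
    unfolding V_def by (rule continuous_on_open_UN) (use cont in auto)
  then have "f \<in> borel_measurable (lebesgue_on V)"
    using V by (simp add: continuous_imp_measurable_on_sets_lebesgue)
  \<comment> \<open>Continuity gives measurability only on the open cells; the zero extension from
    there differs from that of \<open>f\<close> on a null set.\<close>
  then have "(\<lambda>x. if x \<in> S \<inter> V then f x else 0) \<in> borel_measurable lebesgue"
    using V S by (intro borel_measurable_if_I) (auto elim: measurable_restrict_mono)
  then have "(\<lambda>x. if x \<in> S then f x else 0) \<in> borel_measurable lebesgue"
    by (rule borel_measurable_AE) (use AE in \<open>auto elim!: eventually_mono\<close>)
  then have meas: "f \<in> borel_measurable (lebesgue_on S)" by (rule borel_measurable_if_D)
  have "bounded (f ` V)" unfolding V_def image_UN using fin bd by (intro bounded_Union) auto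
  then obtain C where "\<And>x. x \<in> V \<Longrightarrow> norm (f x) \<le> C" by (auto simp: bounded_iff)
  then have "AE x in lebesgue_on S. norm (f x) \<le> C"
    using AE S by (auto simp: AE_restrict_space_iff elim!: eventually_mono)
  with meas show ?thesis by (rule LinfI)
qed

section \<open>Complex combinations under curl, gradient and the Hermitian product\<close>

lemma linear_ccross: "linear (ccross b)"
  by (rule linearI) (simp_all add: ccross_def vec_eq_iff forall_3 algebra_simps scaleR_conv_of_real[where 'a = complex])

lemma ccross_add_scale: "ccross (u + c *s v) x = ccross u x + c *s ccross v x"
  by (simp add: ccross_def vec_eq_iff forall_3 algebra_simps)

lemma linear_vector_scalar_mult: "linear (\<lambda>v::complex^3. c *s v)"
  by (rule linearI) (simp_all add: vec_eq_iff algebra_simps scaleR_conv_of_real[where 'a = complex])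

lemma cdot_add_left: "cdot (u + c *s v) w = cdot u w + c * cdot v w"
  by (simp add: cdot_def sum_3 algebra_simps)

lemma cdot_add_right: "cdot w (u + c *s v) = cdot w u + cnj c * cdot w v"
  by (simp add: cdot_def sum_3 algebra_simps)

lemma has_derivative_axpy:
  fixes u v :: "real^3 \<Rightarrow> complex^3"
  assumes "(u has_derivative u') (at x)" "(v has_derivative v') (at x)"
  shows "((\<lambda>x. u x + c *s v x) has_derivative (\<lambda>h. u' h + c *s v' h)) (at x)"
  using assms bounded_linear.has_derivative[OF linear_conv_bounded_linear[THEN iffD1, OF linear_vector_scalar_mult]]
  by (intro has_derivative_add) auto

lemma partial_deriv_eq: "(u has_derivative u') (at x) \<Longrightarrow> partial_deriv i u x = u' (axis i 1)"
  unfolding partial_deriv_def using frechet_derivative_at by metis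

lemma curl_axpy:
  fixes u v :: "real^3 \<Rightarrow> complex^3"
  assumes "u differentiable (at x)" "v differentiable (at x)"
  shows "curl (\<lambda>x. u x + c *s v x) x = curl u x + c *s curl v x"
proof -
  obtain u' v' where d: "(u has_derivative u') (at x)" "(v has_derivative v') (at x)"
    using assms by (auto simp: differentiable_def)
  show ?thesis
    unfolding curl_def partial_deriv_eq[OF has_derivative_axpy[OF d]]
      partial_deriv_eq[OF d(1)] partial_deriv_eq[OF d(2)]
    by (simp add: vec_eq_iff forall_3 algebra_simps)
qed

lemma grad_axpy:
  fixes u v :: "real^3 \<Rightarrow> complex"
  assumes "u differentiable (at x)" "v differentiable (at x)"
  shows "grad (\<lambda>x. u x + c * v x) x = grad u x + c *s grad v x"
proof -
  obtain u' v' where d: "(u has_derivative u') (at x)" "(v has_derivative v') (at x)"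
    using assms by (auto simp: differentiable_def)
  have "((\<lambda>x. u x + c * v x) has_derivative (\<lambda>h. u' h + c * v' h)) (at x)"
    by (intro derivative_intros d)
  from partial_deriv_eq[OF this] show ?thesis
    by (simp add: grad_def vec_eq_iff partial_deriv_eq[OF d(1)] partial_deriv_eq[OF d(2)])
qed

text \<open>The cellwise part of \<open>nedelec_space\<close>, without conformity. Bounds, the
  sesquilinear structure of the forms and boundary traces rest on this part alone.\<close>

definition edge_fields :: "(real^3) set set \<Rightarrow> (real^3 \<Rightarrow> complex^3) set" where
  "edge_fields \<M> = {u. \<forall>T\<in>\<M>. \<exists>a b. \<forall>x \<in> interior T. u x = a + ccross b x}"

lemma edge_fields_axpy:
  assumes "u \<in> edge_fields \<M>" "v \<in> edge_fields \<M>"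
  shows "(\<lambda>x. u x + c *s v x) \<in> edge_fields \<M>"
  unfolding edge_fields_def
proof clarify
  fix T assume "T \<in> \<M>"
  then obtain a b a' b' where "\<And>x. x \<in> interior T \<Longrightarrow> u x = a + ccross b x"
    "\<And>x. x \<in> interior T \<Longrightarrow> v x = a' + ccross b' x"
    using assms unfolding edge_fields_def by blast
  then have "\<forall>x\<in>interior T. u x + c *s v x = (a + c *s a') + ccross (b + c *s b') x"
    by (simp add: ccross_add_scale vector_add_ldistrib)
  then show "\<exists>a b. \<forall>x\<in>interior T. u x + c *s v x = a + ccross b x" by blast
qed

lemma edge_fields_has_derivative:
  assumes "\<And>x. x \<in> interior T \<Longrightarrow> u x = a + ccross b x" "x \<in> interior T"
  shows "(u has_derivative ccross b) (at x)"
proof (rule has_derivative_transform_within_open)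
  show "((\<lambda>x. a + ccross b x) has_derivative ccross b) (at x)"
    using bounded_linear_imp_has_derivative[OF linear_conv_bounded_linear[THEN iffD1, OF linear_ccross]]
    by (auto intro!: derivative_eq_intros)
qed (use assms in auto)

lemma edge_fields_differentiable:
  "u \<in> edge_fields \<M> \<Longrightarrow> T \<in> \<M> \<Longrightarrow> x \<in> interior T \<Longrightarrow> u differentiable (at x)"
  unfolding edge_fields_def differentiable_def by (blast intro: edge_fields_has_derivative)

lemma Linf_edge_fields:
  assumes M: "tetrahedral_mesh \<M> S" and S: "open S" and u: "u \<in> edge_fields \<M>"
  shows "u \<in> Linf S" "curl u \<in> Linf S"
proof -
  have comp: "compact T" if "T \<in> \<M>" for T
    using M that by (auto simp: tetrahedral_mesh_def intro: compact_simplex)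
  have *: "continuous_on (interior T) u \<and> bounded (u ` interior T)
      \<and> continuous_on (interior T) (curl u) \<and> bounded (curl u ` interior T)" if T: "T \<in> \<M>" for T
  proof -
    obtain a b where ab: "\<And>x. x \<in> interior T \<Longrightarrow> u x = a + ccross b x"
      using u T unfolding edge_fields_def by blast
    have c: "continuous_on A (\<lambda>x. a + ccross b x)" for A
      using linear_continuous_on[OF linear_conv_bounded_linear[THEN iffD1, OF linear_ccross]]
      by (intro continuous_intros)
    have "bounded ((\<lambda>x. a + ccross b x) ` T)"
      by (intro compact_imp_bounded compact_continuous_image c comp T)
    then have "bounded ((\<lambda>x. a + ccross b x) ` interior T)"
      by (rule bounded_subset) (use interior_subset in blast)
    \<comment> \<open>The derivative is \<open>ccross b\<close> at every point of the cell, so the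
      curl is constant there.\<close>
    moreover obtain d where d: "\<And>x. x \<in> interior T \<Longrightarrow> curl u x = d"
      unfolding curl_def using partial_deriv_eq[OF edge_fields_has_derivative[OF ab]] by simp
    have "bounded (curl u ` interior T)"
      by (rule bounded_subset[of "{d}"]) (use d in auto)
    moreover have "continuous_on (interior T) (curl u)"
      using continuous_on_const[of "interior T" d] by (rule continuous_on_eq) (simp add: d)
    moreover have "continuous_on (interior T) u"
      using c by (rule continuous_on_eq) (simp add: ab)
    ultimately show ?thesis using ab by (simp add: image_def)
  qed
  show "u \<in> Linf S" "curl u \<in> Linf S"
    using * by (auto intro!: Linf_piecewise[OF M S])
qed

definition affine_fields :: "(real^3) set set \<Rightarrow> (real^3 \<Rightarrow> complex) set" where
  "affine_fields \<M> = {u. \<forall>T\<in>\<M>. \<exists>c l. linear l \<and> (\<forall>x\<in>T. u x = c + l x)}"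

lemma affine_fields_has_derivative:
  fixes u :: "real^3 \<Rightarrow> complex"
  assumes "linear l" "\<And>x. x \<in> T \<Longrightarrow> u x = c + l x" "x \<in> interior T"
  shows "(u has_derivative l) (at x)"
proof (rule has_derivative_transform_within_open)
  show "((\<lambda>x. c + l x) has_derivative l) (at x)"
    using bounded_linear_imp_has_derivative[OF linear_conv_bounded_linear[THEN iffD1, OF assms(1)]]
    by (auto intro!: derivative_eq_intros)
qed (use assms interior_subset[of T] in auto)

lemma affine_fields_differentiable:
  "u \<in> affine_fields \<M> \<Longrightarrow> T \<in> \<M> \<Longrightarrow> x \<in> interior T \<Longrightarrow> u differentiable (at x)"
  unfolding affine_fields_def differentiable_def by (blast intro: affine_fields_has_derivative)

lemma Linf_grad_affine_fields:
  assumes M: "tetrahedral_mesh \<M> S" and S: "open S" and u: "u \<in> affine_fields \<M>"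
  shows "grad u \<in> Linf S"
proof (rule Linf_piecewise[OF M S])
  fix T assume T: "T \<in> \<M>"
  obtain c l where "linear l" "\<And>x. x \<in> T \<Longrightarrow> u x = c + l x"
    using u T unfolding affine_fields_def by blast
  note d = affine_fields_has_derivative[OF this]
  obtain d where d: "\<And>x. x \<in> interior T \<Longrightarrow> grad u x = d"
    unfolding grad_def using partial_deriv_eq[OF d] by simp
  show "bounded (grad u ` interior T)"
    by (rule bounded_subset[of "{d}"]) (use d in auto)
  show "continuous_on (interior T) (grad u)"
    using continuous_on_const[of "interior T" d] by (rule continuous_on_eq) (simp add: d)
qed

text \<open>Equality almost everywhere is what classical derivatives deliver: the curl of a
  combination splits only at points inside a cell.\<close>

lemma integral_axpy:
  assumes "open S" "bounded S" "f \<in> Linf S" "g \<in> Linf S" "h \<in> Linf S"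
    and "AE x in lebesgue_on S. h x = f x + c * g x"
  shows "(LINT x|lebesgue_on S. h x :: complex) = (LINT x|lebesgue_on S. f x) + c * (LINT x|lebesgue_on S. g x)"
proof -
  have "(LINT x|lebesgue_on S. h x) = (LINT x|lebesgue_on S. f x + c * g x)"
    using assms by (intro integral_cong_AE borel_measurable_add borel_measurable_times Linf_measurable)
      (auto simp: Linf_const)
  also have "\<dots> = (LINT x|lebesgue_on S. f x) + c * (LINT x|lebesgue_on S. g x)"
    using assms by (simp add: integrable_Linf)
  finally show ?thesis .
qed

lemma Linf_form_a:
  assumes "\<gamma> \<in> Linf S" "E \<in> Linf S" "curl E \<in> Linf S" "F \<in> Linf S" "curl F \<in> Linf S"
  shows "(\<lambda>x. of_real (1 / \<mu>) * cdot (curl E x) (curl F x)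
           - \<i> * of_real \<omega> * of_real (\<gamma> x) * cdot (E x) (F x)) \<in> Linf S"
proof -
  have "(\<lambda>x. of_real (1 / \<mu>) * cdot (curl E x) (curl F x)
           + (- \<i> * of_real \<omega>) * (of_real (\<gamma> x) * cdot (E x) (F x))) \<in> Linf S"
    by (intro Linf_add Linf_mult Linf_const Linf_of_real Linf_cdot assms)
  then show ?thesis by (simp add: algebra_simps)
qed

lemma form_a_axpy_left:
  assumes M: "tetrahedral_mesh \<M> S" and S: "open S" "bounded S" and \<gamma>: "\<gamma> \<in> Linf S"
    and u: "u \<in> edge_fields \<M>" and v: "v \<in> edge_fields \<M>" and F: "F \<in> edge_fields \<M>"
  shows "form_a S \<mu> \<omega> \<gamma> (\<lambda>x. u x + c *s v x) F = form_a S \<mu> \<omega> \<gamma> u F + c * form_a S \<mu> \<omega> \<gamma> v F"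
  unfolding form_a_def
proof (rule integral_axpy[OF S])
  show "AE x in lebesgue_on S.
       complex_of_real (1 / \<mu>) * cdot (curl (\<lambda>x. u x + c *s v x) x) (curl F x) -
       \<i> * complex_of_real \<omega> * complex_of_real (\<gamma> x) * cdot (u x + c *s v x) (F x) =
       complex_of_real (1 / \<mu>) * cdot (curl u x) (curl F x) -
       \<i> * complex_of_real \<omega> * complex_of_real (\<gamma> x) * cdot (u x) (F x) +
       c * (complex_of_real (1 / \<mu>) * cdot (curl v x) (curl F x) -
        \<i> * complex_of_real \<omega> * complex_of_real (\<gamma> x) * cdot (v x) (F x))"
    using AE_interior_mesh[OF M S(1)]
  proof eventually_elim
    case (elim x)
    then have "curl (\<lambda>x. u x + c *s v x) x = curl u x + c *s curl v x"
      using u v edge_fields_differentiable by (blast intro: curl_axpy)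
    then show ?case by (simp add: cdot_add_left algebra_simps)
  qed
qed (intro Linf_form_a \<gamma> Linf_edge_fields[OF M S(1)] u v F edge_fields_axpy)+

lemma form_a_axpy_right:
  assumes M: "tetrahedral_mesh \<M> S" and S: "open S" "bounded S" and \<gamma>: "\<gamma> \<in> Linf S"
    and u: "u \<in> edge_fields \<M>" and v: "v \<in> edge_fields \<M>" and F: "F \<in> edge_fields \<M>"
  shows "form_a S \<mu> \<omega> \<gamma> F (\<lambda>x. u x + c *s v x) = form_a S \<mu> \<omega> \<gamma> F u + cnj c * form_a S \<mu> \<omega> \<gamma> F v"
  unfolding form_a_def
proof (rule integral_axpy[OF S])
  show "AE x in lebesgue_on S.
       complex_of_real (1 / \<mu>) * cdot (curl F x) (curl (\<lambda>x. u x + c *s v x) x) -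
       \<i> * complex_of_real \<omega> * complex_of_real (\<gamma> x) * cdot (F x) (u x + c *s v x) =
       complex_of_real (1 / \<mu>) * cdot (curl F x) (curl u x) -
       \<i> * complex_of_real \<omega> * complex_of_real (\<gamma> x) * cdot (F x) (u x) +
       cnj c * (complex_of_real (1 / \<mu>) * cdot (curl F x) (curl v x) -
        \<i> * complex_of_real \<omega> * complex_of_real (\<gamma> x) * cdot (F x) (v x))"
    using AE_interior_mesh[OF M S(1)]
  proof eventually_elim
    case (elim x)
    then have "curl (\<lambda>x. u x + c *s v x) x = curl u x + c *s curl v x"
      using u v edge_fields_differentiable by (blast intro: curl_axpy)
    then show ?case by (simp add: cdot_add_right algebra_simps)
  qed
qed (intro Linf_form_a \<gamma> Linf_edge_fields[OF M S(1)] u v F edge_fields_axpy)+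

text \<open>\<open>w\<close> is kept separate from the combination so that gradients of multipliers
  are covered, which split only almost everywhere.\<close>

lemma form_b_axpy_left:
  assumes S: "open S" "bounded S" and \<epsilon>: "\<epsilon> \<in> Linf S" and "u \<in> Linf S" "v \<in> Linf S" "w \<in> Linf S" "F \<in> Linf S"
    and "AE x in lebesgue_on S. w x = u x + c *s v x"
  shows "form_b S \<epsilon> w F = form_b S \<epsilon> u F + c * form_b S \<epsilon> v F"
  unfolding form_b_def
  using assms by (intro integral_axpy Linf_mult Linf_of_real Linf_cdot S)
    (auto elim!: eventually_mono simp: cdot_add_left algebra_simps)

lemma form_b_axpy_right:
  assumes S: "open S" "bounded S" and \<epsilon>: "\<epsilon> \<in> Linf S" and "u \<in> Linf S" "v \<in> Linf S" "w \<in> Linf S" "F \<in> Linf S"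
    and "AE x in lebesgue_on S. w x = u x + c *s v x"
  shows "form_b S \<epsilon> F w = form_b S \<epsilon> F u + cnj c * form_b S \<epsilon> F v"
  unfolding form_b_def
  using assms by (intro integral_axpy Linf_mult Linf_of_real Linf_cdot S)
    (auto elim!: eventually_mono simp: cdot_add_right algebra_simps)

text \<open>The curl terms cancel in the difference; what remains is at most
  \<open>\<bar>\<omega>\<bar>\<close> times the uniform distance of the conductivities times the
  integral of \<open>norm (cdot (E x) (F x))\<close>.\<close>

lemma form_a_tendsto:
  assumes S: "open S" "bounded S" and \<gamma>: "\<And>k. \<gamma> k \<in> Linf S" "\<gamma>' \<in> Linf S"
    and lim: "uniform_limit S \<gamma> \<gamma>' sequentially"
    and EF: "E \<in> Linf S" "curl E \<in> Linf S" "F \<in> Linf S" "curl F \<in> Linf S"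
  shows "(\<lambda>k. form_a S \<mu> \<omega> (\<gamma> k) E F) \<longlonglongrightarrow> form_a S \<mu> \<omega> \<gamma>' E F"
proof -
  let ?q = "\<lambda>x. cdot (E x) (F x)"
  have q: "?q \<in> Linf S" using EF by (intro Linf_cdot)
  define I where "I = (LINT x|lebesgue_on S. norm (?q x))"
  have I0: "I \<ge> 0" by (simp add: I_def)
  have diff: "norm (form_a S \<mu> \<omega> (\<gamma> k) E F - form_a S \<mu> \<omega> \<gamma>' E F) \<le> \<bar>\<omega>\<bar> * \<delta> * I"
    if "\<And>x. x \<in> S \<Longrightarrow> dist (\<gamma> k x) (\<gamma>' x) \<le> \<delta>" for k \<delta>
  proof -
    have "form_a S \<mu> \<omega> (\<gamma> k) E F - form_a S \<mu> \<omega> \<gamma>' E F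
        = (LINT x|lebesgue_on S. (of_real (1 / \<mu>) * cdot (curl E x) (curl F x)
           - \<i> * of_real \<omega> * of_real (\<gamma> k x) * cdot (E x) (F x)) - (of_real (1 / \<mu>) * cdot (curl E x) (curl F x)
           - \<i> * of_real \<omega> * of_real (\<gamma>' x) * cdot (E x) (F x)))"
      unfolding form_a_def
      by (rule Bochner_Integration.integral_diff[symmetric]) (intro integrable_Linf S Linf_form_a \<gamma> EF)+
    also have "\<dots> = (LINT x|lebesgue_on S. \<i> * of_real \<omega> * of_real (\<gamma>' x - \<gamma> k x) * ?q x)"
      by (intro Bochner_Integration.integral_cong) (auto simp: algebra_simps)
    also have "norm \<dots> \<le> (LINT x|lebesgue_on S. norm (\<i> * of_real \<omega> * of_real (\<gamma>' x - \<gamma> k x) * ?q x))"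
      by (rule integral_norm_bound)
    also have "\<dots> \<le> (LINT x|lebesgue_on S. \<bar>\<omega>\<bar> * \<delta> * norm (?q x))"
    proof (rule integral_mono')
      show "integrable (lebesgue_on S) (\<lambda>x. \<bar>\<omega>\<bar> * \<delta> * norm (?q x))"
        by (intro integrable_mult_right integrable_norm integrable_Linf S q)
      fix x assume "x \<in> space (lebesgue_on S)"
      then have "\<bar>\<gamma>' x - \<gamma> k x\<bar> \<le> \<delta>" using that[of x] by (simp add: dist_real_def abs_minus_commute)
      then show "norm (\<i> * of_real \<omega> * of_real (\<gamma>' x - \<gamma> k x) * ?q x) \<le> \<bar>\<omega>\<bar> * \<delta> * norm (?q x)"
        unfolding norm_mult by (intro mult_right_mono) (auto intro!: mult_left_mono simp flip: of_real_diff)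
      show "0 \<le> \<bar>\<omega>\<bar> * \<delta> * norm (?q x)" using \<open>\<bar>\<gamma>' x - \<gamma> k x\<bar> \<le> \<delta>\<close> by simp
    qed
    finally show ?thesis by (simp add: I_def)
  qed
  show ?thesis
    unfolding LIMSEQ_iff
  proof (intro allI impI)
    fix e :: real assume e: "e > 0"
    \<comment> \<open>The added 1 keeps the denominator positive when
      \<open>\<bar>\<omega>\<bar> * I\<close> is 0; the factor 2 leaves room for the strict
      inequality.\<close>
    define \<delta> where "\<delta> = e / (2 * (\<bar>\<omega>\<bar> * I + 1))"
    have pos: "\<bar>\<omega>\<bar> * I + 1 > 0" using I0 by (smt (verit) mult_nonneg_nonneg)
    then have \<delta>: "\<delta> > 0" using e by (simp add: \<delta>_def)
    obtain K where K: "\<And>k x. k \<ge> K \<Longrightarrow> x \<in> S \<Longrightarrow> dist (\<gamma> k x) (\<gamma>' x) < \<delta>"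
      using lim \<delta> unfolding uniform_limit_sequentially_iff by blast
    have "\<bar>\<omega>\<bar> * \<delta> * I \<le> \<delta> * (\<bar>\<omega>\<bar> * I + 1)" using \<delta> by (simp add: algebra_simps)
    also have "\<dots> = e / 2" using pos by (simp add: \<delta>_def field_simps)
    also have "\<dots> < e" using e by simp
    finally show "\<exists>K. \<forall>k\<ge>K. norm (form_a S \<mu> \<omega> (\<gamma> k) E F - form_a S \<mu> \<omega> \<gamma>' E F) < e"
      using diff[of _ \<delta>] K by (meson order_le_less_trans less_imp_le)
  qed
qed

section \<open>Edge elements and their linear functionals\<close>

lemma norm_vector_scalar_mult: "norm (c *s (v::complex^3)) = norm c * norm v"
  by (simp add: norm_vec_def norm_mult L2_set_right_distrib)

lemma L2_axpy:
  fixes u v :: "'a \<Rightarrow> complex^3"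
  assumes "u \<in> L2 N" "v \<in> L2 N"
  shows "(\<lambda>x. u x + c *s v x) \<in> L2 N"
proof -
  have m: "(\<lambda>x. u x + c *s v x) \<in> borel_measurable N"
  proof (rule borel_measurable_add)
    have "continuous_on UNIV (\<lambda>v::complex^3. c *s v)"
      by (rule linear_continuous_on) (use linear_conv_bounded_linear linear_vector_scalar_mult in blast)
    then have "(\<lambda>v::complex^3. c *s v) \<in> borel_measurable borel" by (rule borel_measurable_continuous_onI)
    then show "(\<lambda>x. c *s v x) \<in> borel_measurable N"
      by (rule measurable_compose[rotated]) (use assms in \<open>simp add: L2_def\<close>)
  qed (use assms in \<open>simp add: L2_def\<close>)
  have "integrable N (\<lambda>x. (norm (u x + c *s v x))\<^sup>2)"
  proof (rule Bochner_Integration.integrable_bound)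
    show "integrable N (\<lambda>x. 2 * (norm (u x))\<^sup>2 + 2 * (norm c)\<^sup>2 * (norm (v x))\<^sup>2)"
      using assms by (simp add: L2_def)
    have "(norm (u x + c *s v x))\<^sup>2 \<le> 2 * (norm (u x))\<^sup>2 + 2 * (norm c)\<^sup>2 * (norm (v x))\<^sup>2" for x
    proof -
      have "norm (u x + c *s v x) \<le> norm (u x) + norm c * norm (v x)"
        by (metis norm_triangle_ineq norm_vector_scalar_mult)
      then have "(norm (u x + c *s v x))\<^sup>2 \<le> (norm (u x) + norm c * norm (v x))\<^sup>2"
        by (intro power_mono) auto
      also have "\<dots> \<le> 2 * (norm (u x))\<^sup>2 + 2 * (norm c * norm (v x))\<^sup>2"
        using sum_squares_bound[of "norm (u x)" "norm c * norm (v x)"] by (simp add: power2_sum)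
      finally show ?thesis by (simp add: power_mult_distrib)
    qed
    then show "AE x in N. norm ((norm (u x + c *s v x))\<^sup>2)
      \<le> norm (2 * (norm (u x))\<^sup>2 + 2 * (norm c)\<^sup>2 * (norm (v x))\<^sup>2)" by (auto intro: order_trans[OF _ abs_ge_self])
  qed (use m in measurable)
  with m show ?thesis by (simp add: L2_def)
qed

lemma integrable_mult_Linf:
  fixes f :: "real^3 \<Rightarrow> complex"
  assumes "integrable (lebesgue_on S) f" "g \<in> Linf S"
  shows "integrable (lebesgue_on S) (\<lambda>x. f x * g x)"
proof -
  obtain C where C: "AE x in lebesgue_on S. norm (g x) \<le> C" using assms by (auto simp: Linf_def)
  show ?thesis
  proof (rule Bochner_Integration.integrable_bound)
    show "integrable (lebesgue_on S) (\<lambda>x. C * norm (f x))" using assms by simp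
    show "(\<lambda>x. f x * g x) \<in> borel_measurable (lebesgue_on S)"
      by (intro borel_measurable_times Linf_measurable assms borel_measurable_integrable)
    show "AE x in lebesgue_on S. norm (f x * g x) \<le> norm (C * norm (f x))"
      using C
    proof eventually_elim
      case (elim x)
      then have "norm (f x) * norm (g x) \<le> norm (f x) * C" by (intro mult_left_mono) auto
      then show ?case by (simp add: norm_mult mult.commute)
    qed
  qed
qed

lemma integrable_L2_nth:
  fixes w :: "real^3 \<Rightarrow> complex^3"
  assumes S: "open S" "bounded S" and w: "w \<in> L2 (lebesgue_on S)"
  shows "integrable (lebesgue_on S) (\<lambda>x. w x $ i)"
proof (rule Bochner_Integration.integrable_bound)
  interpret finite_measure "lebesgue_on S" by (rule finite_measure_lebesgue_on_open[OF S])
  \<comment> \<open>On a set of finite measure the bound 1 + |w|^2 for a component of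
    \<open>w\<close> replaces a Cauchy-Schwarz argument.\<close>
  show "integrable (lebesgue_on S) (\<lambda>x. 1 + (norm (w x))\<^sup>2)" using w by (simp add: L2_def)
  have "continuous_on UNIV (\<lambda>v::complex^3. v $ i)" by (intro continuous_intros)
  then show "(\<lambda>x. w x $ i) \<in> borel_measurable (lebesgue_on S)"
    using measurable_compose[OF _ borel_measurable_continuous_onI, of w] w by (auto simp: L2_def)
  have "norm (w x $ i) \<le> 1 + (norm (w x))\<^sup>2" for x
  proof -
    have "norm (w x $ i) \<le> norm (w x)" by (rule Finite_Cartesian_Product.norm_nth_le)
    moreover have "norm (w x) \<le> 1 + (norm (w x))\<^sup>2"
      using sum_squares_bound[of 1 "norm (w x)"] norm_ge_zero[of "w x"] unfolding power_one by linarith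
    ultimately show ?thesis by simp
  qed
  then show "AE x in lebesgue_on S. norm (w x $ i) \<le> norm (1 + (norm (w x))\<^sup>2)" 
    by (auto intro: order_trans[OF _ abs_ge_self])
qed

lemma integrable_rdot:
  assumes S: "open S" "bounded S" and w: "w \<in> L2 (lebesgue_on S)" and g: "g \<in> Linf S"
  shows "integrable (lebesgue_on S) (\<lambda>x. rdot (w x) (g x))"
  unfolding rdot_def
proof (intro Bochner_Integration.integrable_sum integrable_mult_Linf integrable_L2_nth S w Linf_of_real)
  fix i
  show "(\<lambda>x. g x $ i) \<in> Linf S"
    using g by (rule Linf_compose)
      (auto intro!: continuous_intros simp: Finite_Cartesian_Product.norm_nth_le component_le_norm_cart)
qed

lemma Linf_continuous:
  assumes "open S" "bounded S" "continuous_on UNIV f"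
  shows "f \<in> Linf S"
proof -
  have "compact (closure S)" using assms by (simp add: compact_closure)
  then have "bounded (f ` closure S)"
    using assms by (intro compact_imp_bounded compact_continuous_image) (auto intro: continuous_on_subset)
  then obtain C where "\<And>x. x \<in> S \<Longrightarrow> norm (f x) \<le> C"
    using closure_subset[of S] by (auto simp: bounded_iff)
  moreover have "f \<in> borel_measurable (lebesgue_on S)"
    using assms by (intro continuous_imp_measurable_on_sets_lebesgue) (auto intro: continuous_on_subset)
  ultimately show ?thesis by (intro LinfI[of f S C]) (auto intro!: AE_I2)
qed

lemma C1c_continuous: "u \<in> C1c S \<Longrightarrow> continuous_on UNIV u"
  unfolding C1c_def by (auto intro: has_derivative_continuous intro!: continuous_at_imp_continuous_on)

lemma C1c_continuous_partial_deriv: 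
  assumes "u \<in> C1c S"
  shows "continuous_on UNIV (partial_deriv i u)"
proof -
  obtain u' where d: "\<And>x. (u has_derivative blinfun_apply (u' x)) (at x)" and c: "continuous_on UNIV u'"
    using assms unfolding C1c_def by blast
  have "continuous_on UNIV (\<lambda>x. blinfun_apply (u' x) (axis i 1))"
    by (intro continuous_intros c)
  then show ?thesis by (simp add: partial_deriv_eq[OF d])
qed

lemma C1c_continuous_curl: 
  fixes \<phi> :: "real^3 \<Rightarrow> real^3"
  assumes "\<phi> \<in> C1c S"
  shows "continuous_on UNIV (curl \<phi>)"
proof -
  have c: "continuous_on UNIV (\<lambda>x. partial_deriv i \<phi> x $ j)" for i j
    by (intro continuous_intros C1c_continuous_partial_deriv[OF assms])
  have "continuous_on UNIV (\<lambda>x. \<chi> k. curl \<phi> x $ k)"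
  proof (intro continuous_on_vec_lambda)
    fix k :: 3
    consider "k = 1" | "k = 2" | "k = 3" using exhaust_3 by blast
    then show "continuous_on UNIV (\<lambda>x. curl \<phi> x $ k)"
      by cases (auto simp: curl_def intro!: continuous_intros c)
  qed
  then show ?thesis by simp
qed

lemma C1c_continuous_divergence: "g \<in> C1c S \<Longrightarrow> continuous_on UNIV (divergence g)"
  unfolding divergence_def [abs_def] by (intro continuous_intros C1c_continuous_partial_deriv)

lemma rdot_axpy: "rdot (u + c *s v) x = rdot u x + c * rdot v x"
  by (simp add: rdot_def sum_3 algebra_simps)

lemma Hcurl_axpy:
  assumes S: "open S" "bounded S" and u: "u \<in> Hcurl \<Gamma> S" and v: "v \<in> Hcurl \<Gamma> S"
  shows "(\<lambda>x. u x + c *s v x) \<in> Hcurl \<Gamma> S"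
proof -
  obtain wu where wu: "wu \<in> L2 (lebesgue_on S)" "has_weak_curl S u wu" "zero_tangential_trace_off \<Gamma> S u wu"
    using u by (auto simp: Hcurl_def)
  obtain wv where wv: "wv \<in> L2 (lebesgue_on S)" "has_weak_curl S v wv" "zero_tangential_trace_off \<Gamma> S v wv"
    using v by (auto simp: Hcurl_def)
  have L2: "u \<in> L2 (lebesgue_on S)" "v \<in> L2 (lebesgue_on S)" using u v by (auto simp: Hcurl_def)
  \<comment> \<open>\<open>A\<close> is left free so that the identity serves both the test fields
    inside \<open>S\<close> and those that only avoid \<Gamma>; either kind, with its curl, is
    continuous on the whole space and hence bounded on \<open>S\<close>.\<close>
  have eq: "(LINT x|lebesgue_on S. rdot (u x + c *s v x) (curl \<phi> x))
      = (LINT x|lebesgue_on S. rdot (wu x + c *s wv x) (\<phi> x))"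
    if \<phi>: "\<phi> \<in> C1c A" and eqs: "(LINT x|lebesgue_on S. rdot (u x) (curl \<phi> x)) = (LINT x|lebesgue_on S. rdot (wu x) (\<phi> x))"
      "(LINT x|lebesgue_on S. rdot (v x) (curl \<phi> x)) = (LINT x|lebesgue_on S. rdot (wv x) (\<phi> x))" for \<phi> A
  proof -
    have \<phi>L: "\<phi> \<in> Linf S" "curl \<phi> \<in> Linf S"
      using Linf_continuous[OF S] C1c_continuous[OF \<phi>] C1c_continuous_curl[OF \<phi>] by auto
    note int = integrable_rdot[OF S]
    show ?thesis
      unfolding rdot_axpy using eqs int[OF L2(1) \<phi>L(2)] int[OF L2(2) \<phi>L(2)] int[OF wu(1) \<phi>L(1)] int[OF wv(1) \<phi>L(1)]
      by simp
  qed
  have "has_weak_curl S (\<lambda>x. u x + c *s v x) (\<lambda>x. wu x + c *s wv x)"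
    using wu(2) wv(2) eq[where A = S] unfolding has_weak_curl_def by blast
  moreover have "zero_tangential_trace_off \<Gamma> S (\<lambda>x. u x + c *s v x) (\<lambda>x. wu x + c *s wv x)"
    using wu(3) wv(3) eq[where A = "- \<Gamma>"] unfolding zero_tangential_trace_off_def by blast
  ultimately show ?thesis
    using L2_axpy[OF L2] L2_axpy[OF wu(1) wv(1)] unfolding Hcurl_def by blast
qed

lemma nedelec_edge_fields: "nedelec_space \<Gamma> \<Omega> \<M> \<subseteq> edge_fields \<M>"
  by (auto simp: nedelec_space_def edge_fields_def)

lemma nedelec_axpy:
  assumes S: "open \<Omega>" "bounded \<Omega>" and u: "u \<in> nedelec_space \<Gamma> \<Omega> \<M>" and v: "v \<in> nedelec_space \<Gamma> \<Omega> \<M>"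
  shows "(\<lambda>x. u x + c *s v x) \<in> nedelec_space \<Gamma> \<Omega> \<M>"
proof -
  have "(\<lambda>x. u x + c *s v x) \<in> Hcurl \<Gamma> \<Omega>"
    by (rule Hcurl_axpy[OF S]) (use u v in \<open>simp_all add: nedelec_space_def\<close>)
  moreover have "(\<lambda>x. u x + c *s v x) \<in> edge_fields \<M>"
    using edge_fields_axpy u v nedelec_edge_fields by blast
  moreover have "\<forall>x. x \<notin> (\<Union>T\<in>\<M>. interior T) \<longrightarrow> u x + c *s v x = 0"
    using u v by (simp add: nedelec_space_def)
  ultimately show ?thesis unfolding nedelec_space_def edge_fields_def by blast
qed

lemma lagrange_affine_fields: "lagrange_space D \<M> \<subseteq> affine_fields \<M>"
  by (auto simp: lagrange_space_def affine_fields_def)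

lemma lagrange_axpy:
  fixes u v :: "real^3 \<Rightarrow> complex"
  assumes "u \<in> lagrange_space D \<M>" "v \<in> lagrange_space D \<M>"
  shows "(\<lambda>x. u x + c * v x) \<in> lagrange_space D \<M>"
proof -
  have "\<exists>d l. linear l \<and> (\<forall>x\<in>T. u x + c * v x = d + l x)" if "T \<in> \<M>" for T
  proof -
    have "\<exists>d l. linear l \<and> (\<forall>x\<in>T. u x = d + l x)" "\<exists>d l. linear l \<and> (\<forall>x\<in>T. v x = d + l x)"
      using assms that by (simp_all add: lagrange_space_def)
    then obtain d l d' l' where l: "linear l" "linear l'" "\<forall>x\<in>T. u x = d + l x" "\<forall>x\<in>T. v x = d' + l' x"
      by (elim exE conjE)
    show ?thesis
    proof (intro exI conjI ballI)
      show "linear (\<lambda>x. l x + c * l' x)"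
        by (intro linearI)
          (simp_all add: linear_add[OF l(1)] linear_add[OF l(2)] linear_scale[OF l(1)] linear_scale[OF l(2)] algebra_simps)
      fix x assume "x \<in> T"
      then show "u x + c * v x = (d + c * d') + (l x + c * l' x)"
        using l(3,4) by (simp add: algebra_simps)
    qed
  qed
  moreover have "continuous_on (\<Union>\<M>) (\<lambda>x. u x + c * v x)"
    by (intro continuous_on_add continuous_on_mult continuous_on_const)
      (use assms in \<open>simp_all add: lagrange_space_def\<close>)
  moreover have "\<forall>x\<in>D. u x + c * v x = 0" "\<forall>x. x \<notin> \<Union>\<M> \<longrightarrow> u x + c * v x = 0"
    using assms by (simp_all add: lagrange_space_def del: Union_iff)
  ultimately show ?thesis unfolding lagrange_space_def by blast
qed

section \<open>Linear functionals as coordinates\<close>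

definition axpy_closed :: "(real^3 \<Rightarrow> complex^3) set \<Rightarrow> bool" where
  "axpy_closed R \<longleftrightarrow> R \<noteq> {} \<and> (\<forall>u\<in>R. \<forall>v\<in>R. \<forall>c. (\<lambda>x. u x + c *s v x) \<in> R)"

text \<open>Linearity is asked only on \<open>R\<close>, so that point values, forms in their first
  argument, conjugated forms in their second, and trace components at a boundary point all belong to
  one set, although a trace is a limit that may fail to exist for general fields.\<close>

definition lin_functionals :: "(real^3 \<Rightarrow> complex^3) set \<Rightarrow> ((real^3 \<Rightarrow> complex^3) \<Rightarrow> complex) set" where
  "lin_functionals R = {L. \<forall>u\<in>R. \<forall>v\<in>R. \<forall>c. L (\<lambda>x. u x + c *s v x) = L u + c * L v}"

text \<open>A field is encoded by its values at all linear functionals, so that a nodal basis for finitely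
  many determining functionals represents every other linear functional as well.\<close>

lemma csubspace_functional_values:
  assumes R: "axpy_closed R"
  shows "csubspace ((\<lambda>u L. if L \<in> lin_functionals R then L u else 0) ` R)"
  unfolding csubspace_def
proof safe
  fix u v c assume uv: "u \<in> R" "v \<in> R"
  show "(\<lambda>i. (if i \<in> lin_functionals R then i u else 0) + c * (if i \<in> lin_functionals R then i v else 0))
          \<in> (\<lambda>u L. if L \<in> lin_functionals R then L u else 0) ` R"
    by (rule image_eqI[of _ _ "\<lambda>x. u x + c *s v x"])
      (use R uv in \<open>auto simp: axpy_closed_def lin_functionals_def fun_eq_iff\<close>)
qed (use R in \<open>auto simp: axpy_closed_def\<close>)

lemma lin_functional_zero:
  assumes R: "axpy_closed R" and L: "L \<in> lin_functionals R"
  shows "L (\<lambda>x. 0) = 0"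
proof -
  obtain u where u: "u \<in> R" using R by (auto simp: axpy_closed_def)
  have "L (\<lambda>x. u x + (-1) *s u x) = L u + (-1) * L u"
    using L u unfolding lin_functionals_def by blast
  then show ?thesis by (simp add: vec_eq_iff)
qed

text \<open>Subtracting the nodal combination from \<open>u\<close> leaves an element of
  \<open>R\<close> on which all determining functionals vanish, hence the zero field; every other
  functional then vanishes on the remainder as well.\<close>

lemma nodal_basis:
  assumes R: "axpy_closed R" and I: "finite I" "I \<subseteq> lin_functionals R"
    and det: "\<And>u. u \<in> R \<Longrightarrow> (\<And>L. L \<in> I \<Longrightarrow> L u = 0) \<Longrightarrow> u = (\<lambda>x. 0)"
  shows "\<exists>I'\<subseteq>I. \<exists>e. (\<forall>i\<in>I'. e i \<in> R) \<and> (\<forall>L\<in>lin_functionals R. \<forall>u\<in>R. L u = (\<Sum>i\<in>I'. i u * L (e i)))"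
proof -
  define val where "val u L = (if L \<in> lin_functionals R then L u else 0)" for u :: "real^3 \<Rightarrow> complex^3" and L
  have S: "csubspace (val ` R)"
    using csubspace_functional_values[OF R] by (simp add: val_def[abs_def])
  from csubspace_nodal_basis[OF S I(1)]
  obtain I' f where I': "I' \<subseteq> I" and f: "\<forall>i\<in>I'. f i \<in> val ` R"
    and rep: "\<forall>g\<in>val ` R. \<forall>j\<in>I. g j = (\<Sum>i\<in>I'. g i * f i j)"
    by (elim exE conjE)
  have fin: "finite I'" using I' I(1) finite_subset by blast
  from f have "\<forall>i\<in>I'. \<exists>u. u \<in> R \<and> f i = val u" by blast
  from bchoice[OF this] obtain e where e: "\<And>i. i \<in> I' \<Longrightarrow> e i \<in> R" "\<And>i. i \<in> I' \<Longrightarrow> f i = val (e i)"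
    by blast
  have "L u = (\<Sum>i\<in>I'. i u * L (e i))" if L: "L \<in> lin_functionals R" and u: "u \<in> R" for L u
  proof -
    \<comment> \<open>The encodings form a subspace, so the remainder is the encoding of an actual
      field \<open>w\<close>, to which \<open>det\<close> applies.\<close>
    have "(\<lambda>j. val u j + (-1) * (\<Sum>i\<in>I'. val u i * f i j)) \<in> val ` R"
      by (intro csubspace_add[OF S] csubspace_sum[OF S fin]) (use u f in auto)
    then obtain w where w: "w \<in> R" and eq: "(\<lambda>j. val u j + (-1) * (\<Sum>i\<in>I'. val u i * f i j)) = val w"
      by (elim imageE)
    have vw: "val w j = val u j - (\<Sum>i\<in>I'. val u i * f i j)" for j
      using fun_cong[OF eq, of j] by simp
    have "w = (\<lambda>x. 0)"
    proof (rule det[OF w])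
      fix j assume j: "j \<in> I"
      then have "val w j = 0"
        using vw[of j] bspec[OF bspec[OF rep imageI[OF u]] j] by simp
      then show "j w = 0" using I(2) j unfolding val_def by (simp add: subset_iff)
    qed
    then have "val w L = 0" using lin_functional_zero[OF R L] by (simp add: val_def)
    then have "val u L = (\<Sum>i\<in>I'. val u i * f i L)" using vw[of L] by simp
    also have "\<dots> = (\<Sum>i\<in>I'. i u * L (e i))"
      by (rule sum.cong) (use e(2) L I I' in \<open>auto simp: val_def\<close>)
    finally show ?thesis using L by (simp add: val_def)
  qed
  then show ?thesis using I' e(1) by (intro exI[of _ I'] conjI exI[of _ e] ballI)
qed

lemma ccross_eq_0:
  assumes "\<And>j. ccross b (axis j 1) = 0"
  shows "b = 0"
proof -
  have "b $ 2 = 0" "b $ 3 = 0" using assms[of 1] by (auto simp: ccross_def vec_eq_iff forall_3 axis_def)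
  moreover have "b $ 1 = 0" using assms[of 2] by (auto simp: ccross_def vec_eq_iff forall_3 axis_def)
  ultimately show ?thesis by (simp add: vec_eq_iff forall_3)
qed

text \<open>In a cell the expression \<open>a + ccross b x\<close> is fixed by its values at one
  point and at small displacements along the three axes: differences yield \<open>b\<close>, then
  \<open>a\<close> follows. Off the open cells the field is 0 by the choice of
  representative.\<close>

lemma nedelec_determining_points:
  assumes M: "tetrahedral_mesh \<M> \<Omega>"
  shows "\<exists>P. finite P \<and> (\<forall>u\<in>nedelec_space \<Gamma> \<Omega> \<M>. (\<forall>p\<in>P. u p = 0) \<longrightarrow> u = (\<lambda>x. 0))"
proof -
  have fin: "finite \<M>" using M by (auto simp: tetrahedral_mesh_def triangulation_def)
  have "\<exists>P. finite P \<and> P \<subseteq> interior T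
      \<and> (interior T \<noteq> {} \<longrightarrow> (\<forall>a b. (\<forall>p\<in>P. a + ccross b p = 0) \<longrightarrow> a = 0 \<and> b = 0))"
    for T :: "(real^3) set"
  proof (cases "interior T = {}")
    case False
    then obtain x where x: "x \<in> interior T" by auto
    then obtain \<delta> where \<delta>: "\<delta> > 0" "cball x \<delta> \<subseteq> interior T" using open_contains_cball by (metis open_interior)
    define P where "P = insert x (range (\<lambda>j. x + \<delta> *\<^sub>R axis j 1))"
    have "a = 0 \<and> b = 0" if *: "\<forall>p\<in>P. a + ccross b p = 0" for a b
    proof -
      have "ccross b (axis j 1) = 0" for j
      proof -
        have "a + ccross b x = 0" "a + ccross b (x + \<delta> *\<^sub>R axis j 1) = 0" using * by (auto simp: P_def)
        then have "\<delta> *\<^sub>R ccross b (axis j 1) = 0"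
          by (simp add: linear_add[OF linear_ccross] linear_scale[OF linear_ccross] flip: add.assoc)
        then show ?thesis using \<delta>(1) by simp
      qed
      then have "b = 0" by (rule ccross_eq_0)
      moreover have "a + ccross b x = 0" using * by (auto simp: P_def)
      ultimately show ?thesis by (simp add: ccross_def vec_eq_iff forall_3)
    qed
    moreover have "P \<subseteq> interior T"
      using x \<delta> by (auto simp: P_def dist_norm intro!: subsetD[OF \<delta>(2)])
    moreover have "finite P" by (simp add: P_def)
    ultimately show ?thesis by (intro exI[of _ P] conjI[of "finite P"] conjI[of "P \<subseteq> _"] impI allI)
  qed (rule exI[of _ "{}"], simp)
  then have "\<forall>T :: (real^3) set. \<exists>P. finite P \<and> P \<subseteq> interior T
      \<and> (interior T \<noteq> {} \<longrightarrow> (\<forall>a b. (\<forall>p\<in>P. a + ccross b p = 0) \<longrightarrow> a = 0 \<and> b = 0))" by (rule allI)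
  from choice[OF this] obtain P where P': "\<forall>T. finite (P T) \<and> P T \<subseteq> interior T
      \<and> (interior T \<noteq> {} \<longrightarrow> (\<forall>a b. (\<forall>p\<in>P T. a + ccross b p = 0) \<longrightarrow> a = 0 \<and> b = 0))" by (rule exE)
  have P: "finite (P T)" "P T \<subseteq> interior T" for T using P' by blast+
  have P0: "a = 0 \<and> b = 0" if "interior T \<noteq> {}" "\<forall>p\<in>P T. a + ccross b p = 0" for T a b
    using P' that by blast
  have "u = (\<lambda>x. 0)" if u: "u \<in> nedelec_space \<Gamma> \<Omega> \<M>" and 0: "\<forall>p\<in>(\<Union>T\<in>\<M>. P T). u p = 0" for u
  proof
    fix x
    show "u x = 0"
    proof (cases "x \<in> (\<Union>T\<in>\<M>. interior T)")
      case True
      then obtain T where T: "T \<in> \<M>" "x \<in> interior T" by auto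
      obtain a b where ab: "\<And>x. x \<in> interior T \<Longrightarrow> u x = a + ccross b x"
        using u T unfolding nedelec_space_def by blast
      have "a = 0 \<and> b = 0"
      proof (rule P0[of T])
        show "interior T \<noteq> {}" using T(2) by auto
        show "\<forall>p\<in>P T. a + ccross b p = 0" using 0 T(1) P(2)[of T] ab by (metis UN_I subsetD)
      qed
      then show ?thesis using ab[OF T(2)] by (simp add: ccross_def vec_eq_iff forall_3)
    next
      case False
      then show ?thesis using u by (simp add: nedelec_space_def)
    qed
  qed
  then show ?thesis using fin P(1) by (intro exI[of _ "\<Union>T\<in>\<M>. P T"]) auto
qed

lemma nedelec_nodal_basis:
  assumes S: "open \<Omega>" "bounded \<Omega>" and M: "tetrahedral_mesh \<M> \<Omega>" and R: "R = nedelec_space \<Gamma> \<Omega> \<M>" "R \<noteq> {}"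
  obtains I e where "finite I" "I \<subseteq> lin_functionals R" "\<And>i. i \<in> I \<Longrightarrow> e i \<in> R"
    "\<And>L u. L \<in> lin_functionals R \<Longrightarrow> u \<in> R \<Longrightarrow> L u = (\<Sum>i\<in>I. i u * L (e i))"
proof -
  have cl: "axpy_closed R" unfolding axpy_closed_def using R nedelec_axpy[OF S] by blast
  from nedelec_determining_points[OF M, of \<Gamma>]
  obtain P where P: "finite P" "\<forall>u\<in>R. (\<forall>p\<in>P. u p = 0) \<longrightarrow> u = (\<lambda>x. 0)"
    unfolding R(1) by (elim exE conjE)
  define I where "I = (\<lambda>(p, i) u. u p $ i :: complex) ` (P \<times> (UNIV :: 3 set))"
  have I: "finite I" "I \<subseteq> lin_functionals R" using P(1) by (auto simp: I_def lin_functionals_def)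
  have det: "u = (\<lambda>x. 0)" if "u \<in> R" "\<And>L. L \<in> I \<Longrightarrow> L u = 0" for u
  proof (rule P(2)[rule_format, OF that(1)])
    fix p assume p: "p \<in> P"
    have "(\<lambda>u. u p $ i) \<in> I" for i
      unfolding I_def by (rule image_eqI[of _ _ "(p, i)"]) (use p in auto)
    from that(2)[OF this] show "u p = 0" unfolding vec_eq_iff zero_index by (rule allI)
  qed
  have "\<exists>I'\<subseteq>I. \<exists>e. (\<forall>i\<in>I'. e i \<in> R)
      \<and> (\<forall>L\<in>lin_functionals R. \<forall>u\<in>R. L u = (\<Sum>i\<in>I'. i u * L (e i)))"
    by (rule nodal_basis[OF cl I]) (rule det)
  then obtain I' e where "I' \<subseteq> I" "\<forall>i\<in>I'. e i \<in> R"
    "\<forall>L\<in>lin_functionals R. \<forall>u\<in>R. L u = (\<Sum>i\<in>I'. i u * L (e i))"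
    by (elim exE conjE)
  then show ?thesis using that[of I' e] I finite_subset[OF _ I(1)] subset_trans[OF _ I(2)] by simp
qed

section \<open>Continuity of the discrete state\<close>

lemma lin_functionals_antimono: "W \<subseteq> R \<Longrightarrow> lin_functionals R \<subseteq> lin_functionals W"
  unfolding lin_functionals_def by blast

text \<open>Two solutions of the mixed system differ by a multiplier term, so the multiplier range only
  enters as a subspace of functionals; neither the multipliers nor their uniqueness matter.\<close>

lemma discrete_state_tendsto:
  assumes \<Omega>: "open \<Omega>" "bounded \<Omega>" and \<Omega>\<^sub>0: "open \<Omega>\<^sub>0" "\<Omega>\<^sub>0 \<subseteq> \<Omega>"
    and M: "tetrahedral_mesh \<M> \<Omega>" and M0: "tetrahedral_mesh \<M>\<^sub>0 \<Omega>\<^sub>0"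
    and R: "R = nedelec_space \<Gamma> \<Omega> \<M>" and U: "U = lagrange_space D \<M>\<^sub>0"
    and \<epsilon>: "\<epsilon> \<in> Linf \<Omega>\<^sub>0" and \<gamma>: "\<And>k. \<gamma> k \<in> Linf \<Omega>" "\<gamma>' \<in> Linf \<Omega>"
    and lim: "uniform_limit \<Omega> \<gamma> \<gamma>' sequentially"
    and E: "\<And>k. discrete_state \<Omega> \<Omega>\<^sub>0 \<mu> \<epsilon> \<omega> J R U (\<gamma> k) (E k)"
    and E': "discrete_state \<Omega> \<Omega>\<^sub>0 \<mu> \<epsilon> \<omega> J R U \<gamma>' E'"
    and unique: "\<And>F. discrete_state \<Omega> \<Omega>\<^sub>0 \<mu> \<epsilon> \<omega> J R U \<gamma>' F \<Longrightarrow> F = E'"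
    and L: "L \<in> lin_functionals R"
  shows "(\<lambda>k. L (E k)) \<longlonglongrightarrow> L E'"
proof -
  let ?a = "form_a \<Omega> \<mu> \<omega>" and ?b = "form_b \<Omega>\<^sub>0 \<epsilon>"
  have bd0: "bounded \<Omega>\<^sub>0" using \<Omega>(2) \<Omega>\<^sub>0(2) bounded_subset by blast
  have ER: "E k \<in> R" for k using E by (simp add: discrete_state_def)
  have E'R: "E' \<in> R" using E' by (simp add: discrete_state_def)
  have edge: "u \<in> edge_fields \<M>" if "u \<in> R" for u using that R nedelec_edge_fields by blast
  have axpyR: "(\<lambda>x. u x + c *s v x) \<in> R" if "u \<in> R" "v \<in> R" for u v c
    using nedelec_axpy[OF \<Omega>] that unfolding R by blast
  have axpyU: "(\<lambda>x. u x + c * v x) \<in> U" if "u \<in> U" "v \<in> U" for u v c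
    using lagrange_axpy that unfolding U by blast
  have linf: "u \<in> Linf \<Omega>" "curl u \<in> Linf \<Omega>" if "u \<in> R" for u
    using Linf_edge_fields[OF M \<Omega>(1) edge[OF that]] by auto
  have linf0: "u \<in> Linf \<Omega>\<^sub>0" if "u \<in> R" for u
    using Linf_mono[OF linf(1)[OF that] \<Omega>(1) \<Omega>\<^sub>0] .
  have gradU: "grad \<phi> \<in> Linf \<Omega>\<^sub>0" if "\<phi> \<in> U" for \<phi>
    using Linf_grad_affine_fields[OF M0 \<Omega>\<^sub>0(1)] lagrange_affine_fields that unfolding U by blast
  have a_left: "?a \<beta> (\<lambda>x. u x + c *s v x) F = ?a \<beta> u F + c * ?a \<beta> v F"
    if "\<beta> \<in> Linf \<Omega>" "u \<in> R" "v \<in> R" "F \<in> R" for \<beta> u v c F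
    by (intro form_a_axpy_left[OF M \<Omega>] edge that)
  have a_right: "?a \<beta> F (\<lambda>x. u x + c *s v x) = ?a \<beta> F u + cnj c * ?a \<beta> F v"
    if "\<beta> \<in> Linf \<Omega>" "u \<in> R" "v \<in> R" "F \<in> R" for \<beta> u v c F
    by (intro form_a_axpy_right[OF M \<Omega>] edge that)
  have b_left: "?b (\<lambda>x. u x + c *s v x) w = ?b u w + c * ?b v w"
    if "u \<in> R" "v \<in> R" "w \<in> Linf \<Omega>\<^sub>0" for u v w c
    by (intro form_b_axpy_left[OF \<Omega>\<^sub>0(1) bd0 \<epsilon>] linf0 that axpyR) simp
  have b_right: "?b w (\<lambda>x. u x + c *s v x) = ?b w u + cnj c * ?b w v"
    if "u \<in> R" "v \<in> R" "w \<in> Linf \<Omega>\<^sub>0" for u v w c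
    by (intro form_b_axpy_right[OF \<Omega>\<^sub>0(1) bd0 \<epsilon>] linf0 that axpyR) simp
  have b_grad: "?b (grad (\<lambda>x. \<phi> x + c * \<psi> x)) w = ?b (grad \<phi>) w + c * ?b (grad \<psi>) w"
    if "\<phi> \<in> U" "\<psi> \<in> U" "w \<in> R" for \<phi> \<psi> w c
  proof (rule form_b_axpy_left[OF \<Omega>\<^sub>0(1) bd0 \<epsilon> gradU[OF that(1)] gradU[OF that(2)]
        gradU[OF axpyU[OF that(1,2)]] linf0[OF that(3)]])
    show "AE x in lebesgue_on \<Omega>\<^sub>0. grad (\<lambda>x. \<phi> x + c * \<psi> x) x = grad \<phi> x + c *s grad \<psi> x"
      using AE_interior_mesh[OF M0 \<Omega>\<^sub>0(1)]
    proof eventually_elim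
      case (elim x)
      then obtain T where T: "T \<in> \<M>\<^sub>0" "x \<in> interior T" by blast
      have "\<phi> \<in> affine_fields \<M>\<^sub>0" "\<psi> \<in> affine_fields \<M>\<^sub>0"
        using that(1,2) lagrange_affine_fields unfolding U by blast+
      then show ?case using T by (intro grad_axpy affine_fields_differentiable[OF _ T])
    qed
  qed
  have ne: "R \<noteq> {}" using E'R by blast
  obtain I e where I: "finite I" "I \<subseteq> lin_functionals R" and e: "\<And>i. i \<in> I \<Longrightarrow> e i \<in> R"
    and rep: "\<And>L u. L \<in> lin_functionals R \<Longrightarrow> u \<in> R \<Longrightarrow> L u = (\<Sum>i\<in>I. i u * L (e i))"
    by (rule nedelec_nodal_basis[OF \<Omega> M R ne]) (rule that)
  have rep_a: "(\<Sum>i\<in>I. i u * ?a \<beta> (e i) F) = ?a \<beta> u F" if "\<beta> \<in> Linf \<Omega>" "u \<in> R" "F \<in> R" for \<beta> u F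
  proof -
    have "(\<lambda>u. ?a \<beta> u F) \<in> lin_functionals R"
      unfolding lin_functionals_def using a_left that by blast
    from rep[OF this that(2)] show ?thesis by simp
  qed
  \<comment> \<open>The discretely divergence-free fields (with weight \<epsilon>): the constraint
    equation is built into this space, and all states lie in it.\<close>
  define W where "W = {u \<in> R. \<forall>\<psi>\<in>U. ?b u (grad \<psi>) = 0}"
  define val where "val u L = (if L \<in> lin_functionals W then L u else 0)" for u :: "real^3 \<Rightarrow> complex^3" and L
  have W: "axpy_closed W"
    unfolding axpy_closed_def
  proof (intro conjI ballI allI)
    show "W \<noteq> {}" using E' by (auto simp: W_def discrete_state_def)
    fix u v c assume uv: "u \<in> W" "v \<in> W"
    then show "(\<lambda>x. u x + c *s v x) \<in> W"
      using axpyR[of u v c] b_left[of u v _ c] gradU by (simp add: W_def)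
  qed
  have WR: "W \<subseteq> R" by (auto simp: W_def)
  have IW: "I \<subseteq> lin_functionals W" using I(2) lin_functionals_antimono[OF WR] by blast
  have val: "val u i = i u" if "i \<in> I" for u i using that IW by (auto simp: val_def)
  have EW: "E k \<in> W" for k using E[of k] by (auto simp: W_def discrete_state_def)
  have E'W: "E' \<in> W" using E' by (auto simp: W_def discrete_state_def)
  \<comment> \<open>The multiplier term as the vector of its values on the basis fields. It is
    linear in \<phi>, although the form is antilinear in the test field, so these vectors form a
    complex subspace.\<close>
  define mult where "mult \<phi> j = (if j \<in> I then ?b (grad \<phi>) (e j) else 0)" for \<phi> j
  have \<Phi>: "csubspace (mult ` U)"
    unfolding csubspace_def
  proof (intro conjI ballI allI)
    show "mult ` U \<noteq> {}" using E' by (auto simp: discrete_state_def)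
    fix f g c assume "f \<in> mult ` U" "g \<in> mult ` U"
    then obtain \<phi> \<psi> where *: "\<phi> \<in> U" "\<psi> \<in> U" "f = mult \<phi>" "g = mult \<psi>" by blast
    have "(\<lambda>i. f i + c * g i) = mult (\<lambda>x. \<phi> x + c * \<psi> x)"
      unfolding *(3,4) mult_def using b_grad[OF *(1,2) e] by (auto simp: fun_eq_iff)
    then show "(\<lambda>i. f i + c * g i) \<in> mult ` U" using axpyU[OF *(1,2)] by blast
  qed
  have coord: "(\<lambda>k. i (E k)) \<longlonglongrightarrow> i E'" if i: "i \<in> I" for i
  proof -
    have "(\<lambda>k. val (E k) i) \<longlonglongrightarrow> val E' i"
    proof (rule linear_systems_solutions_converge[where X = "val ` W" and x = "\<lambda>k. val (E k)"
          and x' = "val E'" and A = "\<lambda>k i b. ?a (\<gamma> k) (e i) (e b)" and A' = "\<lambda>i b. ?a \<gamma>' (e i) (e b)",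
          OF I(1) I(1) _ \<Phi> _ _ _ _ _ i])
      show "csubspace (val ` W)"
        using csubspace_functional_values[OF W] by (simp add: val_def[abs_def])
      show "(\<lambda>k. ?a (\<gamma> k) (e i) (e b)) \<longlonglongrightarrow> ?a \<gamma>' (e i) (e b)" if "i \<in> I" "b \<in> I" for i b
        by (intro form_a_tendsto[OF \<Omega> \<gamma> lim] linf e that)
      show "val (E k) \<in> val ` W" for k using EW by blast
      show "val E' \<in> val ` W" using E'W by blast
    next
      fix k
      obtain \<phi> where \<phi>: "\<phi> \<in> U" "\<And>F. F \<in> R \<Longrightarrow> ?a (\<gamma> k) (E k) F + ?b (grad \<phi>) F
          = \<i> * of_real \<omega> * (LINT x|lebesgue_on \<Omega>. cdot (J x) (F x))"
        using E[of k] by (auto simp: discrete_state_def)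
      obtain \<psi> where \<psi>: "\<psi> \<in> U" "\<And>F. F \<in> R \<Longrightarrow> ?a \<gamma>' E' F + ?b (grad \<psi>) F
          = \<i> * of_real \<omega> * (LINT x|lebesgue_on \<Omega>. cdot (J x) (F x))"
        using E' by (auto simp: discrete_state_def)
      show "\<exists>g\<in>mult ` U. \<forall>b\<in>I. (\<Sum>i\<in>I. val (E k) i * ?a (\<gamma> k) (e i) (e b))
          - (\<Sum>i\<in>I. val E' i * ?a \<gamma>' (e i) (e b)) = g b"
      proof (intro bexI ballI)
        \<comment> \<open>Subtracting the two state equations removes the source and leaves the
          difference of the multiplier terms.\<close>
        show "mult (\<lambda>x. \<psi> x + (-1) * \<phi> x) \<in> mult ` U" using axpyU[OF \<psi>(1) \<phi>(1)] by blast
        fix b assume b: "b \<in> I"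
        have "(\<Sum>i\<in>I. val (E k) i * ?a (\<gamma> k) (e i) (e b)) = ?a (\<gamma> k) (E k) (e b)"
          using rep_a[OF \<gamma>(1) ER e[OF b]] val by (simp cong: sum.cong)
        moreover have "(\<Sum>i\<in>I. val E' i * ?a \<gamma>' (e i) (e b)) = ?a \<gamma>' E' (e b)"
          using rep_a[OF \<gamma>(2) E'R e[OF b]] val by (simp cong: sum.cong)
        moreover have "?a (\<gamma> k) (E k) (e b) = ?a \<gamma>' E' (e b) + ?b (grad \<psi>) (e b) - ?b (grad \<phi>) (e b)"
          unfolding eq_diff_eq \<phi>(2)[OF e[OF b]] \<psi>(2)[OF e[OF b]] ..
        moreover have "mult (\<lambda>x. \<psi> x + (-1) * \<phi> x) b = ?b (grad \<psi>) (e b) + (-1) * ?b (grad \<phi>) (e b)"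
          unfolding mult_def if_P[OF b] by (rule b_grad[OF \<psi>(1) \<phi>(1) e[OF b]])
        ultimately show "(\<Sum>i\<in>I. val (E k) i * ?a (\<gamma> k) (e i) (e b))
            - (\<Sum>i\<in>I. val E' i * ?a \<gamma>' (e i) (e b)) = mult (\<lambda>x. \<psi> x + (-1) * \<phi> x) b"
          by (simp only:) simp
      qed
    next
      fix y g assume y: "y \<in> val ` W" and g: "g \<in> mult ` U"
        and eq: "\<And>b. b \<in> I \<Longrightarrow> (\<Sum>i\<in>I. y i * ?a \<gamma>' (e i) (e b)) = g b"
      obtain D where D: "D \<in> W" "y = val D" using y by blast
      have DR: "D \<in> R" using D(1) WR by blast
      obtain \<phi> where \<phi>: "\<phi> \<in> U" "g = mult \<phi>" using g by blast
      have hom: "?a \<gamma>' D (e b) = ?b (grad \<phi>) (e b)" if b: "b \<in> I" for b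
        using rep_a[OF \<gamma>(2) DR e[OF b]] eq[OF b] b val unfolding D(2) \<phi>(2) mult_def
        by (simp cong: sum.cong)
      \<comment> \<open>From the basis fields to all test fields: conjugation turns both sides,
        which are antilinear in the test field, into linear functionals.\<close>
      have homR: "?a \<gamma>' D F = ?b (grad \<phi>) F" if F: "F \<in> R" for F
      proof -
        have "(\<lambda>F. cnj (?a \<gamma>' D F)) \<in> lin_functionals R"
          unfolding lin_functionals_def mem_Collect_eq
          by (intro ballI allI) (simp add: a_right[OF \<gamma>(2) _ _ DR])
        moreover have "(\<lambda>F. cnj (?b (grad \<phi>) F)) \<in> lin_functionals R"
          unfolding lin_functionals_def mem_Collect_eq
          by (intro ballI allI) (simp add: b_right[OF _ _ gradU[OF \<phi>(1)]])
        ultimately have "cnj (?a \<gamma>' D F) = cnj (?b (grad \<phi>) F)"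
          using rep[OF _ F, of "\<lambda>F. cnj (?a \<gamma>' D F)"] rep[OF _ F, of "\<lambda>F. cnj (?b (grad \<phi>) F)"] hom
          by (simp cong: sum.cong)
        then show ?thesis by simp
      qed
      obtain \<psi> where \<psi>: "\<psi> \<in> U" "\<And>F. F \<in> R \<Longrightarrow> ?a \<gamma>' E' F + ?b (grad \<psi>) F
          = \<i> * of_real \<omega> * (LINT x|lebesgue_on \<Omega>. cdot (J x) (F x))"
        using E' by (auto simp: discrete_state_def)
      \<comment> \<open>Adding the homogeneous solution \<open>D\<close> to \<open>E'\<close>, with
        multiplier \<psi> - \<phi>, solves the limit problem again, so uniqueness forces
        \<open>D\<close> to vanish. The factor \<open>1 *s\<close> matches the shape of the
        combination lemmas.\<close>
      have "discrete_state \<Omega> \<Omega>\<^sub>0 \<mu> \<epsilon> \<omega> J R U \<gamma>' (\<lambda>x. E' x + 1 *s D x)"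
        unfolding discrete_state_def
      proof (intro conjI bexI[of _ "\<lambda>x. \<psi> x + (-1) * \<phi> x"] ballI)
        show "(\<lambda>x. E' x + 1 *s D x) \<in> R" by (rule axpyR[OF E'R DR])
        show "(\<lambda>x. \<psi> x + (-1) * \<phi> x) \<in> U" by (rule axpyU[OF \<psi>(1) \<phi>(1)])
        show "?a \<gamma>' (\<lambda>x. E' x + 1 *s D x) F + ?b (grad (\<lambda>x. \<psi> x + (-1) * \<phi> x)) F
            = \<i> * of_real \<omega> * (LINT x|lebesgue_on \<Omega>. cdot (J x) (F x))" if F: "F \<in> R" for F
          unfolding a_left[OF \<gamma>(2) E'R DR F] b_grad[OF \<psi>(1) \<phi>(1) F]
          using \<psi>(2)[OF F] homR[OF F] by simp
        show "?b (\<lambda>x. E' x + 1 *s D x) (grad \<xi>) = 0" if \<xi>: "\<xi> \<in> U" for \<xi>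
          unfolding b_left[OF E'R DR gradU[OF \<xi>]] using D(1) E'W \<xi> by (simp add: W_def)
      qed
      from unique[OF this] have "D x = 0" for x by (simp add: fun_eq_iff)
      then have "D = (\<lambda>x. 0)" by (rule ext)
      then show "\<forall>i\<in>I. y i = 0"
        using lin_functional_zero[OF W] IW by (auto simp: D(2) val_def)
    qed
    then show ?thesis by (simp add: val[OF i])
  qed
  have "(\<lambda>k. \<Sum>i\<in>I. i (E k) * L (e i)) \<longlonglongrightarrow> (\<Sum>i\<in>I. i E' * L (e i))"
    by (intro tendsto_intros coord)
  then show ?thesis using rep[OF L ER] rep[OF L E'R] by simp
qed

section \<open>Tangential traces on boundary faces\<close>

text \<open>From any \<open>z\<close> in \<open>F\<close> the segment to \<open>x\<close> can be
  prolonged beyond \<open>x\<close> inside \<open>F\<close>; a linear function with its maximum over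
  \<open>F\<close> at \<open>x\<close> therefore cannot be smaller at \<open>z\<close>.\<close>

lemma halfspace_touching_rel_interior:
  fixes F :: "'a::euclidean_space set"
  assumes F: "convex F" "F \<subseteq> closure \<Omega>" and x: "x \<in> rel_interior F"
    and \<nu>: "\<forall>y\<in>\<Omega>. \<nu> \<bullet> (y - x) \<le> 0" and z: "z \<in> F"
  shows "\<nu> \<bullet> z = \<nu> \<bullet> x"
proof -
  have "closure \<Omega> \<subseteq> {y. \<nu> \<bullet> y \<le> \<nu> \<bullet> x}"
    using \<nu> by (intro closure_minimal closed_halfspace_le) (auto simp: inner_diff_right)
  then have le: "\<nu> \<bullet> y \<le> \<nu> \<bullet> x" if "y \<in> F" for y using F(2) that by blast
  obtain e where e: "e > 1" "(1 - e) *\<^sub>R z + e *\<^sub>R x \<in> F"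
    using convex_rel_interior_iff[OF F(1), of x] x z by blast
  have "(1 - e) * (\<nu> \<bullet> z) + e * (\<nu> \<bullet> x) \<le> \<nu> \<bullet> x"
    using le[OF e(2)] by (simp add: inner_add_right)
  then have "(e - 1) * (\<nu> \<bullet> x) \<le> (e - 1) * (\<nu> \<bullet> z)" by (simp add: algebra_simps)
  then have "\<nu> \<bullet> x \<le> \<nu> \<bullet> z" using e(1) by simp
  with le[OF z] show ?thesis by simp
qed

text \<open>A half-space supporting the domain at one of the points has all of \<open>F\<close> in
  its bounding plane, so it supports at the other point too. Both points have the same candidate
  normals, which also settles the default value 0.\<close>

lemma outer_normal_rel_interior:
  assumes F: "convex F" "F \<subseteq> closure \<Omega>" and x: "x \<in> rel_interior F" and x': "x' \<in> rel_interior F"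
  shows "outer_normal \<Omega> x = outer_normal \<Omega> x'"
proof -
  have "\<forall>y\<in>\<Omega>. \<nu> \<bullet> (y - x') \<le> 0" 
    if "\<forall>y\<in>\<Omega>. \<nu> \<bullet> (y - x) \<le> 0" "x \<in> rel_interior F" "x' \<in> rel_interior F" for \<nu> x x'
    using halfspace_touching_rel_interior[OF F that(2,1), of x'] that(1,3) rel_interior_subset[of F]
    by (auto simp: inner_diff_right)
  then have "(norm \<nu> = 1 \<and> (\<forall>y\<in>\<Omega>. \<nu> \<bullet> (y - x) \<le> 0)) \<longleftrightarrow> (norm \<nu> = 1 \<and> (\<forall>y\<in>\<Omega>. \<nu> \<bullet> (y - x') \<le> 0))" for \<nu>
    using x x' by blast
  then show ?thesis unfolding outer_normal_def by simp
qed

text \<open>The supporting plane at \<open>x\<close> is the affine hull of the face. From an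
  interior point \<open>y\<close> of the cell, the ray through a domain point \<open>z\<close> near
  \<open>x\<close> hits this plane near \<open>x\<close>, hence in the face; so \<open>z\<close>
  lies strictly between \<open>y\<close> and a point of \<open>T\<close>.\<close>

lemma boundary_face_locally_in_cell:
  fixes T :: "(real^3) set"
  assumes \<Omega>: "open \<Omega>" "convex \<Omega>" "\<Omega> \<noteq> {}" and T: "3 simplex T" "T \<subseteq> closure \<Omega>"
    and F: "F facet_of T" "F \<subseteq> frontier \<Omega>" and x: "x \<in> rel_interior F"
  shows "\<forall>\<^sub>F z in at x within \<Omega>. z \<in> interior T"
proof -
  have xF: "x \<in> F" using x rel_interior_subset by blast
  have FT: "F \<subseteq> T" using F(1) by (rule facet_of_imp_subset)
  have cF: "convex F" using F(1) facet_of_imp_face_of face_of_imp_convex by blast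
  have "x \<notin> \<Omega>" using xF F(2) \<Omega>(1) by (auto simp: frontier_def interior_open)
  then obtain \<nu> b where \<nu>: "\<nu> \<noteq> 0" and sep: "\<And>y. y \<in> \<Omega> \<Longrightarrow> \<nu> \<bullet> y \<le> b" "b \<le> \<nu> \<bullet> x"
    using separating_hyperplane_sets[OF \<Omega>(2) convex_singleton[of x] \<Omega>(3)] by auto
  define \<beta> where "\<beta> = \<nu> \<bullet> x"
  have half: "\<forall>y\<in>\<Omega>. \<nu> \<bullet> (y - x) \<le> 0" using sep by (force simp: inner_diff_right)
  \<comment> \<open>Open subsets of the closure stay strictly below the supporting plane; this is
    applied to the interior of \<open>T\<close> and to the domain itself.\<close>
  have strict: "\<nu> \<bullet> y < \<beta>" if "y \<in> S" "open S" "S \<subseteq> closure \<Omega>" for y S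
  proof -
    have "closure \<Omega> \<subseteq> {y. \<nu> \<bullet> y \<le> \<beta>}"
      using half by (intro closure_minimal closed_halfspace_le) (auto simp: inner_diff_right \<beta>_def)
    then have "S \<subseteq> interior {y. \<nu> \<bullet> y \<le> \<beta>}" using that by (intro interior_maximal) auto
    then show ?thesis using that(1) \<nu> by auto
  qed
  have "F \<subseteq> closure \<Omega>" using F(2) by (auto simp: frontier_def)
  then have FH: "F \<subseteq> {z. \<nu> \<bullet> z = \<beta>}"
    using halfspace_touching_rel_interior[OF cF _ x half] by (auto simp: \<beta>_def)
  have dimT: "aff_dim T = 3" using T(1) by (rule aff_dim_simplex)
  \<comment> \<open>Both dimensions are 2, so the plane containing the face is its affine hull, and
    relative neighbourhoods in the face are plane discs.\<close>
  then have "aff_dim F = aff_dim {z. \<nu> \<bullet> z = \<beta>}"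
    using F(1) aff_dim_hyperplane[OF \<nu>, of \<beta>] by (simp add: facet_of_def)
  then have hull: "affine hull F = {z. \<nu> \<bullet> z = \<beta>}"
    using aff_dim_eq_full_gen[OF FH] affine_hyperplane[of \<nu> \<beta>] by (simp add: affine_hull_eq)
  obtain \<delta> where \<delta>: "\<delta> > 0" "ball x \<delta> \<inter> {z. \<nu> \<bullet> z = \<beta>} \<subseteq> F"
    using x unfolding mem_rel_interior_ball hull by blast
  have cT: "convex T" using T(1) by (rule convex_simplex)
  have "interior T \<noteq> {}"
    using interior_rel_interior_gen[of T] dimT rel_interior_eq_empty[OF cT] xF FT by auto
  then obtain y where y: "y \<in> interior T" by blast
  have y\<beta>: "\<nu> \<bullet> y < \<beta>" using strict[OF y] interior_subset[of T] T(2) by auto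
  \<comment> \<open>Central projection from \<open>y\<close> onto the supporting plane, with
    stretching factor \<open>t z\<close>; it fixes \<open>x\<close>, and the factor exceeds 1 at
    points strictly between the levels of \<open>y\<close> and of the plane.\<close>
  define t where "t z = (\<beta> - \<nu> \<bullet> y) / (\<nu> \<bullet> z - \<nu> \<bullet> y)" for z
  define w where "w z = y + t z *\<^sub>R (z - y)" for z
  have "isCont w x"
    unfolding w_def t_def by (intro continuous_intros) (use y\<beta> in \<open>simp add: \<beta>_def\<close>)
  moreover have "w x = x" using y\<beta> by (simp add: w_def t_def \<beta>_def)
  ultimately have "(w \<longlongrightarrow> x) (at x)" by (simp add: isCont_def)
  then have "\<forall>\<^sub>F z in at x. dist (w z) x < \<delta>" using \<delta>(1) by (rule tendstoD)
  moreover have "((\<lambda>z. \<nu> \<bullet> z) \<longlongrightarrow> \<nu> \<bullet> x) (at x)" by (intro tendsto_intros)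
  then have "\<forall>\<^sub>F z in at x. \<nu> \<bullet> y < \<nu> \<bullet> z"
    by (rule order_tendstoD) (use y\<beta> in \<open>simp add: \<beta>_def\<close>)
  ultimately have "\<forall>\<^sub>F z in at x. dist (w z) x < \<delta> \<and> \<nu> \<bullet> y < \<nu> \<bullet> z" by (rule eventually_conj)
  then have "\<forall>\<^sub>F z in at x within \<Omega>. dist (w z) x < \<delta> \<and> \<nu> \<bullet> y < \<nu> \<bullet> z"
    using at_le[of \<Omega> UNIV x] filter_leD by blast
  moreover have "\<forall>\<^sub>F z in at x within \<Omega>. z \<in> \<Omega>" by (simp add: eventually_at_filter)
  ultimately show ?thesis
  proof eventually_elim
    case (elim z)
    have z\<beta>: "\<nu> \<bullet> z < \<beta>" using strict[OF elim(2) \<Omega>(1)] closure_subset by blast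
    have "\<nu> \<bullet> w z = \<beta>"
      using elim(1) by (simp add: w_def t_def inner_add_right inner_diff_right)
    then have "w z \<in> ball x \<delta> \<inter> {z. \<nu> \<bullet> z = \<beta>}" using elim(1) by (simp add: dist_commute)
    then have wT: "w z \<in> closure T" using \<delta>(2) FT closure_subset[of T] by blast
    have t: "t z > 1" using elim(1) z\<beta> by (simp add: t_def field_simps)
    have "w z - (1 - 1 / t z) *\<^sub>R (w z - y) \<in> interior T"
      by (rule mem_interior_closure_convex_shrink[OF cT y wT]) (use t in auto)
    also have "w z - (1 - 1 / t z) *\<^sub>R (w z - y) = z"
      using t by (simp add: w_def algebra_simps)
    finally show ?case .
  qed
qed

text \<open>Near \<open>x\<close> the domain lies in one open cell, where the field coincides with a
  continuous affine expression; this makes the limit exist.\<close>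

lemma inner_trace_edge_field:
  assumes \<Omega>: "open \<Omega>" "convex \<Omega>" "\<Omega> \<noteq> {}" and T: "3 simplex T" "T \<subseteq> closure \<Omega>"
    and F: "F facet_of T" "F \<subseteq> frontier \<Omega>" and x: "x \<in> rel_interior F"
    and u: "\<And>y. y \<in> interior T \<Longrightarrow> u y = a + ccross b y"
  shows "inner_trace \<Omega> u x = a + ccross b x"
  unfolding inner_trace_def
proof (rule tendsto_Lim)
  have "x \<in> frontier \<Omega>" using x rel_interior_subset F(2) by blast
  then have "x islimpt \<Omega>" using \<Omega>(1) by (auto simp: frontier_def interior_open closure_def)
  then show "\<not> trivial_limit (at x within \<Omega>)" by (simp add: trivial_limit_within)
  have "continuous_on UNIV (\<lambda>x. a + ccross b x)"
    using linear_continuous_on[OF linear_conv_bounded_linear[THEN iffD1, OF linear_ccross]]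
    by (intro continuous_intros)
  then have "((\<lambda>x. a + ccross b x) \<longlongrightarrow> a + ccross b x) (at x within \<Omega>)"
    by (meson UNIV_I continuous_on_def continuous_on_subset tendsto_within_subset top_greatest)
  moreover have "\<forall>\<^sub>F y in at x within \<Omega>. a + ccross b y = u y"
    using boundary_face_locally_in_cell[OF \<Omega> T F x] by eventually_elim (simp add: u)
  ultimately show "(u \<longlongrightarrow> a + ccross b x) (at x within \<Omega>)"
    using Lim_transform_eventually by blast
qed

text \<open>A facet of a tetrahedron is the hull of three of its vertices, so the choice in
  \<open>triangle_vertices\<close> succeeds; the chosen points are distinct because the facet has
  dimension 2.\<close>

lemma triangle_vertices_facet:
  assumes T: "3 simplex (T :: (real^3) set)" and F: "F facet_of T" and abc: "triangle_vertices F = (a, b, c)"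
  shows "F = convex hull {a, b, c}" "distinct [a, b, c]"
proof -
  obtain C where C: "\<not> affine_dependent C" "int (card C) = 3 + 1" "T = convex hull C"
    using T unfolding simplex_def by blast
  obtain v where v: "v \<in> C" "F = convex hull (C - {v})"
    using F unfolding C(3) facet_of_convex_hull_affine_independent[OF C(1)] by blast
  have "card (C - {v}) = 3" using C(2) v(1) by simp
  then obtain p q r where "C - {v} = {p, q, r}" unfolding card_3_iff by blast
  then have "case (p, q, r) of (a, b, c) \<Rightarrow> F = convex hull {a, b, c}" using v(2) by simp
  then have "case triangle_vertices F of (a, b, c) \<Rightarrow> F = convex hull {a, b, c}"
    unfolding triangle_vertices_def by (rule someI)
  then show Fabc: "F = convex hull {a, b, c}" using abc by simp
  have "aff_dim F = 2" using F aff_dim_simplex[OF T] by (simp add: facet_of_def)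
  then have "2 \<le> int (card {a, b, c}) - 1"
    using aff_dim_le_card[of "{a, b, c}"] Fabc by (simp add: aff_dim_convex_hull)
  then have "card {a, b, c} \<ge> 3" by simp
  then show "distinct [a, b, c]"
    by (auto simp: card_insert_if split: if_splits)
qed

lemma triangle_param_rel_interior:
  assumes T: "3 simplex (T :: (real^3) set)" and F: "F facet_of T" and st: "s > 0" "t > 0" "s + t < 1"
  shows "triangle_param F (s, t) \<in> rel_interior F"
proof -
  obtain a b c where abc: "triangle_vertices F = (a, b, c)" using prod_cases3 by blast
  note v = triangle_vertices_facet[OF T F abc]
  \<comment> \<open>Barycentric coordinates as weights on the vertices, well defined since these are
    distinct. Strictly positive weights lead to the relative interior.\<close>
  define u where "u x = (if x = a then 1 - s - t else if x = b then s else t)" for x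
  have "triangle_param F (s, t) = (1 - s - t) *\<^sub>R a + (s *\<^sub>R b + t *\<^sub>R c)"
    by (simp add: triangle_param_def abc algebra_simps)
  moreover have u: "u a = 1 - s - t" "u b = s" "u c = t" using v(2) by (auto simp: u_def)
  moreover have "(\<Sum>x\<in>{a, b, c}. u x *\<^sub>R x) = u a *\<^sub>R a + (u b *\<^sub>R b + u c *\<^sub>R c)"
    using v(2) by simp
  ultimately have "triangle_param F (s, t) = (\<Sum>x\<in>{a, b, c}. u x *\<^sub>R x)" by simp
  moreover have "\<forall>x\<in>{a, b, c}. 0 < u x" using u st by simp
  moreover have "sum u {a, b, c} = 1" using u v(2) by simp
  ultimately have "triangle_param F (s, t) \<in> {y. \<exists>u. (\<forall>x\<in>{a, b, c}. 0 < u x) \<and> sum u {a, b, c} = 1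
      \<and> (\<Sum>x\<in>{a, b, c}. u x *\<^sub>R x) = y}"
    unfolding mem_Collect_eq by (intro exI[of _ u] conjI) (assumption, assumption, erule sym)
  then have "triangle_param F (s, t) \<in> rel_interior (convex hull {a, b, c})"
    by (rule subsetD[OF explicit_subset_rel_interior_convex_hull_minimal, rotated]) simp
  then show ?thesis using v(1) by simp
qed

section \<open>The reference triangle and traces on faces\<close>

lemma ref_triangle_bounded: "bounded ref_triangle"
proof (rule bounded_subset)
  show "bounded (cbox (0, 0) (1, 1 :: real) :: (real \<times> real) set)" by (rule bounded_cbox)
  show "ref_triangle \<subseteq> cbox (0, 0) (1, 1)" by (auto simp: ref_triangle_def cbox_Pair_eq)
qed

lemma ref_triangle_closed: "closed ref_triangle"
proof -
  have eq: "ref_triangle = {p. 0 \<le> fst p} \<inter> {p. 0 \<le> snd p} \<inter> {p. fst p + snd p \<le> 1}"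
    by (auto simp: ref_triangle_def)
  show ?thesis unfolding eq by (intro closed_Int closed_Collect_le continuous_intros)
qed

lemma finite_measure_ref_triangle: "finite_measure (lebesgue_on ref_triangle)"
  by (simp add: finite_measure_lebesgue_on lmeasurable_compact compact_eq_bounded_closed
      ref_triangle_bounded ref_triangle_closed)

lemma AE_ref_triangle_interior:
  "AE p in lebesgue_on ref_triangle. 0 < fst p \<and> 0 < snd p \<and> fst p + snd p < 1"
proof -
  define N where "N = {p::real\<times>real. (1, 0) \<bullet> p = 0} \<union> {p. (0, 1) \<bullet> p = 0} \<union> {p. (1, 1) \<bullet> p = 1}"
  have "negligible N" unfolding N_def by (intro negligible_Un negligible_hyperplane) (auto simp: zero_prod_def)
  then have "AE p in lebesgue. p \<notin> N" using AE_not_in negligible_iff_null_sets by blast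
  then have "AE p in lebesgue. p \<in> ref_triangle \<longrightarrow> 0 < fst p \<and> 0 < snd p \<and> fst p + snd p < 1"
    by (rule eventually_mono) (auto simp: N_def ref_triangle_def)
  moreover have "ref_triangle \<inter> space lebesgue \<in> sets lebesgue"
    using ref_triangle_closed by auto
  ultimately show ?thesis by (subst AE_restrict_space_iff)
qed

text \<open>The outer normal and the inner limit are under control only in the relative interior of
  a face; this makes them usable under surface integrals.\<close>

lemma AE_triangle_param_rel_interior:
  assumes "3 simplex (T :: (real^3) set)" "F facet_of T"
  shows "AE p in lebesgue_on ref_triangle. triangle_param F p \<in> rel_interior F"
  using AE_ref_triangle_interior
proof eventually_elim
  case (elim p)
  then show ?case using triangle_param_rel_interior[OF assms, of "fst p" "snd p"] by simp
qed

lemma measurable_lebesgue_on_AE: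
  fixes f g :: "'a::euclidean_space \<Rightarrow> 'b::euclidean_space"
  assumes S: "S \<in> sets lebesgue" and g: "g \<in> borel_measurable (lebesgue_on S)"
    and eq: "AE x in lebesgue_on S. g x = f x"
  shows "f \<in> borel_measurable (lebesgue_on S)"
proof (rule borel_measurable_if_D, rule borel_measurable_AE)
  show "(\<lambda>x. if x \<in> S then g x else 0) \<in> borel_measurable lebesgue"
    using g S by (rule borel_measurable_if_I)
  have "AE x in lebesgue. x \<in> S \<longrightarrow> g x = f x" using eq S by (simp add: AE_restrict_space_iff)
  then show "AE x in lebesgue. (if x \<in> S then g x else 0) = (if x \<in> S then f x else 0)"
    by (rule eventually_mono) simp
qed

definition face_trace :: "(real^3) set \<Rightarrow> (real^3) set \<Rightarrow> (real^3 \<Rightarrow> complex^3) \<Rightarrow> real \<times> real \<Rightarrow> complex^3" where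
  "face_trace \<Omega> F u p = tangential \<Omega> (inner_trace \<Omega> u) (triangle_param F p)"

text \<open>\<open>Lim\<close> is not additive in general; here the one-cell description gives all
  three limits explicitly. As a linear functional, the trace is a combination of nodal
  coordinates.\<close>

lemma face_trace_linear:
  assumes \<Omega>: "open \<Omega>" "convex \<Omega>" "\<Omega> \<noteq> {}" and T: "3 simplex T" "T \<subseteq> closure \<Omega>" "T \<in> \<M>"
    and F: "F facet_of T" "F \<subseteq> frontier \<Omega>" and p: "triangle_param F p \<in> rel_interior F"
    and R: "R \<subseteq> edge_fields \<M>"
  shows "(\<lambda>u. face_trace \<Omega> F u p $ i) \<in> lin_functionals R"
  unfolding lin_functionals_def mem_Collect_eq
proof (intro ballI allI)
  fix u v c assume "u \<in> R" "v \<in> R"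
  then have "u \<in> edge_fields \<M>" "v \<in> edge_fields \<M>" using R by auto
  then obtain a b a' b' where ab: "\<And>y. y \<in> interior T \<Longrightarrow> u y = a + ccross b y"
    and ab': "\<And>y. y \<in> interior T \<Longrightarrow> v y = a' + ccross b' y"
    using T(3) unfolding edge_fields_def by blast
  have "u y + c *s v y = (a + c *s a') + ccross (b + c *s b') y" if "y \<in> interior T" for y
    using ab[OF that] ab'[OF that] by (simp add: ccross_add_scale vector_add_ldistrib)
  note tr = inner_trace_edge_field[OF \<Omega> T(1,2) F p]
  have "inner_trace \<Omega> (\<lambda>x. u x + c *s v x) (triangle_param F p)
      = inner_trace \<Omega> u (triangle_param F p) + c *s inner_trace \<Omega> v (triangle_param F p)"
    using tr[of u, OF ab] tr[of v, OF ab'] tr[of "\<lambda>x. u x + c *s v x" "a + c *s a'" "b + c *s b'"]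
      \<open>\<And>y. y \<in> interior T \<Longrightarrow> u y + c *s v y = (a + c *s a') + ccross (b + c *s b') y\<close>
    by (simp add: ccross_add_scale vector_add_ldistrib)
  then show "face_trace \<Omega> F (\<lambda>x. u x + c *s v x) p $ i = face_trace \<Omega> F u p $ i + c * face_trace \<Omega> F v p $ i"
    by (simp add: face_trace_def tangential_def ccross_add_scale)
qed

text \<open>Almost everywhere the trace is an affine expression crossed with one fixed normal, hence
  equal to a continuous function on the compact reference triangle.\<close>

lemma face_trace_measurable_bounded:
  assumes \<Omega>: "open \<Omega>" "convex \<Omega>" "\<Omega> \<noteq> {}" and T: "3 simplex T" "T \<subseteq> closure \<Omega>" "T \<in> \<M>"
    and F: "F facet_of T" "F \<subseteq> frontier \<Omega>" and u: "u \<in> edge_fields \<M>"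
  shows "face_trace \<Omega> F u \<in> borel_measurable (lebesgue_on ref_triangle)"
    and "\<exists>C. AE p in lebesgue_on ref_triangle. norm (face_trace \<Omega> F u p) \<le> C"
proof -
  obtain a b where ab: "\<And>y. y \<in> interior T \<Longrightarrow> u y = a + ccross b y"
    using u T(3) unfolding edge_fields_def by blast
  have cF: "convex F" using F(1) facet_of_imp_face_of face_of_imp_convex by blast
  have Fcl: "F \<subseteq> closure \<Omega>" using F(2) by (auto simp: frontier_def)
  note ri = AE_triangle_param_rel_interior[OF T(1) F(1)]
  \<comment> \<open>The normal is the same throughout the relative interior, so it is sampled at an
    arbitrary point of it.\<close>
  define N where "N = outer_normal \<Omega> (SOME x. x \<in> rel_interior F)"
  have N: "outer_normal \<Omega> x = N" if "x \<in> rel_interior F" for x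
    unfolding N_def
    by (rule outer_normal_rel_interior[OF cF Fcl that someI[of "\<lambda>x. x \<in> rel_interior F", OF that]])
  define g where "g p = ccross (a + ccross b (triangle_param F p)) N" for p
  have ae: "AE p in lebesgue_on ref_triangle. g p = face_trace \<Omega> F u p"
    using ri
  proof eventually_elim
    case (elim p)
    then show ?case
      using inner_trace_edge_field[OF \<Omega> T(1,2) F elim, of u, OF ab] N[OF elim]
      by (simp add: g_def face_trace_def tangential_def)
  qed
  have lin: "linear (\<lambda>v. ccross v N)"
    by (rule linearI) (simp_all add: ccross_def vec_eq_iff forall_3 algebra_simps)
  obtain p q r where pqr: "triangle_vertices F = (p, q, r)" using prod_cases3 by blast
  have param_eq: "triangle_param F = (\<lambda>x. p + fst x *\<^sub>R (q - p) + snd x *\<^sub>R (r - p))"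
    by (simp add: triangle_param_def pqr split_def)
  have param: "continuous_on A (triangle_param F)" for A
    unfolding param_eq by (intro continuous_intros)
  have cont: "continuous_on A g" for A
  proof -
    note clin = linear_continuous_on[OF linear_conv_bounded_linear[THEN iffD1]]
    have "continuous_on A (\<lambda>p. ccross b (triangle_param F p))"
      by (rule continuous_on_compose2[OF clin[OF linear_ccross] param subset_UNIV])
    then have "continuous_on A (\<lambda>p. a + ccross b (triangle_param F p))"
      by (intro continuous_on_add continuous_on_const)
    then show ?thesis
      unfolding g_def by (rule continuous_on_compose2[OF clin[OF lin] _ subset_UNIV])
  qed
  show "face_trace \<Omega> F u \<in> borel_measurable (lebesgue_on ref_triangle)"
  proof (rule measurable_lebesgue_on_AE[OF _ _ ae])
    show S: "ref_triangle \<in> sets lebesgue" using ref_triangle_closed by auto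
    show "g \<in> borel_measurable (lebesgue_on ref_triangle)"
      by (rule continuous_imp_measurable_on_sets_lebesgue[OF cont S])
  qed
  have "bounded (g ` ref_triangle)"
    by (intro compact_imp_bounded compact_continuous_image cont)
      (simp add: compact_eq_bounded_closed ref_triangle_bounded ref_triangle_closed)
  then obtain C where "\<And>p. p \<in> ref_triangle \<Longrightarrow> norm (g p) \<le> C" by (auto simp: bounded_iff)
  then have "AE p in lebesgue_on ref_triangle. norm (g p) \<le> C" by (intro AE_I2) simp
  then have "AE p in lebesgue_on ref_triangle. norm (face_trace \<Omega> F u p) \<le> C"
    using ae by eventually_elim simp
  then show "\<exists>C. AE p in lebesgue_on ref_triangle. norm (face_trace \<Omega> F u p) \<le> C" by blast
qed

section \<open>Convergence of the misfit\<close>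

definition surface_sq :: "(real^3) set set \<Rightarrow> (real^3 \<Rightarrow> complex^3) \<Rightarrow> real" where
  "surface_sq \<F> f = (\<Sum>F\<in>\<F>. triangle_jacobian F *
      (LINT p|lebesgue_on ref_triangle. (norm (f (triangle_param F p)))\<^sup>2))"

lemma triangle_jacobian_nonneg: "triangle_jacobian F \<ge> 0"
  by (simp add: triangle_jacobian_def split: prod.split)

lemma surface_sq_nonneg: "surface_sq \<F> f \<ge> 0"
  unfolding surface_sq_def by (intro sum_nonneg mult_nonneg_nonneg triangle_jacobian_nonneg) simp

lemma surface_L2_norm_sq: "(surface_L2_norm \<F> f)\<^sup>2 = surface_sq \<F> f"
  using surface_sq_nonneg[of \<F> f] by (simp add: surface_L2_norm_def surface_sq_def)

lemma misfit_eq: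
  "misfit \<Omega> \<F> E g = 1 / 2 * surface_sq \<F> (\<lambda>x. tangential \<Omega> (inner_trace \<Omega> E) x - tangential \<Omega> g x)"
  by (simp add: misfit_def surface_L2_norm_sq)

lemma L2_diff:
  fixes u v :: "'a \<Rightarrow> complex^3"
  assumes "u \<in> L2 N" "v \<in> L2 N"
  shows "(\<lambda>x. u x - v x) \<in> L2 N"
proof -
  have "(\<lambda>x. u x - v x) = (\<lambda>x. u x + (-1) *s v x)" by (simp add: fun_eq_iff vec_eq_iff)
  with L2_axpy[OF assms, of "-1"] show ?thesis by (simp only:)
qed

lemma L2_add:
  fixes u v :: "'a \<Rightarrow> complex^3"
  assumes "u \<in> L2 N" "v \<in> L2 N"
  shows "(\<lambda>x. u x + v x) \<in> L2 N"
  using L2_axpy[OF assms, of 1] by simp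

lemma surface_L2_diff:
  "f \<in> surface_L2 \<F> \<Longrightarrow> g \<in> surface_L2 \<F> \<Longrightarrow> (\<lambda>x. f x - g x) \<in> surface_L2 \<F>"
  by (simp add: surface_L2_def L2_diff)

text \<open>Young's inequality, 2 |f| |d| \<le> \<delta> |f|^2 + |d|^2 / \<delta>. The resulting
  bound can be integrated and summed over the faces term by term.\<close>

lemma norm_sq_perturb:
  fixes f d :: "'a::real_normed_vector"
  assumes "\<delta> > 0"
  shows "\<bar>(norm (f + d))\<^sup>2 - (norm f)\<^sup>2\<bar> \<le> \<delta> * (norm f)\<^sup>2 + (1 + 1 / \<delta>) * (norm d)\<^sup>2"
proof -
  define A B D where "A = norm (f + d)" "B = norm f" "D = norm d"
  have nn: "A \<ge> 0" "B \<ge> 0" "D \<ge> 0" by (simp_all add: A_B_D_def)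
  have "A \<le> B + D" unfolding A_B_D_def by (rule norm_triangle_ineq)
  moreover have "B \<le> A + D" unfolding A_B_D_def using norm_triangle_ineq4[of "f + d" d] by simp
  ultimately have AB: "\<bar>A - B\<bar> \<le> D" by linarith
  have "\<bar>A\<^sup>2 - B\<^sup>2\<bar> = \<bar>A - B\<bar> * (A + B)"
  proof -
    have "A\<^sup>2 - B\<^sup>2 = (A - B) * (A + B)" by (simp add: power2_eq_square algebra_simps)
    then show ?thesis using nn by (simp add: abs_mult)
  qed
  also have "\<dots> \<le> D * (2 * B + D)" using AB nn by (intro mult_mono) auto
  also have "\<dots> = 2 * (B * D) + D\<^sup>2" by (simp add: algebra_simps power2_eq_square)
  also have "2 * (B * D) \<le> \<delta> * B\<^sup>2 + 1 / \<delta> * D\<^sup>2"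
  proof -
    have "0 \<le> (\<delta> * B - D)\<^sup>2 / \<delta>" using assms by simp
    also have "\<dots> = \<delta> * B\<^sup>2 + 1 / \<delta> * D\<^sup>2 - 2 * (B * D)"
      using assms by (simp add: field_simps power2_eq_square)
    finally show ?thesis by simp
  qed
  finally have "\<bar>A\<^sup>2 - B\<^sup>2\<bar> \<le> \<delta> * B\<^sup>2 + (1 + 1 / \<delta>) * D\<^sup>2" by (simp add: distrib_right)
  then show ?thesis by (simp only: A_B_D_def)
qed

lemma L2_integrable: "f \<in> L2 N \<Longrightarrow> integrable N (\<lambda>x. (norm (f x))\<^sup>2)"
  by (simp add: L2_def)

lemma surface_sq_perturb:
  assumes f: "f \<in> surface_L2 \<F>" and d: "d \<in> surface_L2 \<F>" and \<delta>: "\<delta> > 0"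
  shows "\<bar>surface_sq \<F> (\<lambda>x. f x + d x) - surface_sq \<F> f\<bar> \<le> \<delta> * surface_sq \<F> f + (1 + 1 / \<delta>) * surface_sq \<F> d"
proof -
  let ?I = "\<lambda>F f. LINT p|lebesgue_on ref_triangle. (norm (f (triangle_param F p)))\<^sup>2"
  have I: "\<bar>?I F (\<lambda>x. f x + d x) - ?I F f\<bar> \<le> \<delta> * ?I F f + (1 + 1 / \<delta>) * ?I F d" if F: "F \<in> \<F>" for F
  proof -
    have L: "(\<lambda>p. f (triangle_param F p)) \<in> L2 (lebesgue_on ref_triangle)"
      "(\<lambda>p. d (triangle_param F p)) \<in> L2 (lebesgue_on ref_triangle)"
      using f d F by (auto simp: surface_L2_def)
    note int = L2_integrable[OF L(1)] L2_integrable[OF L(2)] L2_integrable[OF L2_add[OF L]]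
    have "\<bar>?I F (\<lambda>x. f x + d x) - ?I F f\<bar> = \<bar>LINT p|lebesgue_on ref_triangle.
        (norm (f (triangle_param F p) + d (triangle_param F p)))\<^sup>2 - (norm (f (triangle_param F p)))\<^sup>2\<bar>"
      using int by simp
    also have "\<dots> \<le> (LINT p|lebesgue_on ref_triangle.
        \<bar>(norm (f (triangle_param F p) + d (triangle_param F p)))\<^sup>2 - (norm (f (triangle_param F p)))\<^sup>2\<bar>)"
      by (rule integral_abs_bound)
    also have "\<dots> \<le> (LINT p|lebesgue_on ref_triangle.
        \<delta> * (norm (f (triangle_param F p)))\<^sup>2 + (1 + 1 / \<delta>) * (norm (d (triangle_param F p)))\<^sup>2)"
      using int by (intro integral_mono norm_sq_perturb \<delta>) auto
    also have "\<dots> = \<delta> * ?I F f + (1 + 1 / \<delta>) * ?I F d" using int by simp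
    finally show ?thesis .
  qed
  have "\<bar>surface_sq \<F> (\<lambda>x. f x + d x) - surface_sq \<F> f\<bar>
      = \<bar>\<Sum>F\<in>\<F>. triangle_jacobian F * (?I F (\<lambda>x. f x + d x) - ?I F f)\<bar>"
    by (simp add: surface_sq_def right_diff_distrib sum_subtractf)
  also have "\<dots> \<le> (\<Sum>F\<in>\<F>. \<bar>triangle_jacobian F * (?I F (\<lambda>x. f x + d x) - ?I F f)\<bar>)" by (rule sum_abs)
  also have "\<dots> \<le> (\<Sum>F\<in>\<F>. triangle_jacobian F * (\<delta> * ?I F f + (1 + 1 / \<delta>) * ?I F d))"
  proof (rule sum_mono)
    fix F assume "F \<in> \<F>"
    from mult_left_mono[OF I[OF this] triangle_jacobian_nonneg[of F]]
    show "\<bar>triangle_jacobian F * (?I F (\<lambda>x. f x + d x) - ?I F f)\<bar>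
        \<le> triangle_jacobian F * (\<delta> * ?I F f + (1 + 1 / \<delta>) * ?I F d)"
      by (simp only: abs_mult abs_of_nonneg[OF triangle_jacobian_nonneg])
  qed
  also have "\<dots> = \<delta> * surface_sq \<F> f + (1 + 1 / \<delta>) * surface_sq \<F> d"
    unfolding surface_sq_def sum_distrib_left sum.distrib[symmetric]
    by (intro sum.cong refl) (simp only: algebra_simps)
  finally show ?thesis .
qed

lemma surface_sq_add_tendsto:
  assumes f: "f \<in> surface_L2 \<F>" and d: "\<And>k. d k \<in> surface_L2 \<F>" and lim: "(\<lambda>k. surface_sq \<F> (d k)) \<longlonglongrightarrow> 0"
  shows "(\<lambda>k. surface_sq \<F> (\<lambda>x. f x + d k x)) \<longlonglongrightarrow> surface_sq \<F> f"
  unfolding LIMSEQ_iff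
proof (intro allI impI)
  fix e :: real assume e: "e > 0"
  define S where "S = surface_sq \<F> f"
  have S: "S \<ge> 0" by (simp add: S_def surface_sq_nonneg)
  \<comment> \<open>\<delta> is fixed first, so that the share of \<open>f\<close> is at most e / 2;
    the factor 1 + 1 / \<delta> is then a constant, absorbed by the vanishing perturbation.\<close>
  define \<delta> where "\<delta> = e / (2 * (S + 1))"
  have \<delta>: "\<delta> > 0" using e S by (simp add: \<delta>_def)
  have "\<delta> * S \<le> \<delta> * (S + 1)" using \<delta> by simp
  also have "\<dots> = e / 2" using S by (simp add: \<delta>_def field_simps)
  finally have dS: "\<delta> * S \<le> e / 2" .
  have "(\<lambda>k. (1 + 1 / \<delta>) * surface_sq \<F> (d k)) \<longlonglongrightarrow> (1 + 1 / \<delta>) * 0"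
    by (intro tendsto_intros lim)
  then have "\<forall>\<^sub>F k in sequentially. (1 + 1 / \<delta>) * surface_sq \<F> (d k) < e / 2"
    by (rule order_tendstoD) (use e in simp)
  then obtain K where K: "\<And>k. k \<ge> K \<Longrightarrow> (1 + 1 / \<delta>) * surface_sq \<F> (d k) < e / 2"
    by (auto simp: eventually_sequentially)
  have "norm (surface_sq \<F> (\<lambda>x. f x + d k x) - surface_sq \<F> f) < e" if "k \<ge> K" for k
    using surface_sq_perturb[OF f d \<delta>, of k] K[OF that] dS unfolding S_def real_norm_def by linarith
  then show "\<exists>K. \<forall>k\<ge>K. norm (surface_sq \<F> (\<lambda>x. f x + d k x) - surface_sq \<F> f) < e" by blast
qed

lemma surface_sq_diff_le:
  assumes "u \<in> surface_L2 \<F>" "v \<in> surface_L2 \<F>"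
  shows "surface_sq \<F> (\<lambda>x. u x - v x) \<le> 2 * surface_sq \<F> u + 2 * surface_sq \<F> v"
proof -
  have uminus: "surface_sq \<F> (\<lambda>x. - v x) = surface_sq \<F> v" by (simp add: surface_sq_def)
  have "(\<lambda>x. - v x) \<in> surface_L2 \<F>"
    using surface_L2_diff[OF surface_L2_diff[OF assms(2) assms(2)] assms(2)] by simp
  \<comment> \<open>With \<delta> = 1 the square of \<open>u\<close> is counted once more and the
    weight of \<open>v\<close> is 1 + 1 / 1, which gives both factors 2.\<close>
  from surface_sq_perturb[OF assms(1) this, of 1] show ?thesis by (simp add: uminus)
qed

lemma surface_sq_diff_tendsto:
  assumes u: "\<And>k. u k \<in> surface_L2 \<F>" "u' \<in> surface_L2 \<F>" and v: "\<And>k. v k \<in> surface_L2 \<F>" "v' \<in> surface_L2 \<F>"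
    and limu: "(\<lambda>k. surface_sq \<F> (\<lambda>x. u k x - u' x)) \<longlonglongrightarrow> 0"
    and limv: "(\<lambda>k. surface_sq \<F> (\<lambda>x. v k x - v' x)) \<longlonglongrightarrow> 0"
  shows "(\<lambda>k. surface_sq \<F> (\<lambda>x. u k x - v k x)) \<longlonglongrightarrow> surface_sq \<F> (\<lambda>x. u' x - v' x)"
proof -
  \<comment> \<open>The departure from the limit difference at stage \<open>k\<close>, itself a
    difference of two fields whose squares vanish.\<close>
  define d where "d k x = (u k x - u' x) - (v k x - v' x)" for k x
  have d: "d k \<in> surface_L2 \<F>" for k
    unfolding d_def by (intro surface_L2_diff u v)
  have "(\<lambda>k. surface_sq \<F> (d k)) \<longlonglongrightarrow> 0"
  proof (rule tendsto_sandwich[where f = "\<lambda>_. 0"])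
    show "(\<lambda>k. 2 * surface_sq \<F> (\<lambda>x. u k x - u' x) + 2 * surface_sq \<F> (\<lambda>x. v k x - v' x)) \<longlonglongrightarrow> 0"
      using tendsto_add[OF tendsto_mult_right_zero[OF limu] tendsto_mult_right_zero[OF limv]] by simp
    show "\<forall>\<^sub>F k in sequentially. surface_sq \<F> (d k)
        \<le> 2 * surface_sq \<F> (\<lambda>x. u k x - u' x) + 2 * surface_sq \<F> (\<lambda>x. v k x - v' x)"
      unfolding d_def by (intro always_eventually allI surface_sq_diff_le surface_L2_diff u v)
  qed (auto simp: surface_sq_nonneg)
  from surface_sq_add_tendsto[OF surface_L2_diff[OF u(2) v(2)] d this]
  show ?thesis by (simp add: d_def)
qed

section \<open>Convergence of traces on the boundary faces of the mesh\<close>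

lemma mesh_faces_boundary:
  assumes M: "tetrahedral_mesh \<M> \<Omega>" and F: "F \<in> mesh_faces \<M> \<Gamma>" and \<Gamma>: "\<Gamma> \<subseteq> frontier \<Omega>"
  obtains T where "T \<in> \<M>" "3 simplex T" "T \<subseteq> closure \<Omega>" "F facet_of T" "F \<subseteq> frontier \<Omega>"
  using assms unfolding tetrahedral_mesh_def mesh_faces_def by blast

lemma face_trace_L2:
  assumes \<Omega>: "open \<Omega>" "convex \<Omega>" "\<Omega> \<noteq> {}" and M: "tetrahedral_mesh \<M> \<Omega>"
    and F: "F \<in> mesh_faces \<M> \<Gamma>" and \<Gamma>: "\<Gamma> \<subseteq> frontier \<Omega>" and u: "u \<in> edge_fields \<M>"
  shows "face_trace \<Omega> F u \<in> L2 (lebesgue_on ref_triangle)"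
proof -
  obtain T where T: "T \<in> \<M>" "3 simplex T" "T \<subseteq> closure \<Omega>" "F facet_of T" "F \<subseteq> frontier \<Omega>"
    using mesh_faces_boundary[OF M F \<Gamma>] by blast
  note m = face_trace_measurable_bounded[OF \<Omega> T(2,3,1,4,5) u]
  obtain C where C: "AE p in lebesgue_on ref_triangle. norm (face_trace \<Omega> F u p) \<le> C" using m(2) by blast
  have "integrable (lebesgue_on ref_triangle) (\<lambda>p. (norm (face_trace \<Omega> F u p))\<^sup>2)"
  proof (rule finite_measure.integrable_const_bound[OF finite_measure_ref_triangle])
    show "AE p in lebesgue_on ref_triangle. norm ((norm (face_trace \<Omega> F u p))\<^sup>2) \<le> C\<^sup>2"
      using C by eventually_elim (simp add: power_mono)
    show "(\<lambda>p. (norm (face_trace \<Omega> F u p))\<^sup>2) \<in> borel_measurable (lebesgue_on ref_triangle)"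
      using m(1) by measurable
  qed
  with m(1) show ?thesis by (simp add: L2_def)
qed

text \<open>In nodal coordinates the difference of traces combines finitely many essentially bounded
  traces with coefficients that tend to 0. The bound is uniform on the face, whose parameter domain
  has finite measure.\<close>

lemma face_trace_tendsto:
  assumes \<Omega>: "open \<Omega>" "bounded \<Omega>" "convex \<Omega>" "\<Omega> \<noteq> {}" and M: "tetrahedral_mesh \<M> \<Omega>"
    and R: "R = nedelec_space \<Gamma>' \<Omega> \<M>" and F: "F \<in> mesh_faces \<M> \<Gamma>" and \<Gamma>: "\<Gamma> \<subseteq> frontier \<Omega>"
    and E: "\<And>k. E k \<in> R" "E' \<in> R"
    and lim: "\<And>L. L \<in> lin_functionals R \<Longrightarrow> (\<lambda>k. L (E k)) \<longlonglongrightarrow> L E'"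
  shows "(\<lambda>k. LINT p|lebesgue_on ref_triangle. (norm (face_trace \<Omega> F (E k) p - face_trace \<Omega> F E' p))\<^sup>2) \<longlonglongrightarrow> 0"
proof -
  interpret finite_measure "lebesgue_on ref_triangle" by (rule finite_measure_ref_triangle)
  have Redge: "R \<subseteq> edge_fields \<M>" using R nedelec_edge_fields by blast
  obtain T where T: "T \<in> \<M>" "3 simplex T" "T \<subseteq> closure \<Omega>" "F facet_of T" "F \<subseteq> frontier \<Omega>"
    using mesh_faces_boundary[OF M F \<Gamma>] by blast
  have ne: "R \<noteq> {}" using E by blast
  obtain I e where I: "finite I" "I \<subseteq> lin_functionals R" and e: "\<And>i. i \<in> I \<Longrightarrow> e i \<in> R"
    and rep: "\<And>L u. L \<in> lin_functionals R \<Longrightarrow> u \<in> R \<Longrightarrow> L u = (\<Sum>i\<in>I. i u * L (e i))"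
    by (rule nedelec_nodal_basis[OF \<Omega>(1,2) M R ne]) (rule that)
  have "\<forall>i\<in>I. \<exists>C. AE p in lebesgue_on ref_triangle. norm (face_trace \<Omega> F (e i) p) \<le> C"
    using face_trace_measurable_bounded(2)[OF \<Omega>(1,3,4) T(2,3,1,4,5)] e Redge by blast
  from bchoice[OF this] obtain C
    where C: "\<forall>i\<in>I. AE p in lebesgue_on ref_triangle. norm (face_trace \<Omega> F (e i) p) \<le> C i" by (rule exE)
  define B where "B k = (\<Sum>i\<in>I. norm (i (E k) - i E') * C i)" for k
  have "(\<lambda>k. i (E k) - i E') \<longlonglongrightarrow> 0" if "i \<in> I" for i
    using lim[of i] I(2) that by (intro LIM_zero) auto
  then have B: "B \<longlonglongrightarrow> 0"
    unfolding B_def by (intro tendsto_null_sum tendsto_mult_left_zero tendsto_norm_zero)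
  have bound: "AE p in lebesgue_on ref_triangle. norm (face_trace \<Omega> F (E k) p - face_trace \<Omega> F E' p) \<le> B k" for k
  proof -
    \<comment> \<open>One null set serves all basis fields, as there are finitely many.\<close>
    have "AE p in lebesgue_on ref_triangle. \<forall>i\<in>I. norm (face_trace \<Omega> F (e i) p) \<le> C i"
      using C I(1) by (subst AE_ball_countable) (auto intro: countable_finite)
    then show ?thesis
      using AE_triangle_param_rel_interior[OF T(2,4)]
    proof eventually_elim
      case (elim p)
      have "face_trace \<Omega> F u p = (\<Sum>i\<in>I. i u *s face_trace \<Omega> F (e i) p)" if u: "u \<in> R" for u
        unfolding vec_eq_iff
        using rep[OF face_trace_linear[OF \<Omega>(1,3,4) T(2,3,1,4,5) elim(2) Redge] u] by simp
      then have "face_trace \<Omega> F (E k) p - face_trace \<Omega> F E' p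
          = (\<Sum>i\<in>I. (i (E k) - i E') *s face_trace \<Omega> F (e i) p)"
        using E by (simp add: vector_sub_rdistrib sum_subtractf)
      also have "norm \<dots> \<le> (\<Sum>i\<in>I. norm ((i (E k) - i E') *s face_trace \<Omega> F (e i) p))" by (rule norm_sum)
      also have "\<dots> \<le> B k"
        unfolding B_def norm_vector_scalar_mult using elim(1) by (intro sum_mono mult_left_mono) auto
      finally show ?case .
    qed
  qed
  show ?thesis
  proof (rule tendsto_sandwich[where f = "\<lambda>_. 0"])
    show "(\<lambda>k. measure (lebesgue_on ref_triangle) (space (lebesgue_on ref_triangle)) * (B k)\<^sup>2) \<longlonglongrightarrow> 0"
      by (rule tendsto_mult_right_zero) (use tendsto_power[OF B, of 2] in simp)
    have "(LINT p|lebesgue_on ref_triangle. (norm (face_trace \<Omega> F (E k) p - face_trace \<Omega> F E' p))\<^sup>2)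
        \<le> (LINT p|lebesgue_on ref_triangle. (B k)\<^sup>2)" for k
    proof (rule integral_mono_AE)
      show "integrable (lebesgue_on ref_triangle) (\<lambda>p. (norm (face_trace \<Omega> F (E k) p - face_trace \<Omega> F E' p))\<^sup>2)"
        by (intro L2_integrable L2_diff face_trace_L2[OF \<Omega>(1,3,4) M F \<Gamma>]) (use E Redge in auto)
      show "AE p in lebesgue_on ref_triangle. (norm (face_trace \<Omega> F (E k) p - face_trace \<Omega> F E' p))\<^sup>2 \<le> (B k)\<^sup>2"
        using bound[of k] by eventually_elim (simp add: power_mono)
    qed simp
    then show "\<forall>\<^sub>F k in sequentially. (LINT p|lebesgue_on ref_triangle. (norm (face_trace \<Omega> F (E k) p - face_trace \<Omega> F E' p))\<^sup>2)
        \<le> measure (lebesgue_on ref_triangle) (space (lebesgue_on ref_triangle)) * (B k)\<^sup>2"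
      by (intro always_eventually allI) simp
  qed simp_all
qed

lemma misfit_tendsto:
  assumes \<Omega>: "open \<Omega>" "bounded \<Omega>" "convex \<Omega>" "\<Omega> \<noteq> {}" and M: "tetrahedral_mesh \<M> \<Omega>"
    and R: "R = nedelec_space \<Gamma>' \<Omega> \<M>" and F: "\<F> = mesh_faces \<M> \<Gamma>" and \<Gamma>: "\<Gamma> \<subseteq> frontier \<Omega>"
    and E: "\<And>k. E k \<in> R" "E' \<in> R"
    and lim: "\<And>L. L \<in> lin_functionals R \<Longrightarrow> (\<lambda>k. L (E k)) \<longlonglongrightarrow> L E'"
    and g: "\<And>k. tangential \<Omega> (g k) \<in> surface_L2 \<F>" "tangential \<Omega> g' \<in> surface_L2 \<F>"
    and limg: "(\<lambda>k. surface_L2_norm \<F> (\<lambda>x. tangential \<Omega> (g k) x - tangential \<Omega> g' x)) \<longlonglongrightarrow> 0"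
  shows "(\<lambda>k. misfit \<Omega> \<F> (E k) (g k)) \<longlonglongrightarrow> misfit \<Omega> \<F> E' g'"
  unfolding misfit_eq
proof (intro tendsto_intros surface_sq_diff_tendsto g)
  have trace: "tangential \<Omega> (inner_trace \<Omega> u) \<in> surface_L2 \<F>" if "u \<in> R" for u
  proof -
    have "u \<in> edge_fields \<M>" using that R nedelec_edge_fields by blast
    then show ?thesis
      using face_trace_L2[OF \<Omega>(1,3,4) M _ \<Gamma>, of _ u] by (simp add: F surface_L2_def face_trace_def[abs_def])
  qed
  show "tangential \<Omega> (inner_trace \<Omega> (E k)) \<in> surface_L2 \<F>" for k using trace E by blast
  show "tangential \<Omega> (inner_trace \<Omega> E') \<in> surface_L2 \<F>" using trace E by blast
  show "(\<lambda>k. surface_sq \<F> (\<lambda>x. tangential \<Omega> (inner_trace \<Omega> (E k)) x - tangential \<Omega> (inner_trace \<Omega> E') x)) \<longlonglongrightarrow> 0"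
    unfolding surface_sq_def F
    using face_trace_tendsto[OF \<Omega> M R _ \<Gamma> E lim]
    by (intro tendsto_null_sum tendsto_mult_right_zero) (simp add: face_trace_def)
  show "(\<lambda>k. surface_sq \<F> (\<lambda>x. tangential \<Omega> (g k) x - tangential \<Omega> g' x)) \<longlonglongrightarrow> 0"
    using tendsto_power[OF limg, of 2] by (simp add: surface_L2_norm_sq)
qed

section \<open>Closedness of the admissible set\<close>

text \<open>An affine function on a cell that vanishes near one point of the cell vanishes on the cell.\<close>

lemma lagrange_vanishes_on_boundary_cells:
  fixes v :: "real^3 \<Rightarrow> real"
  assumes v: "v \<in> lagrange_space D \<M>" and supp: "closure {x. v x \<noteq> 0} \<subseteq> S"
    and T: "T \<in> \<M>" "convex T" and y: "y \<in> T" "y \<notin> S" and x: "x \<in> T"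
  shows "v x = 0"
proof -
  have "y \<in> - closure {x. v x \<noteq> 0}" using y(2) supp by blast
  then obtain \<delta> where \<delta>: "\<delta> > 0" "ball y \<delta> \<subseteq> - closure {x. v x \<noteq> 0}"
    using open_contains_ball[of "- closure {x. v x \<noteq> 0}"] by blast
  have zero: "v z = 0" if "z \<in> ball y \<delta>" for z
  proof -
    have "z \<notin> closure {x. v x \<noteq> 0}" using that \<delta>(2) by blast
    then show ?thesis using closure_subset[of "{x. v x \<noteq> 0}"] by auto
  qed
  have "\<exists>c l. linear l \<and> (\<forall>x\<in>T. v x = c + l x)" using v T(1) by (simp add: lagrange_space_def)
  then obtain c l where l: "linear l" "\<forall>x\<in>T. v x = c + l x" by (elim exE conjE)
  \<comment> \<open>The minimum with 1 keeps \<open>z\<close> on the segment; the added 1 guards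
    against \<open>x = y\<close>, and the factor 2 puts \<open>z\<close> inside the open
    ball.\<close>
  define t where "t = min 1 (\<delta> / (2 * (norm (x - y) + 1)))"
  have t: "0 < t" "t \<le> 1" using \<delta>(1) by (auto simp: t_def intro!: divide_pos_pos add_nonneg_pos)
  define z where "z = (1 - t) *\<^sub>R y + t *\<^sub>R x"
  have zT: "z \<in> T" unfolding z_def using t by (intro convexD[OF T(2) y(1) x]) auto
  have "norm (z - y) = t * norm (x - y)"
  proof -
    have "z - y = t *\<^sub>R (x - y)" by (simp add: z_def algebra_simps)
    then show ?thesis using t by simp
  qed
  also have "\<dots> \<le> \<delta> / (2 * (norm (x - y) + 1)) * norm (x - y)"
    by (intro mult_right_mono) (auto simp: t_def)
  also have "\<dots> < \<delta>"
  proof -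
    have "\<delta> * norm (x - y) < \<delta> * (2 * (norm (x - y) + 1))"
      by (rule mult_strict_left_mono[OF _ \<delta>(1)]) (use norm_ge_zero[of "x - y"] in argo)
    moreover have "2 * (norm (x - y) + 1) > 0" using norm_ge_zero[of "x - y"] by argo
    ultimately show ?thesis by (simp add: divide_less_eq)
  qed
  finally have "v z = 0" by (intro zero) (simp add: dist_norm norm_minus_commute)
  moreover have "v y = 0" by (intro zero) (simp add: \<delta>(1))
  \<comment> \<open>Affine along the segment and zero at both \<open>y\<close> and \<open>z\<close>,
    with \<open>t\<close> positive: the value at \<open>x\<close> must be 0.\<close>
  moreover have "v z = (1 - t) * v y + t * v x"
  proof -
    have "l z = (1 - t) * l y + t * l x"
      unfolding z_def linear_add[OF l(1)] linear_scale[OF l(1)] by simp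
    then show ?thesis using l(2) zT y(1) x by (simp add: algebra_simps)
  qed
  ultimately show ?thesis using t(1) by simp
qed

text \<open>Every \<open>s j\<close> vanishes on each cell that leaves \<open>S\<close>, so the
  limit is supported on the union of the cells contained in \<open>S\<close>, a compact set
  independent of \<open>j\<close>.\<close>

lemma limit_compact_support:
  fixes s :: "nat \<Rightarrow> real^3 \<Rightarrow> real"
  assumes M: "tetrahedral_mesh \<M> S"
    and s: "\<And>j. s j \<in> lagrange_space D \<M>" "\<And>j. closure {x. s j x \<noteq> 0} \<subseteq> S"
    and lim: "\<And>x. (\<lambda>j. s j x) \<longlonglongrightarrow> \<sigma> x" and off: "\<And>x. x \<notin> S \<Longrightarrow> \<sigma> x = 0"
  shows "compact (closure {x. \<sigma> x \<noteq> 0})" "closure {x. \<sigma> x \<noteq> 0} \<subseteq> S"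
proof -
  have fin: "finite \<M>" and simp: "\<And>T. T \<in> \<M> \<Longrightarrow> 3 simplex T" and cov: "\<Union>\<M> = closure S"
    using M by (auto simp: tetrahedral_mesh_def triangulation_def)
  define K where "K = \<Union>{T \<in> \<M>. T \<subseteq> S}"
  have K: "compact K" unfolding K_def using fin simp by (intro compact_Union) (auto intro: compact_simplex)
  have KS: "K \<subseteq> S" by (auto simp: K_def)
  have sub: "{x. \<sigma> x \<noteq> 0} \<subseteq> K"
  proof
    fix x assume "x \<in> {x. \<sigma> x \<noteq> 0}"
    then have x: "\<sigma> x \<noteq> 0" by simp
    then have "x \<in> S" using off by blast
    then obtain T where T: "T \<in> \<M>" "x \<in> T" using cov closure_subset by blast
    have "T \<subseteq> S"
    proof (rule ccontr)
      assume "\<not> T \<subseteq> S"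
      then obtain y where "y \<in> T" "y \<notin> S" by blast
      then have "s j x = 0" for j
        using lagrange_vanishes_on_boundary_cells[OF s(1) s(2) T(1) convex_simplex[OF simp[OF T(1)]] _ _ T(2)] by blast
      then have "\<sigma> x = 0" using lim[of x] by (simp add: LIMSEQ_const_iff)
      with x show False by contradiction
    qed
    then show "x \<in> K" using T by (auto simp: K_def)
  qed
  have "closure {x. \<sigma> x \<noteq> 0} \<subseteq> K" using sub compact_imp_closed[OF K] by (rule closure_minimal)
  then show "closure {x. \<sigma> x \<noteq> 0} \<subseteq> S" using KS by blast
  show "compact (closure {x. \<sigma> x \<noteq> 0})"
    unfolding compact_closure using compact_imp_bounded[OF K] sub by (rule bounded_subset)
qed

section \<open>Total variation and passage to the limit\<close>

definition test_fields :: "(real^3) set \<Rightarrow> (real^3 \<Rightarrow> real^3) set" where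
  "test_fields S = {g \<in> C1c S. \<forall>x\<in>S. norm (g x) \<le> 1}"

lemma total_variation_upper:
  "g \<in> test_fields S \<Longrightarrow> ereal (LINT x|lebesgue_on S. u x * divergence g x) \<le> total_variation S u"
  unfolding total_variation_def test_fields_def by (rule SUP_upper)

lemma total_variation_least:
  "(\<And>g. g \<in> test_fields S \<Longrightarrow> ereal (LINT x|lebesgue_on S. u x * divergence g x) \<le> b) \<Longrightarrow> total_variation S u \<le> b"
  unfolding total_variation_def test_fields_def by (rule SUP_least)

text \<open>The zero field is a test field. This excludes the value -\<infinity>, so a variation
  below \<infinity> is a real number.\<close>

lemma total_variation_nonneg: "total_variation S u \<ge> 0"
proof -
  have "((\<lambda>x. 0) :: real^3 \<Rightarrow> real^3) \<in> test_fields S"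
    unfolding test_fields_def C1c_def
    by (auto intro!: exI[of _ "\<lambda>x. 0"] simp: zero_blinfun.rep_eq)
  from total_variation_upper[OF this, of u] show ?thesis
    by (simp add: divergence_def partial_deriv_eq[OF has_derivative_const] zero_ereal_def[symmetric])
qed

lemma admissible_bounds:
  assumes "\<tau> \<in> admissible S m M"
  shows "norm (\<tau> x) \<le> \<bar>m\<bar> + \<bar>M\<bar>"
  using assms by (cases "x \<in> S") (force simp: admissible_def)+

lemma admissible_Linf:
  assumes \<Omega>: "open \<Omega>" and S: "open S" "S \<subseteq> \<Omega>" and \<tau>: "\<tau> \<in> admissible S m M"
  shows "\<tau> \<in> Linf \<Omega>"
proof (rule LinfI)
  have "\<tau> \<in> borel_measurable (lebesgue_on S)" using \<tau> by (auto simp: admissible_def BV_def)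
  then have "(\<lambda>x. if x \<in> S then \<tau> x else 0) \<in> borel_measurable (lebesgue_on \<Omega>)"
    using \<Omega> S by (subst borel_measurable_if_lebesgue_on) auto
  moreover have "(\<lambda>x. if x \<in> S then \<tau> x else 0) = \<tau>" using \<tau> by (auto simp: admissible_def fun_eq_iff)
  ultimately show "\<tau> \<in> borel_measurable (lebesgue_on \<Omega>)" by simp
  show "AE x in lebesgue_on \<Omega>. norm (\<tau> x) \<le> \<bar>m\<bar> + \<bar>M\<bar>"
    using admissible_bounds[OF \<tau>] by (intro AE_I2)
qed

text \<open>Dominated convergence: \<open>m\<close> and \<open>M\<close> bound the sequence and the
  divergence of a C1 test field is bounded on \<open>S\<close>, so pointwise convergence is
  enough.\<close>

lemma divergence_integral_tendsto:
  fixes s :: "nat \<Rightarrow> real^3 \<Rightarrow> real"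
  assumes S: "open S" "bounded S" and s: "\<And>j. s j \<in> admissible S m M" and lim: "\<And>x. (\<lambda>j. s j x) \<longlonglongrightarrow> \<sigma> x"
    and g: "g \<in> test_fields S"
  shows "(\<lambda>j. LINT x|lebesgue_on S. s j x * divergence g x) \<longlonglongrightarrow> (LINT x|lebesgue_on S. \<sigma> x * divergence g x)"
proof (rule integral_dominated_convergence)
  have div: "divergence g \<in> Linf S"
    using g by (intro Linf_continuous[OF S] C1c_continuous_divergence[of g S]) (simp add: test_fields_def)
  have meas: "s j \<in> borel_measurable (lebesgue_on S)" for j
    using s[of j] by (auto simp: admissible_def BV_def)
  then show "(\<lambda>x. s j x * divergence g x) \<in> borel_measurable (lebesgue_on S)" for j
    by (intro borel_measurable_times Linf_measurable[OF div])
  have "\<sigma> \<in> borel_measurable (lebesgue_on S)"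
    by (rule borel_measurable_LIMSEQ_metric[OF meas]) (rule lim)
  then show "(\<lambda>x. \<sigma> x * divergence g x) \<in> borel_measurable (lebesgue_on S)"
    by (intro borel_measurable_times Linf_measurable[OF div])
  show "integrable (lebesgue_on S) (\<lambda>x. (\<bar>m\<bar> + \<bar>M\<bar>) * norm (divergence g x))"
    by (intro integrable_mult_right integrable_norm integrable_Linf[OF S div])
  show "AE x in lebesgue_on S. (\<lambda>j. s j x * divergence g x) \<longlonglongrightarrow> \<sigma> x * divergence g x"
    by (intro AE_I2 tendsto_intros lim)
  show "AE x in lebesgue_on S. norm (s j x * divergence g x) \<le> (\<bar>m\<bar> + \<bar>M\<bar>) * norm (divergence g x)" for j
    unfolding norm_mult by (intro AE_I2 mult_right_mono admissible_bounds[OF s]) simp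
qed

text \<open>Finite variation of the limit is a hypothesis here and is later obtained from
  minimality. The support condition rests on the mesh; the remaining conditions follow from
  pointwise convergence and the common bounds.\<close>

lemma admissible_limit:
  fixes s :: "nat \<Rightarrow> real^3 \<Rightarrow> real"
  assumes S: "open S" "bounded S" and mesh: "tetrahedral_mesh \<M> S"
    and s: "\<And>j. s j \<in> lagrange_space D \<M>" "\<And>j. s j \<in> admissible S m M"
    and lim: "\<And>x. (\<lambda>j. s j x) \<longlonglongrightarrow> \<sigma> x"
    and TV: "total_variation S \<sigma> < \<infinity>"
  shows "\<sigma> \<in> admissible S m M"
proof -
  have off: "\<sigma> x = 0" if "x \<notin> S" for x
    using lim[of x] s(2) that by (simp add: admissible_def LIMSEQ_const_iff)
  have bounds: "m \<le> \<sigma> x \<and> \<sigma> x \<le> M" if "x \<in> S" for x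
  proof
    have "m \<le> s j x" "s j x \<le> M" for j using s(2)[of j] that by (simp_all add: admissible_def)
    then show "m \<le> \<sigma> x" "\<sigma> x \<le> M"
      using LIMSEQ_le_const[OF lim[of x], of m] LIMSEQ_le_const2[OF lim[of x], of M] by blast+
  qed
  have "closure {x. s j x \<noteq> 0} \<subseteq> S" for j using s(2)[of j] by (simp add: admissible_def)
  note cs = limit_compact_support[OF mesh s(1) this lim off]
  have "\<sigma> \<in> borel_measurable (lebesgue_on S)"
  proof (rule borel_measurable_LIMSEQ_metric[of s])
    show "s j \<in> borel_measurable (lebesgue_on S)" for j
      using s(2)[of j] by (auto simp: admissible_def BV_def)
  qed (rule lim)
  moreover have "AE x in lebesgue_on S. norm (\<sigma> x) \<le> \<bar>m\<bar> + \<bar>M\<bar>"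
  proof (intro AE_I2)
    fix x assume "x \<in> space (lebesgue_on S)"
    then have "m \<le> \<sigma> x" "\<sigma> x \<le> M" using bounds[of x] by simp_all
    then show "norm (\<sigma> x) \<le> \<bar>m\<bar> + \<bar>M\<bar>" by simp
  qed
  ultimately have "integrable (lebesgue_on S) \<sigma>" by (intro integrable_Linf[OF S] LinfI)
  then show ?thesis using TV off bounds cs by (simp add: admissible_def BV_def)
qed

section \<open>Stability with respect to the data\<close>

theorem theorem3p2:
  fixes \<Omega> \<Omega>\<^sub>0 \<Omega>\<^sub>1 \<Omega>\<^sub>2 \<Omega>\<^sub>C \<Gamma> :: "(real^3) set"
    and \<M> \<M>\<^sub>0 \<M>\<^sub>C \<F> :: "(real^3) set set"
    and h \<kappa> \<mu> \<omega> s\<^sub>0 m M \<alpha> :: real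
    and \<epsilon> \<sigma>\<^sub>0 :: "real^3 \<Rightarrow> real"
    and J Eobs :: "real^3 \<Rightarrow> complex^3"
    and Ek :: "nat \<Rightarrow> real^3 \<Rightarrow> complex^3"
    and R :: "(real^3 \<Rightarrow> complex^3) set"
    and U :: "(real^3 \<Rightarrow> complex) set"
    and V K\<^sub>h :: "(real^3 \<Rightarrow> real) set"
    and E\<^sub>h :: "(real^3 \<Rightarrow> real) \<Rightarrow> real^3 \<Rightarrow> complex^3"
    and G :: "(real^3 \<Rightarrow> real) \<Rightarrow> real"
    and \<sigma>k :: "nat \<Rightarrow> real^3 \<Rightarrow> real"
    and \<sigma> :: "real^3 \<Rightarrow> real"
  assumes Omega: "open \<Omega>" "convex \<Omega>" "bounded \<Omega>" "\<Omega> \<noteq> {}"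
    and parts: "polyhedral_open \<Omega>\<^sub>0" "polyhedral_open \<Omega>\<^sub>C"
      "\<Omega>\<^sub>0 \<subseteq> \<Omega>" "\<Omega>\<^sub>C \<subseteq> \<Omega>" "\<Omega>\<^sub>0 \<inter> \<Omega>\<^sub>C = {}" "closure \<Omega> = closure \<Omega>\<^sub>0 \<union> closure \<Omega>\<^sub>C"
    and conducting: "open \<Omega>\<^sub>1" "open \<Omega>\<^sub>2" "\<Omega>\<^sub>1 \<inter> \<Omega>\<^sub>2 = {}" "\<Omega>\<^sub>C = \<Omega>\<^sub>1 \<union> closure \<Omega>\<^sub>2"
    and Gamma: "\<Gamma> \<subseteq> frontier \<Omega>" "\<Gamma> \<subseteq> frontier \<Omega>\<^sub>0" "\<F> = mesh_faces \<M> \<Gamma>" "\<Gamma> = \<Union>\<F>"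
    and mesh: "tetrahedral_mesh \<M> \<Omega>" "tetrahedral_mesh \<M>\<^sub>0 \<Omega>\<^sub>0" "tetrahedral_mesh \<M>\<^sub>C \<Omega>\<^sub>C"
      "\<M> = \<M>\<^sub>0 \<union> \<M>\<^sub>C" "mesh_size \<M> = h" "shape_regular \<kappa> \<M>" "quasi_uniform \<kappa> \<M>"
    and coefficients: "\<mu> > 0" "\<omega> > 0"
      "\<epsilon> \<in> borel_measurable (lebesgue_on \<Omega>\<^sub>0)" "bounded (\<epsilon> ` \<Omega>\<^sub>0)" "\<forall>x\<in>\<Omega>\<^sub>0. \<epsilon> x > 0"
      "s\<^sub>0 > 0" "\<sigma>\<^sub>0 = (\<lambda>x. s\<^sub>0 * indicator \<Omega>\<^sub>C x)"
    and source: "J \<in> L2 (lebesgue_on \<Omega>)" "divergence_free \<Omega> J"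
    and spaces: "R = nedelec_space \<Gamma> \<Omega> \<M>"
      "U = lagrange_space (frontier \<Omega>\<^sub>0 - \<Gamma>) \<M>\<^sub>0"
      "V = lagrange_space (frontier \<Omega>\<^sub>C) \<M>\<^sub>C"
    and constraint: "m < M" "- s\<^sub>0 < m" "K\<^sub>h = V \<inter> admissible \<Omega>\<^sub>C m M"
    and well_posed: "\<forall>\<tau>\<in>K\<^sub>h. \<exists>!E. discrete_state \<Omega> \<Omega>\<^sub>0 \<mu> \<epsilon> \<omega> J R U (\<lambda>x. \<tau> x + \<sigma>\<^sub>0 x) E"
    and state: "\<forall>\<tau>\<in>K\<^sub>h. discrete_state \<Omega> \<Omega>\<^sub>0 \<mu> \<epsilon> \<omega> J R U (\<lambda>x. \<tau> x + \<sigma>\<^sub>0 x) (E\<^sub>h \<tau>)"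
    and observation: "tangential \<Omega> Eobs \<in> surface_L2 \<F>"
    and objective: "G = (\<lambda>\<tau>. misfit \<Omega> \<F> (E\<^sub>h \<tau>) Eobs)"
    and alpha: "\<alpha> > 0"
    and data: "\<And>k. tangential \<Omega> (Ek k) \<in> surface_L2 \<F>"
    and data_conv:
      "(\<lambda>k. surface_L2_norm \<F> (\<lambda>x. tangential \<Omega> (Ek k) x - tangential \<Omega> Eobs x)) \<longlonglongrightarrow> 0"
    and minimizers: "\<And>k. is_arg_min
      (\<lambda>\<tau>. ereal (misfit \<Omega> \<F> (E\<^sub>h \<tau>) (Ek k)) + ereal \<alpha> * total_variation \<Omega>\<^sub>C \<tau>)
      (\<lambda>\<tau>. \<tau> \<in> K\<^sub>h) (\<sigma>k k)"
    and limit: "limit_point_in V \<sigma>k \<sigma>"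
  shows "is_arg_min (\<lambda>\<tau>. ereal (G \<tau>) + ereal \<alpha> * total_variation \<Omega>\<^sub>C \<tau>) (\<lambda>\<tau>. \<tau> \<in> K\<^sub>h) \<sigma>"
proof -
  have open_bd: "open \<Omega>\<^sub>0" "open \<Omega>\<^sub>C" "bounded \<Omega>\<^sub>C"
    using parts(1,2) by (simp_all add: polyhedral_open_def)
  have K: "\<tau> \<in> V" "\<tau> \<in> admissible \<Omega>\<^sub>C m M" if "\<tau> \<in> K\<^sub>h" for \<tau>
    using that by (simp_all add: constraint(3))
  obtain r where r: "strict_mono r" and ul: "uniform_limit UNIV (\<lambda>j. \<sigma>k (r j)) \<sigma> sequentially"
    using limit unfolding limit_point_in_def by (elim conjE exE)
  have \<sigma>V: "\<sigma> \<in> V" using limit by (simp add: limit_point_in_def)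
  have lim: "(\<lambda>j. \<sigma>k (r j) x) \<longlonglongrightarrow> \<sigma> x" for x
    using tendsto_uniform_limitI[OF ul UNIV_I] .
  have min: "\<sigma>k k \<in> K\<^sub>h" "\<And>\<tau>. \<tau> \<in> K\<^sub>h \<Longrightarrow>
      ereal (misfit \<Omega> \<F> (E\<^sub>h (\<sigma>k k)) (Ek k)) + ereal \<alpha> * total_variation \<Omega>\<^sub>C (\<sigma>k k)
      \<le> ereal (misfit \<Omega> \<F> (E\<^sub>h \<tau>) (Ek k)) + ereal \<alpha> * total_variation \<Omega>\<^sub>C \<tau>" for k
    using minimizers[of k] by (simp_all add: is_arg_min_linorder)
  \<comment> \<open>On \<open>K\<^sub>h\<close> the variation is finite, so the comparisons can be
    carried out in real arithmetic.\<close>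
  define tv where "tv \<tau> = real_of_ereal (total_variation \<Omega>\<^sub>C \<tau>)" for \<tau>
  have tv: "total_variation \<Omega>\<^sub>C \<tau> = ereal (tv \<tau>)" if "\<tau> \<in> K\<^sub>h" for \<tau>
  proof -
    have "total_variation \<Omega>\<^sub>C \<tau> < \<infinity>" using K(2)[OF that] by (simp add: admissible_def BV_def)
    then show ?thesis
      using total_variation_nonneg[of \<Omega>\<^sub>C \<tau>] unfolding tv_def
      by (cases "total_variation \<Omega>\<^sub>C \<tau>") simp_all
  qed
  have div_le: "(LINT x|lebesgue_on \<Omega>\<^sub>C. \<tau> x * divergence g x) \<le> tv \<tau>"
    if "\<tau> \<in> K\<^sub>h" "g \<in> test_fields \<Omega>\<^sub>C" for \<tau> g
    using total_variation_upper[OF that(2), of \<tau>] by (simp add: tv[OF that(1)])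
  have div_lim: "(\<lambda>j. LINT x|lebesgue_on \<Omega>\<^sub>C. \<sigma>k (r j) x * divergence g x)
      \<longlonglongrightarrow> (LINT x|lebesgue_on \<Omega>\<^sub>C. \<sigma> x * divergence g x)" if "g \<in> test_fields \<Omega>\<^sub>C" for g
    by (rule divergence_integral_tendsto[OF open_bd(2,3) K(2)[OF min(1)] lim that])
  have step: "misfit \<Omega> \<F> (E\<^sub>h (\<sigma>k (r j))) (Ek (r j)) + \<alpha> * (LINT x|lebesgue_on \<Omega>\<^sub>C. \<sigma>k (r j) x * divergence g x)
      \<le> misfit \<Omega> \<F> (E\<^sub>h \<tau>) (Ek (r j)) + \<alpha> * tv \<tau>"
    if "\<tau> \<in> K\<^sub>h" "g \<in> test_fields \<Omega>\<^sub>C" for \<tau> g j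
  proof -
    have "\<alpha> * (LINT x|lebesgue_on \<Omega>\<^sub>C. \<sigma>k (r j) x * divergence g x) \<le> \<alpha> * tv (\<sigma>k (r j))"
      using alpha by (intro mult_left_mono div_le[OF min(1) that(2)]) simp
    moreover have "misfit \<Omega> \<F> (E\<^sub>h (\<sigma>k (r j))) (Ek (r j)) + \<alpha> * tv (\<sigma>k (r j))
        \<le> misfit \<Omega> \<F> (E\<^sub>h \<tau>) (Ek (r j)) + \<alpha> * tv \<tau>"
      using min(2)[OF that(1), of "r j"] unfolding tv[OF that(1)] tv[OF min(1)] by simp
    ultimately show ?thesis by linarith
  qed
  have ER: "E\<^sub>h \<tau> \<in> R" if "\<tau> \<in> K\<^sub>h" for \<tau> using state that by (simp add: discrete_state_def)
  have data_r: "(\<lambda>j. surface_L2_norm \<F> (\<lambda>x. tangential \<Omega> (Ek (r j)) x - tangential \<Omega> Eobs x)) \<longlonglongrightarrow> 0"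
    using LIMSEQ_subseq_LIMSEQ[OF data_conv r] by (simp add: o_def)
  \<comment> \<open>The states stay arbitrary in this fact: it is used for the constant state of a
    competitor and later for the states of the minimizers.\<close>
  note misfit_lim = misfit_tendsto[OF Omega(1,3,2,4) mesh(1) spaces(1) Gamma(3,1) _ _ _ data observation data_r]
  have comp_lim: "(\<lambda>j. misfit \<Omega> \<F> (E\<^sub>h \<tau>) (Ek (r j))) \<longlonglongrightarrow> G \<tau>" if "\<tau> \<in> K\<^sub>h" for \<tau>
    unfolding objective by (rule misfit_lim) (auto intro: ER that)
  \<comment> \<open>Comparison with a single competitor bounds the variations along the sequence.\<close>
  have "total_variation \<Omega>\<^sub>C \<sigma> \<le> ereal ((G (\<sigma>k 0) + \<alpha> * tv (\<sigma>k 0)) / \<alpha>)"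
  proof (rule total_variation_least)
    fix g assume g: "g \<in> test_fields \<Omega>\<^sub>C"
    have "\<alpha> * (LINT x|lebesgue_on \<Omega>\<^sub>C. \<sigma> x * divergence g x) \<le> G (\<sigma>k 0) + \<alpha> * tv (\<sigma>k 0)"
    proof (rule LIMSEQ_le)
      show "(\<lambda>j. \<alpha> * (LINT x|lebesgue_on \<Omega>\<^sub>C. \<sigma>k (r j) x * divergence g x))
          \<longlonglongrightarrow> \<alpha> * (LINT x|lebesgue_on \<Omega>\<^sub>C. \<sigma> x * divergence g x)"
        by (intro tendsto_intros div_lim g)
      show "(\<lambda>j. misfit \<Omega> \<F> (E\<^sub>h (\<sigma>k 0)) (Ek (r j)) + \<alpha> * tv (\<sigma>k 0)) \<longlonglongrightarrow> G (\<sigma>k 0) + \<alpha> * tv (\<sigma>k 0)"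
        by (intro tendsto_intros comp_lim min(1))
      \<comment> \<open>Convergence of these misfits is not yet known, as it rests on the limit
        being in \<open>K\<^sub>h\<close>; discarding them as nonnegative still bounds the
        variation. The competitor \<open>\<sigma>k 0\<close> is an element of
        \<open>K\<^sub>h\<close> at hand.\<close>
      have "0 \<le> misfit \<Omega> \<F> (E\<^sub>h (\<sigma>k (r j))) (Ek (r j))" for j by (simp add: misfit_def)
      then show "\<exists>N. \<forall>j\<ge>N. \<alpha> * (LINT x|lebesgue_on \<Omega>\<^sub>C. \<sigma>k (r j) x * divergence g x)
          \<le> misfit \<Omega> \<F> (E\<^sub>h (\<sigma>k 0)) (Ek (r j)) + \<alpha> * tv (\<sigma>k 0)"
        using step[OF min(1) g, of _ 0] by (smt (verit))
    qed
    then show "ereal (LINT x|lebesgue_on \<Omega>\<^sub>C. \<sigma> x * divergence g x) \<le> ereal ((G (\<sigma>k 0) + \<alpha> * tv (\<sigma>k 0)) / \<alpha>)"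
      using alpha by (simp add: pos_le_divide_eq mult.commute)
  qed
  then have "total_variation \<Omega>\<^sub>C \<sigma> < \<infinity>" by (rule le_less_trans) simp
  then have "\<sigma> \<in> admissible \<Omega>\<^sub>C m M"
    using K[OF min(1)] unfolding spaces(3)
    by (intro admissible_limit[OF open_bd(2,3) mesh(3) _ _ lim])
  \<comment> \<open>Only now does unique solvability apply at the limit, which identifies the limit
    of the states as \<open>E\<^sub>h \<sigma>\<close>.\<close>
  then have \<sigma>K: "\<sigma> \<in> K\<^sub>h" using \<sigma>V by (simp add: constraint(3))
  define \<gamma> where "\<gamma> \<tau> x = \<tau> x + \<sigma>\<^sub>0 x" for \<tau> x
  have \<gamma>: "\<gamma> \<tau> \<in> Linf \<Omega>" if "\<tau> \<in> K\<^sub>h" for \<tau>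
    unfolding \<gamma>_def
  proof (rule Linf_add)
    show "\<tau> \<in> Linf \<Omega>" by (rule admissible_Linf[OF Omega(1) open_bd(2) parts(4) K(2)[OF that]])
    have "indicator \<Omega>\<^sub>C \<in> borel_measurable (lebesgue_on \<Omega>)"
      using open_bd(2) by (intro measurable_restrict_space1 borel_measurable_indicator) auto
    then have "(\<lambda>x. s\<^sub>0 * indicator \<Omega>\<^sub>C x) \<in> borel_measurable (lebesgue_on \<Omega>)" by measurable
    moreover have "AE x in lebesgue_on \<Omega>. norm (s\<^sub>0 * indicator \<Omega>\<^sub>C x :: real) \<le> \<bar>s\<^sub>0\<bar>"
      by (intro AE_I2) (simp add: abs_mult indicator_def)
    ultimately show "\<sigma>\<^sub>0 \<in> Linf \<Omega>" unfolding coefficients(7) by (rule LinfI)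
  qed
  have \<gamma>_lim: "uniform_limit \<Omega> (\<lambda>j. \<gamma> (\<sigma>k (r j))) (\<gamma> \<sigma>) sequentially"
  proof -
    have "uniform_limit UNIV (\<lambda>j x. \<sigma>k (r j) x + \<sigma>\<^sub>0 x) (\<lambda>x. \<sigma> x + \<sigma>\<^sub>0 x) sequentially"
      by (intro uniform_limit_add ul uniform_limit_const)
    then show ?thesis unfolding \<gamma>_def[abs_def] by (rule uniform_limit_on_subset) simp
  qed
  have \<epsilon>: "\<epsilon> \<in> Linf \<Omega>\<^sub>0"
  proof -
    obtain C where "\<And>x. x \<in> \<Omega>\<^sub>0 \<Longrightarrow> norm (\<epsilon> x) \<le> C" using coefficients(4) by (auto simp: bounded_iff)
    then have "AE x in lebesgue_on \<Omega>\<^sub>0. norm (\<epsilon> x) \<le> C" by (intro AE_I2) simp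
    with coefficients(3) show ?thesis by (rule LinfI)
  qed
  have st: "discrete_state \<Omega> \<Omega>\<^sub>0 \<mu> \<epsilon> \<omega> J R U (\<gamma> \<tau>) (E\<^sub>h \<tau>)" if "\<tau> \<in> K\<^sub>h" for \<tau>
    using state that by (simp add: \<gamma>_def[abs_def])
  have uniq: "F = E\<^sub>h \<sigma>" if "discrete_state \<Omega> \<Omega>\<^sub>0 \<mu> \<epsilon> \<omega> J R U (\<gamma> \<sigma>) F" for F
    using bspec[OF well_posed \<sigma>K] st[OF \<sigma>K] that unfolding \<gamma>_def[abs_def] by blast
  have state_lim: "(\<lambda>j. L (E\<^sub>h (\<sigma>k (r j)))) \<longlonglongrightarrow> L (E\<^sub>h \<sigma>)" if "L \<in> lin_functionals R" for L
    by (rule discrete_state_tendsto[OF Omega(1,3) open_bd(1) parts(3) mesh(1,2) spaces(1,2) \<epsilon>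
          \<gamma>[OF min(1)] \<gamma>[OF \<sigma>K] \<gamma>_lim st[OF min(1)] st[OF \<sigma>K] uniq that])
  have G_lim: "(\<lambda>j. misfit \<Omega> \<F> (E\<^sub>h (\<sigma>k (r j))) (Ek (r j))) \<longlonglongrightarrow> G \<sigma>"
    unfolding objective by (rule misfit_lim[OF ER[OF min(1)] ER[OF \<sigma>K] state_lim])
  have "ereal (G \<sigma>) + ereal \<alpha> * total_variation \<Omega>\<^sub>C \<sigma> \<le> ereal (G \<tau>) + ereal \<alpha> * total_variation \<Omega>\<^sub>C \<tau>"
    if \<tau>: "\<tau> \<in> K\<^sub>h" for \<tau>
  proof -
    \<comment> \<open>Moving \<open>G \<sigma>\<close> to the right and dividing by the positive
      \<alpha> isolates the variation, so that one constant bounds the supremum over all test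
      fields.\<close>
    have "total_variation \<Omega>\<^sub>C \<sigma> \<le> ereal ((G \<tau> + \<alpha> * tv \<tau> - G \<sigma>) / \<alpha>)"
    proof (rule total_variation_least)
      fix g assume g: "g \<in> test_fields \<Omega>\<^sub>C"
      have "G \<sigma> + \<alpha> * (LINT x|lebesgue_on \<Omega>\<^sub>C. \<sigma> x * divergence g x) \<le> G \<tau> + \<alpha> * tv \<tau>"
      proof (rule LIMSEQ_le)
        show "(\<lambda>j. misfit \<Omega> \<F> (E\<^sub>h (\<sigma>k (r j))) (Ek (r j)) + \<alpha> * (LINT x|lebesgue_on \<Omega>\<^sub>C. \<sigma>k (r j) x * divergence g x))
            \<longlonglongrightarrow> G \<sigma> + \<alpha> * (LINT x|lebesgue_on \<Omega>\<^sub>C. \<sigma> x * divergence g x)"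
          by (intro tendsto_intros div_lim g G_lim)
        show "(\<lambda>j. misfit \<Omega> \<F> (E\<^sub>h \<tau>) (Ek (r j)) + \<alpha> * tv \<tau>) \<longlonglongrightarrow> G \<tau> + \<alpha> * tv \<tau>"
          by (intro tendsto_intros comp_lim \<tau>)
      qed (use step[OF \<tau> g] in blast)
      then show "ereal (LINT x|lebesgue_on \<Omega>\<^sub>C. \<sigma> x * divergence g x) \<le> ereal ((G \<tau> + \<alpha> * tv \<tau> - G \<sigma>) / \<alpha>)"
        using alpha by (simp add: pos_le_divide_eq algebra_simps)
    qed
    then have "G \<sigma> + \<alpha> * tv \<sigma> \<le> G \<tau> + \<alpha> * tv \<tau>"
      using alpha by (simp add: tv[OF \<sigma>K] pos_le_divide_eq algebra_simps)
    then show ?thesis by (simp add: tv[OF \<sigma>K] tv[OF \<tau>])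
  qed
  then show ?thesis using \<sigma>K by (simp add: is_arg_min_linorder)
qed

end
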